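(* The theory $\mathrm{RCA}_0^{\Omega}$ proves the equivalences $$(\exists^{2})^{\mathrm{st}}\leftrightarrow \Pi^0_1\text{-TRANS}\leftrightarrow \mathrm{IVT}^{*}\leftrightarrow \text{E-UIVT}^{\mathrm{st}}.$$
   Context: BASE THEORY. Finite types: $0$ (natural numbers), $\sigma\to\tau$, and $\sigma^{*}$ (finite sequences of objects of type $\sigma$); $1=0\to 0$, $2=1\to 0$, $3=2\to 0$. Superscripts indicate types; tuples are coded as single objects where convenient. Equality $=_0$ is primitive; for $\tau=\tau_1\to\dots\to\tau_k\to 0$, $x=_\tau y$ means $(\forall z_1\dots z_k)(xz_1\dots z_k=_0 yz_1\dots z_k)$. $\mathrm{RCA}_0^{\omega}$ is Kohlenbach's higher-order base theory: classical arithmetic in all finite types with combinators, zero, successor, the recursor $R_0$ (primitive recursion with type $0$ values), quantifier-free induction, extensionality $x=_\rho y\to\varphi(x)=_\tau\varphi(y)$ for all $\varphi^{\rho\to\tau}$, and $\mathrm{QF\text{-}AC}^{1,0}$, where $\mathrm{QF\text{-}AC}^{\sigma,\tau}$ is $(\forall x^\sigma)(\exists y^\tau)A_0(x,y)\to(\exists F^{\sigma\to\tau})(\forall x)A_0(x,F(x))$ for quantifier-free $A_0$. $\mathrm{RCA}_0^{\Omega}$ extends $\mathrm{RCA}_0^{\omega}$ (with the types $\sigma^*$) by a predicate $\mathrm{st}$ ("is standard") for each type. A formula is internal if it does not contain $\mathrm{st}$; $(\forall^{\mathrm{st}}x)A$ is $(\forall x)(\mathrm{st}(x)\to A)$, $(\exists^{\mathrm{st}}x)A$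 is $(\exists x)(\mathrm{st}(x)\wedge A)$; $N\in\Omega$ means $\neg\mathrm{st}(N^0)$. Axioms: (i) standardness respects equality, closed terms are standard, a standard functional applied to a standard object is standard, and numbers below a standard number are standard; (ii) Idealization: $(\forall^{\mathrm{st}}x^{\sigma^*})(\exists y^\tau)(\forall z\in x)\varphi(z,y)\to(\exists y)(\forall^{\mathrm{st}}z^{\sigma})\varphi(z,y)$ for internal $\varphi$; (iii) $\mathrm{HAC}_{\mathrm{int}}$: $(\forall^{\mathrm{st}}x^{\rho})(\exists^{\mathrm{st}}y^{\tau})\varphi(x,y)\to(\exists^{\mathrm{st}}\Phi^{\rho\to\tau^*})(\forall^{\mathrm{st}}x)(\exists y\in\Phi(x))\varphi(x,y)$ for internal $\varphi$; (iv) $\mathrm{PF\text{-}TP}_\forall$: $(\forall^{\mathrm{st}}x^\tau)\varphi(x)\to(\forall x^\tau)\varphi(x)$ for internal $\varphi(x)$ with no parameters other than $x$; (v) for certain functionals uniquely specified by a parameter-free internal formula $D$ (e.g. the one in $(\exists^2)$), a constant $\Xi_0$ with the axiom $\mathrm{st}(\Xi_0)\wedge(\forall^{\mathrm{st}}\Xi)[D^{\mathrm{st}}(\Xi)\to \Xi_0$ and $\Xi$ agree on all standard inputs$]$; these constants do not count as parameters in (iv). NOTATION. $A^{\mathrm{st}}$ is $A$ with all quantifiers (except bounded number quantifiers) relativised to $\mathrm{st}$. For $\tau=\tau_1\to\dots\to\tau_k\to 0$, $x\approx_\tau y$ means $(\forall^{\mathrm{st}}z_1^{\tau_1}\dots z_k^{\tau_k})(xz_1\dots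 z_k=_0yz_1\dots z_k)$. If $\mathrm{AX}^{\mathrm{st}}$ is $(\exists^{\mathrm{st}}\Phi^{\rho\to\tau})A^{\mathrm{st}}(\Phi)$, then $\text{E-AX}^{\mathrm{st}}$ states that there is such a standard $\Phi$ which is moreover standard extensional: $(\forall^{\mathrm{st}}x^\rho,y^\rho)(x\approx_\rho y\to\Phi(x)\approx_\tau\Phi(y))$. A real is a fast-converging Cauchy sequence of rationals $q_{(\cdot)}^1$, i.e. $(\forall n,i)(|q_n-q_{n+i}|<2^{-n})$ (via a standard trick every $f^1$ can be viewed as a real); reals $q_{(\cdot)},r_{(\cdot)}$ are equal if $(\forall n)(|q_n-r_n|\leq 2^{-n})$. Functions from reals to reals are given by functionals of type $1\to1$ mapping equal reals to equal reals. $f\in C[0,1]$ means $f$ is $\varepsilon$-$\delta$-continuous on $[0,1]$; $f\in\overline{C}[0,1]$ means $f\in C[0,1]$, $f(0)\geq0$ and $f(1)\leq 0$; $C^{\mathrm{st}}[0,1]$, $\overline{C}^{\mathrm{st}}[0,1]$ are defined by the same formulas with all quantifiers relative to $\mathrm{st}$. PRINCIPLES. $(\exists^2)$: $(\exists\varphi^2)(\forall g^1)[(\exists x^0)g(x)=0\leftrightarrow\varphi(g)=0]$. $\Pi^0_1\text{-TRANS}$: $(\forall^{\mathrm{st}}f^1)[(\forall^{\mathrm{st}}n^0)f(n)=0\to(\forall n^0)f(n)=0]$. $\mathrm{IVT}^*$: $(\forall^{\mathrm{st}}f^{1\to1}\in\overline{C}^{\mathrm{st}}[0,1])(\exists^{\mathrm{st}}x^1\in[0,1])(f(x)=0)$,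 where $f(x)=0$ is (full, internal) equality of reals. $\mathrm{UIVT}$: $(\exists\Phi^{(1\to1)\to1})(\forall f^{1\to1}\in\overline{C}[0,1])(f(\Phi(f))=0)$ (so that in $\mathrm{UIVT}^{\mathrm{st}}$ the equality is also relativised to $\mathrm{st}$). *)

theory Defs
  imports Main
begin

text \<open>
  A deep embedding of the theories RCA$_0^\omega$ and RCA$_0^\Omega$: finite types, terms over
  typed combinators, first-order formulas with a standardness predicate, a Hilbert calculus for
  classical many-sorted logic, and the axioms.
\<close>

section \<open>Types, terms, formulas\<close>

datatype ty = T0 | Fn ty ty (infixr "\<rightarrow>" 65) | Sq ty

abbreviation T1 :: ty where "T1 \<equiv> T0 \<rightarrow> T0"
abbreviation T2 :: ty where "T2 \<equiv> T1 \<rightarrow> T0"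

text \<open>
  \<open>Pi\<close> and \<open>Sig\<close> are the combinators, \<open>Rec\<close> is the recursor $R_0$.  The types \<open>Sq \<sigma>\<close> of finite
  sequences come with length, entries, and \<open>Seg f n\<close> $= \langle f(0),\dots,f(n-1)\rangle$.
  \<open>Xi \<sigma> i\<close> are the names available for the constants $\Xi_0$ of type \<open>\<sigma>\<close>; which of them belong to
  the language is determined by a signature (see below).
\<close>

datatype cst =
    Zero | Succ | Rec
  | Pi ty ty | Sig ty ty ty
  | Len ty | Entry ty | Seg ty
  | Xi ty nat

primrec cty :: "cst \<Rightarrow> ty" where
  "cty Zero = T0"
| "cty Succ = T0 \<rightarrow> T0"
| "cty Rec = T0 \<rightarrow> (T0 \<rightarrow> T0 \<rightarrow> T0) \<rightarrow> T0 \<rightarrow> T0"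
| "cty (Pi \<rho> \<sigma>) = \<rho> \<rightarrow> \<sigma> \<rightarrow> \<rho>"
| "cty (Sig \<rho> \<sigma> \<tau>) = (\<rho> \<rightarrow> \<sigma> \<rightarrow> \<tau>) \<rightarrow> (\<rho> \<rightarrow> \<sigma>) \<rightarrow> \<rho> \<rightarrow> \<tau>"
| "cty (Len \<sigma>) = Sq \<sigma> \<rightarrow> T0"
| "cty (Entry \<sigma>) = Sq \<sigma> \<rightarrow> T0 \<rightarrow> \<sigma>"
| "cty (Seg \<sigma>) = (T0 \<rightarrow> \<sigma>) \<rightarrow> T0 \<rightarrow> Sq \<sigma>"
| "cty (Xi \<sigma> i) = \<sigma>"

text \<open>
  Variables are de Bruijn indices with a separate index space for every type: inside a formula,
  \<open>Var \<sigma> i\<close> refers to the \<open>i\<close>-th enclosing quantifier over type \<open>\<sigma>\<close>; quantifiers over other types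
  are not counted.
\<close>

datatype tm = Var ty nat | Cn cst | App tm tm (infixl "\<cdot>" 90)

datatype fm =
    Eq tm tm (infix "\<^bold>=" 50)
  | St tm
  | Fls
  | Imp fm fm (infixr "\<^bold>\<longrightarrow>" 25)
  | Forall ty fm ("(\<^bold>\<forall>_./ _)" [100, 10] 10)

abbreviation Neg ("\<^bold>\<not> _" [40] 40) where "\<^bold>\<not> A \<equiv> A \<^bold>\<longrightarrow> Fls"
abbreviation Conj (infixr "\<^bold>\<and>" 35) where "A \<^bold>\<and> B \<equiv> \<^bold>\<not> (A \<^bold>\<longrightarrow> \<^bold>\<not> B)"
abbreviation Iff (infixr "\<^bold>\<longleftrightarrow>" 25) where "A \<^bold>\<longleftrightarrow> B \<equiv> (A \<^bold>\<longrightarrow> B) \<^bold>\<and> (B \<^bold>\<longrightarrow> A)"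
abbreviation Exists ("(\<^bold>\<exists>_./ _)" [100, 10] 10) where "\<^bold>\<exists>\<sigma>. A \<equiv> \<^bold>\<not> (\<^bold>\<forall>\<sigma>. \<^bold>\<not> A)"

text \<open>
  A signature selects the constants \<open>Xi \<sigma> i\<close> of the language, each with the formula
  (with free variable \<open>Var \<sigma> 0\<close>) that specifies it.
\<close>

type_synonym sig = "ty \<Rightarrow> nat \<Rightarrow> fm option"

abbreviation no_Xi :: sig where "no_Xi \<equiv> \<lambda>_ _. None"

primrec ty_of :: "tm \<Rightarrow> ty" where
  "ty_of (Var \<sigma> i) = \<sigma>"
| "ty_of (Cn c) = cty c"
| "ty_of (t \<cdot> u) = (case ty_of t of \<sigma> \<rightarrow> \<tau> \<Rightarrow> \<tau> | _ \<Rightarrow> T0)"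

primrec wt :: "sig \<Rightarrow> tm \<Rightarrow> bool" where
  "wt D (Var \<sigma> i) \<longleftrightarrow> True"
| "wt D (Cn c) \<longleftrightarrow> (case c of Xi \<sigma> i \<Rightarrow> D \<sigma> i \<noteq> None | _ \<Rightarrow> True)"
| "wt D (t \<cdot> u) \<longleftrightarrow> wt D t \<and> wt D u \<and> (case ty_of t of \<sigma> \<rightarrow> \<tau> \<Rightarrow> ty_of u = \<sigma> | _ \<Rightarrow> False)"

primrec wf :: "sig \<Rightarrow> fm \<Rightarrow> bool" where
  "wf D (t \<^bold>= u) \<longleftrightarrow> wt D t \<and> wt D u \<and> ty_of t = T0 \<and> ty_of u = T0"
| "wf D (St t) \<longleftrightarrow> wt D t"
| "wf D Fls \<longleftrightarrow> True"
| "wf D (A \<^bold>\<longrightarrow> B) \<longleftrightarrow> wf D A \<and> wf D B"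
| "wf D (\<^bold>\<forall>\<sigma>. A) \<longleftrightarrow> wf D A"

primrec fv_tm :: "tm \<Rightarrow> (ty \<times> nat) set" where
  "fv_tm (Var \<sigma> i) = {(\<sigma>, i)}"
| "fv_tm (Cn c) = {}"
| "fv_tm (t \<cdot> u) = fv_tm t \<union> fv_tm u"

primrec fv :: "fm \<Rightarrow> (ty \<times> nat) set" where
  "fv (t \<^bold>= u) = fv_tm t \<union> fv_tm u"
| "fv (St t) = fv_tm t"
| "fv Fls = {}"
| "fv (A \<^bold>\<longrightarrow> B) = fv A \<union> fv B"
| "fv (\<^bold>\<forall>\<sigma>. A) = {(\<tau>, i). (\<tau>, if \<tau> = \<sigma> then Suc i else i) \<in> fv A}"

primrec internal :: "fm \<Rightarrow> bool" where
  "internal (t \<^bold>= u) \<longleftrightarrow> True"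
| "internal (St t) \<longleftrightarrow> False"
| "internal Fls \<longleftrightarrow> True"
| "internal (A \<^bold>\<longrightarrow> B) \<longleftrightarrow> internal A \<and> internal B"
| "internal (\<^bold>\<forall>\<sigma>. A) \<longleftrightarrow> internal A"

primrec qfree :: "fm \<Rightarrow> bool" where
  "qfree (t \<^bold>= u) \<longleftrightarrow> True"
| "qfree (St t) \<longleftrightarrow> False"
| "qfree Fls \<longleftrightarrow> True"
| "qfree (A \<^bold>\<longrightarrow> B) \<longleftrightarrow> qfree A \<and> qfree B"
| "qfree (\<^bold>\<forall>\<sigma>. A) \<longleftrightarrow> False"

subsection \<open>Substitution\<close>

text \<open>\<open>lift \<sigma> t\<close> is \<open>t\<close> moved under one additional quantifier over type \<open>\<sigma>\<close>.\<close>

primrec lift :: "ty \<Rightarrow> tm \<Rightarrow> tm" where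
  "lift \<sigma> (Var \<tau> i) = Var \<tau> (if \<tau> = \<sigma> then Suc i else i)"
| "lift \<sigma> (Cn c) = Cn c"
| "lift \<sigma> (t \<cdot> u) = lift \<sigma> t \<cdot> lift \<sigma> u"

type_synonym subst = "ty \<Rightarrow> nat \<Rightarrow> tm"

definition shift :: "ty \<Rightarrow> subst" where
  "shift \<sigma> = (\<lambda>\<tau> i. lift \<sigma> (Var \<tau> i))"

definition inst :: "ty \<Rightarrow> tm \<Rightarrow> subst" where
  "inst \<sigma> t = (\<lambda>\<tau> i. if \<tau> = \<sigma> then (case i of 0 \<Rightarrow> t | Suc j \<Rightarrow> Var \<tau> j) else Var \<tau> i)"

definition push :: "ty \<Rightarrow> subst \<Rightarrow> subst" where
  "push \<sigma> s = (\<lambda>\<tau> i. if \<tau> = \<sigma>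
     then (case i of 0 \<Rightarrow> Var \<tau> 0 | Suc j \<Rightarrow> lift \<sigma> (s \<tau> j)) else lift \<sigma> (s \<tau> i))"

text \<open>Unlike \<open>inst\<close>, this does not remove a quantifier: only one variable changes.\<close>

definition replace :: "ty \<Rightarrow> nat \<Rightarrow> tm \<Rightarrow> subst" where
  "replace \<sigma> k t = (\<lambda>\<tau> i. if \<tau> = \<sigma> \<and> i = k then t else Var \<tau> i)"

primrec subst_tm :: "subst \<Rightarrow> tm \<Rightarrow> tm" where
  "subst_tm s (Var \<sigma> i) = s \<sigma> i"
| "subst_tm s (Cn c) = Cn c"
| "subst_tm s (t \<cdot> u) = subst_tm s t \<cdot> subst_tm s u"

primrec subst_fm :: "subst \<Rightarrow> fm \<Rightarrow> fm" where
  "subst_fm s (t \<^bold>= u) = (subst_tm s t \<^bold>= subst_tm s u)"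
| "subst_fm s (St t) = St (subst_tm s t)"
| "subst_fm s Fls = Fls"
| "subst_fm s (A \<^bold>\<longrightarrow> B) = (subst_fm s A \<^bold>\<longrightarrow> subst_fm s B)"
| "subst_fm s (\<^bold>\<forall>\<sigma>. A) = (\<^bold>\<forall>\<sigma>. subst_fm (push \<sigma> s) A)"

section \<open>Derivability\<close>

text \<open>Free variables of the non-logical axioms in \<open>T\<close> are read universally.\<close>

inductive proves :: "sig \<Rightarrow> fm set \<Rightarrow> fm \<Rightarrow> bool" for D :: sig and T :: "fm set" where
  axiom: "A \<in> T \<Longrightarrow> proves D T A"
| imp_K: "wf D A \<Longrightarrow> wf D B \<Longrightarrow> proves D T (A \<^bold>\<longrightarrow> B \<^bold>\<longrightarrow> A)"
| imp_S: "wf D A \<Longrightarrow> wf D B \<Longrightarrow> wf D C \<Longrightarrow>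
    proves D T ((A \<^bold>\<longrightarrow> B \<^bold>\<longrightarrow> C) \<^bold>\<longrightarrow> (A \<^bold>\<longrightarrow> B) \<^bold>\<longrightarrow> A \<^bold>\<longrightarrow> C)"
| classical: "wf D A \<Longrightarrow> proves D T (\<^bold>\<not> (\<^bold>\<not> A) \<^bold>\<longrightarrow> A)"
| all_inst: "wf D A \<Longrightarrow> wt D t \<Longrightarrow> ty_of t = \<sigma> \<Longrightarrow>
    proves D T ((\<^bold>\<forall>\<sigma>. A) \<^bold>\<longrightarrow> subst_fm (inst \<sigma> t) A)"
| all_imp: "wf D A \<Longrightarrow> wf D B \<Longrightarrow>
    proves D T ((\<^bold>\<forall>\<sigma>. (subst_fm (shift \<sigma>) A \<^bold>\<longrightarrow> B)) \<^bold>\<longrightarrow> A \<^bold>\<longrightarrow> (\<^bold>\<forall>\<sigma>. B))"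
| mp: "proves D T (A \<^bold>\<longrightarrow> B) \<Longrightarrow> proves D T A \<Longrightarrow> proves D T B"
| gen: "proves D T A \<Longrightarrow> proves D T (\<^bold>\<forall>\<sigma>. A)"

section \<open>Arithmetical terms\<close>

text \<open>
  \<open>lam \<sigma> t\<close> is bracket abstraction: it abstracts \<open>Var \<sigma> 0\<close> from \<open>t\<close> and lowers the remaining
  variables of type \<open>\<sigma>\<close>, so \<open>lam\<close> binds like the quantifiers do.
\<close>

definition const_lam :: "ty \<Rightarrow> tm \<Rightarrow> tm" where
  "const_lam \<sigma> t = Cn (Pi (ty_of t) \<sigma>) \<cdot> subst_tm (inst \<sigma> (Var \<sigma> 0)) t"

primrec lam :: "ty \<Rightarrow> tm \<Rightarrow> tm" where
  "lam \<sigma> (Var \<tau> i) = (if \<tau> = \<sigma> \<and> i = 0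
     then Cn (Sig \<sigma> (\<sigma> \<rightarrow> \<sigma>) \<sigma>) \<cdot> Cn (Pi \<sigma> (\<sigma> \<rightarrow> \<sigma>)) \<cdot> Cn (Pi \<sigma> \<sigma>)
     else const_lam \<sigma> (Var \<tau> i))"
| "lam \<sigma> (Cn c) = const_lam \<sigma> (Cn c)"
| "lam \<sigma> (t \<cdot> u) = (if (\<sigma>, 0) \<in> fv_tm (t \<cdot> u)
     then Cn (Sig \<sigma> (ty_of u) (ty_of (t \<cdot> u))) \<cdot> lam \<sigma> t \<cdot> lam \<sigma> u
     else const_lam \<sigma> (t \<cdot> u))"

abbreviation zero :: tm where "zero \<equiv> Cn Zero"
abbreviation suc :: "tm \<Rightarrow> tm" where "suc t \<equiv> Cn Succ \<cdot> t"
abbreviation v :: "nat \<Rightarrow> tm" where "v i \<equiv> Var T0 i"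

text \<open>
  \<open>rec a h n\<close> has the value \<open>a\<close> at \<open>0\<close>; in the step term \<open>h\<close>, \<open>v 0\<close> is the predecessor \<open>k\<close> of the
  current argument, \<open>v 1\<close> is the value at \<open>k\<close>, and \<open>v (i + 2)\<close> is the ambient variable \<open>v i\<close>.
\<close>

abbreviation rec :: "tm \<Rightarrow> tm \<Rightarrow> tm \<Rightarrow> tm" where
  "rec a h n \<equiv> Cn Rec \<cdot> a \<cdot> lam T0 (lam T0 h) \<cdot> n"

definition add_c :: tm where "add_c = lam T0 (lam T0 (rec (v 1) (suc (v 1)) (v 0)))"
abbreviation add :: "tm \<Rightarrow> tm \<Rightarrow> tm" where "add t u \<equiv> add_c \<cdot> t \<cdot> u"

definition mult_c :: tm where "mult_c = lam T0 (lam T0 (rec zero (add (v 1) (v 3)) (v 0)))"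
abbreviation mult :: "tm \<Rightarrow> tm \<Rightarrow> tm" where "mult t u \<equiv> mult_c \<cdot> t \<cdot> u"

definition pred_c :: tm where "pred_c = lam T0 (rec zero (v 0) (v 0))"

text \<open>Truncated subtraction.\<close>

definition monus_c :: tm where "monus_c = lam T0 (lam T0 (rec (v 1) (pred_c \<cdot> v 1) (v 0)))"
abbreviation monus :: "tm \<Rightarrow> tm \<Rightarrow> tm" where "monus t u \<equiv> monus_c \<cdot> t \<cdot> u"

definition dist_c :: tm where
  "dist_c = lam T0 (lam T0 (add (monus (v 1) (v 0)) (monus (v 0) (v 1))))"
abbreviation dist :: "tm \<Rightarrow> tm \<Rightarrow> tm" where "dist t u \<equiv> dist_c \<cdot> t \<cdot> u"

definition pow2_c :: tm where "pow2_c = lam T0 (rec (suc zero) (add (v 1) (v 1)) (v 0))"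
abbreviation pow2 :: "tm \<Rightarrow> tm" where "pow2 t \<equiv> pow2_c \<cdot> t"

text \<open>\<open>cond c a b\<close> is \<open>a\<close> if \<open>c\<close> is \<open>0\<close>, and \<open>b\<close> otherwise.\<close>

definition cond_c :: tm where
  "cond_c = lam T0 (lam T0 (lam T0 (rec (v 1) (v 2) (v 2))))"
abbreviation cond :: "tm \<Rightarrow> tm \<Rightarrow> tm \<Rightarrow> tm" where "cond c a b \<equiv> cond_c \<cdot> c \<cdot> a \<cdot> b"

text \<open>$\sum_{k<n} g(k)$\<close>

definition sum_c :: tm where
  "sum_c = lam T1 (lam T0 (rec zero (add (v 1) (Var T1 0 \<cdot> v 0)) (v 0)))"
abbreviation sum_below :: "tm \<Rightarrow> tm \<Rightarrow> tm" where "sum_below g n \<equiv> sum_c \<cdot> g \<cdot> n"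

text \<open>
  Cantor pairing; \<open>root_c \<cdot> z\<close> is the largest \<open>w\<close> with $w(w+1)/2 \le z$, i.e. the sum of the two
  components of \<open>z\<close>.
\<close>

definition tri_c :: tm where "tri_c = lam T0 (rec zero (add (v 1) (suc (v 0))) (v 0))"

definition pair_c :: tm where
  "pair_c = lam T0 (lam T0 (add (tri_c \<cdot> add (v 1) (v 0)) (v 1)))"
abbreviation pair :: "tm \<Rightarrow> tm \<Rightarrow> tm" where "pair t u \<equiv> pair_c \<cdot> t \<cdot> u"

definition root_c :: tm where
  "root_c = lam T0 (rec zero
     (cond (monus (tri_c \<cdot> suc (v 1)) (suc (v 0))) (suc (v 1)) (v 1)) (v 0))"

definition fst_c :: tm where
  "fst_c = lam T0 (monus (v 0) (tri_c \<cdot> (root_c \<cdot> v 0)))"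

definition snd_c :: tm where
  "snd_c = lam T0 (monus (root_c \<cdot> v 0) (fst_c \<cdot> v 0))"

section \<open>Formula abbreviations\<close>

definition le :: "tm \<Rightarrow> tm \<Rightarrow> fm" where "le t u = (monus t u \<^bold>= zero)"
definition lt :: "tm \<Rightarrow> tm \<Rightarrow> fm" where "lt t u = (monus (suc t) u \<^bold>= zero)"

text \<open>Bounded number quantification $(\forall i<t)A$, where \<open>A\<close> lives below the quantifier but \<open>t\<close> does not.\<close>

definition ball :: "tm \<Rightarrow> fm \<Rightarrow> fm" where
  "ball t A = (\<^bold>\<forall>T0. (lt (v 0) (lift T0 t) \<^bold>\<longrightarrow> A))"

definition bex :: "tm \<Rightarrow> fm \<Rightarrow> fm" where
  "bex t A = (\<^bold>\<not> ball t (\<^bold>\<not> A))"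

text \<open>Extensional equality; on sequences, equal length and equal entries.\<close>

primrec eqt :: "ty \<Rightarrow> tm \<Rightarrow> tm \<Rightarrow> fm" where
  "eqt T0 t u = (t \<^bold>= u)"
| "eqt (\<sigma> \<rightarrow> \<tau>) t u = (\<^bold>\<forall>\<sigma>. eqt \<tau> (lift \<sigma> t \<cdot> Var \<sigma> 0) (lift \<sigma> u \<cdot> Var \<sigma> 0))"
| "eqt (Sq \<sigma>) t u = ((Cn (Len \<sigma>) \<cdot> t \<^bold>= Cn (Len \<sigma>) \<cdot> u) \<^bold>\<and>
     ball (Cn (Len \<sigma>) \<cdot> t)
       (eqt \<sigma> (Cn (Entry \<sigma>) \<cdot> lift T0 t \<cdot> v 0) (Cn (Entry \<sigma>) \<cdot> lift T0 u \<cdot> v 0)))"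

text \<open>\<open>elem \<sigma> z x\<close> is $z \in x$ for a sequence \<open>x\<close> of type $\sigma^*$.\<close>

definition elem :: "ty \<Rightarrow> tm \<Rightarrow> tm \<Rightarrow> fm" where
  "elem \<sigma> z x = bex (Cn (Len \<sigma>) \<cdot> x) (eqt \<sigma> (lift T0 z) (Cn (Entry \<sigma>) \<cdot> lift T0 x \<cdot> v 0))"

definition all_st :: "ty \<Rightarrow> fm \<Rightarrow> fm" ("(\<^bold>\<forall>st_./ _)" [100, 10] 10) where
  "(\<^bold>\<forall>st \<sigma>. A) = (\<^bold>\<forall>\<sigma>. (St (Var \<sigma> 0) \<^bold>\<longrightarrow> A))"

definition ex_st :: "ty \<Rightarrow> fm \<Rightarrow> fm" ("(\<^bold>\<exists>st_./ _)" [100, 10] 10) where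
  "(\<^bold>\<exists>st \<sigma>. A) = (\<^bold>\<exists>\<sigma>. (St (Var \<sigma> 0) \<^bold>\<and> A))"

text \<open>The relativisation $A^{\mathrm{st}}$; bounded number quantifiers are left alone.\<close>

definition bounded_body :: "fm \<Rightarrow> bool" where
  "bounded_body A \<longleftrightarrow> (\<exists>t B. A = (lt (v 0) (lift T0 t) \<^bold>\<longrightarrow> B))"

primrec relat :: "fm \<Rightarrow> fm" where
  "relat (t \<^bold>= u) = (t \<^bold>= u)"
| "relat (St t) = St t"
| "relat Fls = Fls"
| "relat (A \<^bold>\<longrightarrow> B) = (relat A \<^bold>\<longrightarrow> relat B)"
| "relat (\<^bold>\<forall>\<sigma>. A) =
    (if \<sigma> = T0 \<and> bounded_body A then \<^bold>\<forall>\<sigma>. relat A else \<^bold>\<forall>st \<sigma>. relat A)"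

definition approx :: "ty \<Rightarrow> tm \<Rightarrow> tm \<Rightarrow> fm" where
  "approx \<tau> t u = relat (eqt \<tau> t u)"

section \<open>The theories\<close>

inductive_set RCA0_omega :: "sig \<Rightarrow> fm set" for D :: sig where
  eq_refl: "(v 0 \<^bold>= v 0) \<in> RCA0_omega D"
| eq_sym: "(v 0 \<^bold>= v 1 \<^bold>\<longrightarrow> v 1 \<^bold>= v 0) \<in> RCA0_omega D"
| eq_trans: "(v 0 \<^bold>= v 1 \<^bold>\<longrightarrow> v 1 \<^bold>= v 2 \<^bold>\<longrightarrow> v 0 \<^bold>= v 2) \<in> RCA0_omega D"
| extensionality:
    "(eqt \<rho> (Var \<rho> 0) (Var \<rho> 1) \<^bold>\<longrightarrow>
      eqt \<tau> (Var (\<rho> \<rightarrow> \<tau>) 0 \<cdot> Var \<rho> 0) (Var (\<rho> \<rightarrow> \<tau>) 0 \<cdot> Var \<rho> 1)) \<in> RCA0_omega D"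
| suc_not_zero: "(\<^bold>\<not> (suc (v 0) \<^bold>= zero)) \<in> RCA0_omega D"
| suc_inject: "(suc (v 0) \<^bold>= suc (v 1) \<^bold>\<longrightarrow> v 0 \<^bold>= v 1) \<in> RCA0_omega D"
| comb_Pi: "eqt \<rho> (Cn (Pi \<rho> \<sigma>) \<cdot> Var \<rho> 0 \<cdot> Var \<sigma> 1) (Var \<rho> 0) \<in> RCA0_omega D"
| comb_Sig:
    "eqt \<tau> (Cn (Sig \<rho> \<sigma> \<tau>) \<cdot> Var (\<rho> \<rightarrow> \<sigma> \<rightarrow> \<tau>) 0 \<cdot> Var (\<rho> \<rightarrow> \<sigma>) 1 \<cdot> Var \<rho> 2)
      (Var (\<rho> \<rightarrow> \<sigma> \<rightarrow> \<tau>) 0 \<cdot> Var \<rho> 2 \<cdot> (Var (\<rho> \<rightarrow> \<sigma>) 1 \<cdot> Var \<rho> 2)) \<in> RCA0_omega D"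
| rec_zero: "(Cn Rec \<cdot> v 0 \<cdot> Var (T0 \<rightarrow> T0 \<rightarrow> T0) 0 \<cdot> zero \<^bold>= v 0) \<in> RCA0_omega D"
| rec_suc:
    "(Cn Rec \<cdot> v 0 \<cdot> Var (T0 \<rightarrow> T0 \<rightarrow> T0) 0 \<cdot> suc (v 1) \<^bold>=
      Var (T0 \<rightarrow> T0 \<rightarrow> T0) 0 \<cdot> (Cn Rec \<cdot> v 0 \<cdot> Var (T0 \<rightarrow> T0 \<rightarrow> T0) 0 \<cdot> v 1) \<cdot> v 1) \<in> RCA0_omega D"
| len_seg: "(Cn (Len \<sigma>) \<cdot> (Cn (Seg \<sigma>) \<cdot> Var (T0 \<rightarrow> \<sigma>) 0 \<cdot> v 0) \<^bold>= v 0) \<in> RCA0_omega D"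
| entry_seg:
    "(lt (v 1) (v 0) \<^bold>\<longrightarrow>
      eqt \<sigma> (Cn (Entry \<sigma>) \<cdot> (Cn (Seg \<sigma>) \<cdot> Var (T0 \<rightarrow> \<sigma>) 0 \<cdot> v 0) \<cdot> v 1)
        (Var (T0 \<rightarrow> \<sigma>) 0 \<cdot> v 1)) \<in> RCA0_omega D"
| qf_induction:
    "wf D A \<Longrightarrow> qfree A \<Longrightarrow>
      (subst_fm (inst T0 zero) A \<^bold>\<longrightarrow>
       (\<^bold>\<forall>T0. (A \<^bold>\<longrightarrow> subst_fm (replace T0 0 (suc (v 0))) A)) \<^bold>\<longrightarrow> (\<^bold>\<forall>T0. A)) \<in> RCA0_omega D"
  \<comment> \<open>QF-AC$^{1,0}$. In \<open>A\<close>, \<open>Var T1 0\<close> is $x$ and \<open>Var T0 0\<close> is $y$; on the right \<open>A\<close> is moved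
      below the quantifier for $F$, and $y$ becomes $F(x)$.\<close>
| qf_ac:
    "wf D A \<Longrightarrow> qfree A \<Longrightarrow>
      ((\<^bold>\<forall>T1. \<^bold>\<exists>T0. A) \<^bold>\<longrightarrow>
       (\<^bold>\<exists>T2. \<^bold>\<forall>T1. subst_fm (inst T0 (Var T2 0 \<cdot> Var T1 0))
                    (subst_fm (push T0 (push T1 (shift T2))) A))) \<in> RCA0_omega D"

inductive_set RCA0_Omega :: "sig \<Rightarrow> fm set" for D :: sig where
  RCA0_omega: "A \<in> RCA0_omega D \<Longrightarrow> A \<in> RCA0_Omega D"
| st_eq:
    "(eqt \<tau> (Var \<tau> 0) (Var \<tau> 1) \<^bold>\<longrightarrow> St (Var \<tau> 0) \<^bold>\<longrightarrow> St (Var \<tau> 1)) \<in> RCA0_Omega D"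
| st_closed: "wt D t \<Longrightarrow> fv_tm t = {} \<Longrightarrow> St t \<in> RCA0_Omega D"
| st_app:
    "(St (Var (\<sigma> \<rightarrow> \<tau>) 0) \<^bold>\<longrightarrow> St (Var \<sigma> 0) \<^bold>\<longrightarrow> St (Var (\<sigma> \<rightarrow> \<tau>) 0 \<cdot> Var \<sigma> 0)) \<in> RCA0_Omega D"
| st_le: "(St (v 0) \<^bold>\<longrightarrow> le (v 1) (v 0) \<^bold>\<longrightarrow> St (v 1)) \<in> RCA0_Omega D"
  \<comment> \<open>In \<open>A\<close>, the variables are $y^\tau$ and, innermost, $z^\sigma$; \<open>A\<close> is moved below the quantifier
      for $x$, which lies outside those for $y$ and $z$.\<close>
| idealization:
    "wf D A \<Longrightarrow> internal A \<Longrightarrow>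
      ((\<^bold>\<forall>st (Sq \<sigma>). \<^bold>\<exists>\<tau>. \<^bold>\<forall>\<sigma>.
          (elem \<sigma> (Var \<sigma> 0) (lift \<sigma> (lift \<tau> (Var (Sq \<sigma>) 0))) \<^bold>\<longrightarrow>
           subst_fm (push \<sigma> (push \<tau> (shift (Sq \<sigma>)))) A)) \<^bold>\<longrightarrow>
       (\<^bold>\<exists>\<tau>. \<^bold>\<forall>st \<sigma>. A)) \<in> RCA0_Omega D"
  \<comment> \<open>In \<open>A\<close>, the variables are $x^\rho$ and, innermost, $y^\tau$; similarly for $\Phi$.\<close>
| HAC_int:
    "wf D A \<Longrightarrow> internal A \<Longrightarrow>
      ((\<^bold>\<forall>st \<rho>. \<^bold>\<exists>st \<tau>. A) \<^bold>\<longrightarrow>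
       (\<^bold>\<exists>st (\<rho> \<rightarrow> Sq \<tau>). \<^bold>\<forall>st \<rho>. \<^bold>\<exists>\<tau>.
          (elem \<tau> (Var \<tau> 0) (lift \<tau> (lift \<rho> (Var (\<rho> \<rightarrow> Sq \<tau>) 0) \<cdot> Var \<rho> 0)) \<^bold>\<and>
           subst_fm (push \<tau> (push \<rho> (shift (\<rho> \<rightarrow> Sq \<tau>)))) A))) \<in> RCA0_Omega D"
| PF_TP:
    "wf D A \<Longrightarrow> internal A \<Longrightarrow> fv A \<subseteq> {(\<tau>, 0)} \<Longrightarrow>
      ((\<^bold>\<forall>st \<tau>. A) \<^bold>\<longrightarrow> (\<^bold>\<forall>\<tau>. A)) \<in> RCA0_Omega D"
| Xi_st: "D \<sigma> i = Some A \<Longrightarrow> St (Cn (Xi \<sigma> i)) \<in> RCA0_Omega D"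
| Xi_agree:
    "D \<sigma> i = Some A \<Longrightarrow>
      (\<^bold>\<forall>st \<sigma>. (relat A \<^bold>\<longrightarrow> approx \<sigma> (Cn (Xi \<sigma> i)) (Var \<sigma> 0))) \<in> RCA0_Omega D"

abbreviation RCA0_Omega_proves :: "sig \<Rightarrow> fm \<Rightarrow> bool" ("RCA0\<Omega>[_] \<turnstile> _" [0, 20] 20) where
  "RCA0\<Omega>[D] \<turnstile> A \<equiv> proves D (RCA0_Omega D) A"

text \<open>
  Specifications of constants are parameter-free internal formulas of the language without \<open>Xi\<close>
  that are satisfied by at most one functional, provably in RCA$_0^\omega$.
\<close>

definition admissible_spec :: "ty \<Rightarrow> fm \<Rightarrow> bool" where
  "admissible_spec \<sigma> A \<longleftrightarrow>
     wf no_Xi A \<and> internal A \<and> fv A \<subseteq> {(\<sigma>, 0)} \<and>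
     proves no_Xi (RCA0_omega no_Xi)
       (A \<^bold>\<longrightarrow> subst_fm (replace \<sigma> 0 (Var \<sigma> 1)) A \<^bold>\<longrightarrow> eqt \<sigma> (Var \<sigma> 0) (Var \<sigma> 1))"

definition admissible_sig :: "sig \<Rightarrow> bool" where
  "admissible_sig D \<longleftrightarrow> (\<forall>\<sigma> i A. D \<sigma> i = Some A \<longrightarrow> admissible_spec \<sigma> A)"

section \<open>Real numbers\<close>

text \<open>
  Rationals are coded by numbers: $\langle\langle a,b\rangle,d\rangle$ stands for $(a-b)/(d+1)$, so every
  number codes a rational.  Outside the codes we calculate with formal fractions: the triple of
  terms $(a,b,d)$ stands for $(a-b)/d$, where $d > 0$.
\<close>

type_synonym frac = "tm \<times> tm \<times> tm"

definition decode :: "tm \<Rightarrow> frac" where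
  "decode q = (fst_c \<cdot> (fst_c \<cdot> q), snd_c \<cdot> (fst_c \<cdot> q), suc (snd_c \<cdot> q))"

fun frac_add :: "frac \<Rightarrow> frac \<Rightarrow> frac" where
  "frac_add (a, b, d) (a', b', d') =
     (add (mult a d') (mult a' d), add (mult b d') (mult b' d), mult d d')"

text \<open>The distance \<open>\<bar>p - q\<bar>\<close>.\<close>

fun frac_dist :: "frac \<Rightarrow> frac \<Rightarrow> frac" where
  "frac_dist (a, b, d) (a', b', d') =
     (dist (add (mult a d') (mult b' d)) (add (mult a' d) (mult b d')), zero, mult d d')"

definition frac_pow :: "tm \<Rightarrow> frac" \<comment> \<open>$2^{-n}$\<close> where
  "frac_pow n = (suc zero, zero, pow2 n)"

fun frac_less :: "frac \<Rightarrow> frac \<Rightarrow> fm" where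
  "frac_less (a, b, d) (a', b', d') =
     lt (add (mult a d') (mult b' d)) (add (mult a' d) (mult b d'))"

fun frac_le :: "frac \<Rightarrow> frac \<Rightarrow> fm" where
  "frac_le (a, b, d) (a', b', d') =
     le (add (mult a d') (mult b' d)) (add (mult a' d) (mult b d'))"

text \<open>Characteristic term of \<open>frac_less\<close>: \<open>0\<close> if $p < q$, and \<open>1\<close> otherwise.\<close>

fun frac_less_char :: "frac \<Rightarrow> frac \<Rightarrow> tm" where
  "frac_less_char (a, b, d) (a', b', d') =
     monus (suc zero)
       (monus (add (mult a' d) (mult b d')) (add (mult a d') (mult b' d)))"

text \<open>
  Every \<open>f\<close> of type 1 is viewed as a real as follows.  \<open>violations_c \<cdot> f \<cdot> n\<close> counts the pairs
  $j < i \le n$ with $|f(j) - f(i)| \ge 2^{-j}$.  The sequence \<open>hat_c \<cdot> f\<close> follows \<open>f\<close> as long as there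
  is no violation and is constant from then on.  So it always is a fast-converging Cauchy
  sequence, $|q_n - q_{n+i}| < 2^{-n}$, and it agrees with \<open>f\<close> whenever \<open>f\<close> is one already.
\<close>

definition violations_c :: tm where
  "violations_c = lam T1 (lam T0
     (sum_below
       (lam T0 (sum_below
         (lam T0 (frac_less_char
            (frac_dist (decode (Var T1 0 \<cdot> v 0)) (decode (Var T1 0 \<cdot> v 1)))
            (frac_pow (v 0))))
         (v 0)))
       (suc (v 0))))"

definition hat_c :: tm where
  "hat_c = lam T1 (lam T0
     (rec (Var T1 0 \<cdot> zero)
       (cond (violations_c \<cdot> Var T1 0 \<cdot> suc (v 0)) (Var T1 0 \<cdot> suc (v 0)) (v 1))
       (v 0)))"

text \<open>The \<open>n\<close>-th rational approximation of the real \<open>x\<close>; its error is at most $2^{-n}$.\<close>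

definition apx :: "tm \<Rightarrow> tm \<Rightarrow> frac" where
  "apx x n = decode (hat_c \<cdot> x \<cdot> n)"

text \<open>
  The bound is $2^{-n}$, so for sequences that approximate the same real badly this is finer than
  having equal limits; if one of the sequences is constant, it is the same.
\<close>

definition real_eq :: "tm \<Rightarrow> tm \<Rightarrow> fm" where
  "real_eq x y = (\<^bold>\<forall>T0. frac_le
     (frac_dist (apx (lift T0 x) (v 0)) (apx (lift T0 y) (v 0))) (frac_pow (v 0)))"

text \<open>$x \le y$, as $(\forall n)(x_n \le y_n + 2^{-n} + 2^{-n})$.\<close>

definition real_le :: "tm \<Rightarrow> tm \<Rightarrow> fm" where
  "real_le x y = (\<^bold>\<forall>T0. frac_le (apx (lift T0 x) (v 0))
     (frac_add (apx (lift T0 y) (v 0)) (frac_add (frac_pow (v 0)) (frac_pow (v 0)))))"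

text \<open>$|x - y| < 2^{-k}$, as $(\exists n)(|x_n - y_n| + 2^{-n} + 2^{-n} < 2^{-k})$.\<close>

definition real_near :: "tm \<Rightarrow> tm \<Rightarrow> tm \<Rightarrow> fm" where
  "real_near x y k = (\<^bold>\<exists>T0. frac_less
     (frac_add (frac_dist (apx (lift T0 x) (v 0)) (apx (lift T0 y) (v 0)))
        (frac_add (frac_pow (v 0)) (frac_pow (v 0))))
     (frac_pow (lift T0 k)))"

definition real_0 :: tm where "real_0 = lam T0 zero"
definition real_1 :: tm where "real_1 = lam T0 (pair (pair (suc zero) zero) zero)"

definition in_unit :: "tm \<Rightarrow> fm" where
  "in_unit x = (real_le real_0 x \<^bold>\<and> real_le x real_1)"

text \<open>In the following formulas, the function \<open>f\<close> is the free variable \<open>Var (T1 \<rightarrow> T1) 0\<close>.\<close>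

abbreviation vf :: tm where "vf \<equiv> Var (T1 \<rightarrow> T1) 0"

definition real_function :: fm where
  "real_function = (\<^bold>\<forall>T1. \<^bold>\<forall>T1.
     (real_eq (Var T1 1) (Var T1 0) \<^bold>\<longrightarrow> real_eq (vf \<cdot> Var T1 1) (vf \<cdot> Var T1 0)))"

text \<open>\<open>f\<close> is a function on the reals with
  $(\forall x\in[0,1])(\forall k)(\exists N)(\forall y\in[0,1])(|x-y|<2^{-N}\to|f(x)-f(y)|<2^{-k})$.\<close>

definition C_unit :: fm where
  "C_unit = (real_function \<^bold>\<and>
     (\<^bold>\<forall>T1. (in_unit (Var T1 0) \<^bold>\<longrightarrow>
       (\<^bold>\<forall>T0. \<^bold>\<exists>T0. \<^bold>\<forall>T1. (in_unit (Var T1 0) \<^bold>\<longrightarrow>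
          real_near (Var T1 1) (Var T1 0) (v 0) \<^bold>\<longrightarrow>
          real_near (vf \<cdot> Var T1 1) (vf \<cdot> Var T1 0) (v 1))))))"

definition C_bar_unit :: fm where
  "C_bar_unit = (C_unit \<^bold>\<and> real_le real_0 (vf \<cdot> real_0) \<^bold>\<and> real_le (vf \<cdot> real_1) real_0)"

section \<open>The principles\<close>

text \<open>
  Where AX is $(\exists\Phi^{\rho\to\tau})A(\Phi)$, the definition below gives E-AX$^{\mathrm{st}}$; the
  argument \<open>A\<close> has the free variable \<open>Var (\<rho> \<rightarrow> \<tau>) 0\<close>.
\<close>

definition standard_extensional :: "ty \<Rightarrow> ty \<Rightarrow> fm" where
  "standard_extensional \<rho> \<tau> =
     (let \<Phi> = lift \<rho> (lift \<rho> (Var (\<rho> \<rightarrow> \<tau>) 0)) in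
      \<^bold>\<forall>st \<rho>. \<^bold>\<forall>st \<rho>. (approx \<rho> (Var \<rho> 1) (Var \<rho> 0) \<^bold>\<longrightarrow>
        approx \<tau> (\<Phi> \<cdot> Var \<rho> 1) (\<Phi> \<cdot> Var \<rho> 0)))"

definition E_st :: "ty \<Rightarrow> ty \<Rightarrow> fm \<Rightarrow> fm" where
  "E_st \<rho> \<tau> A = (\<^bold>\<exists>st (\<rho> \<rightarrow> \<tau>). (relat A \<^bold>\<and> standard_extensional \<rho> \<tau>))"

definition exists2_matrix :: fm where
  "exists2_matrix = (\<^bold>\<forall>T1. ((\<^bold>\<exists>T0. Var T1 0 \<cdot> v 0 \<^bold>= zero) \<^bold>\<longleftrightarrow> Var T2 0 \<cdot> Var T1 0 \<^bold>= zero))"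

definition exists2 :: fm where
  "exists2 = (\<^bold>\<exists>T2. exists2_matrix)"

text \<open>
  The matrix of $(\exists^2)$ alone leaves the nonzero values of $\varphi$ open.  The functional with
  values in $\{0,1\}$ is uniquely specified.
\<close>

definition exists2_spec :: fm where
  "exists2_spec = (exists2_matrix \<^bold>\<and> (\<^bold>\<forall>T1. le (Var T2 0 \<cdot> Var T1 0) (suc zero)))"

definition Pi01_TRANS :: fm where
  "Pi01_TRANS = (\<^bold>\<forall>st T1. ((\<^bold>\<forall>st T0. Var T1 0 \<cdot> v 0 \<^bold>= zero) \<^bold>\<longrightarrow> (\<^bold>\<forall>T0. Var T1 0 \<cdot> v 0 \<^bold>= zero)))"

text \<open>Only the class of functions is relativised; $x \in [0,1]$ and $f(x) = 0$ are internal.\<close>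

definition IVT_star :: fm where
  "IVT_star = (\<^bold>\<forall>st (T1 \<rightarrow> T1). (relat C_bar_unit \<^bold>\<longrightarrow>
     (\<^bold>\<exists>st T1. (in_unit (Var T1 0) \<^bold>\<and> real_eq (vf \<cdot> Var T1 0) real_0))))"

text \<open>
  As functions are defined on all of type 1, $f(\Phi(f))$ always makes sense, and
  $\Phi(f) \in [0,1]$ is not required.
\<close>

definition UIVT_matrix :: fm where
  "UIVT_matrix = (\<^bold>\<forall>(T1 \<rightarrow> T1). (C_bar_unit \<^bold>\<longrightarrow>
     real_eq (vf \<cdot> (Var ((T1 \<rightarrow> T1) \<rightarrow> T1) 0 \<cdot> vf)) real_0))"

definition UIVT :: fm where
  "UIVT = (\<^bold>\<exists>((T1 \<rightarrow> T1) \<rightarrow> T1). UIVT_matrix)"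

definition E_UIVT_st :: fm where
  "E_UIVT_st = E_st (T1 \<rightarrow> T1) T1 UIVT_matrix"

end

theory Submission
  imports Defs "HOL-Library.Countable" "HOL-Computational_Algebra.Fraction_Field"
begin

text \<open>
  The calculus is complete for Henkin models, so it suffices to verify the equivalences in an
  arbitrary model of RCA$_0^\Omega$; choosing representatives modulo extensional equality makes
  equality genuine there.  The numbers of a model form an ordered semiring, and quantifier-free
  induction and calculations with rationals take place in the ordered field that it generates.

  $(\exists^2)^{\mathrm{st}}$ makes the constant $\Xi_0$ decide the standard part of $(\exists x)\,g(x)=0$,
  so PF-TP$_\forall$, applied to $g(x)=0\to\Xi_0(g)=0$, yields $\Pi^0_1$-TRANS.  Conversely, $\Pi^0_1$-TRANS
  turns an internal zero of a standard $g$ into a standard one, and HAC$_{\mathrm{int}}$ collects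
  finitely many candidates for it.  From $(\exists^2)^{\mathrm{st}}$ we decide the signs $f(q)\le 0$ at
  rationals, and bisection gives a zero of $f$; it depends only on the values of $f$ at rationals, so
  that $\Pi^0_1$-TRANS makes it standard extensional, and it makes $f(x)=0$ internal.
  Given IVT$^*$, a standard $g$ whose least zero $k$ is nonstandard contradicts the case of the constant
  function with value $2^{-k-1}$, which is standardly zero.  Given E-UIVT$^{\mathrm{st}}$ with the
  functional $\Phi$, Grilliot's trick decides whether $g$ has a standard zero: the functions that are
  $0$ if it has none, and $-2^{-k-1}x$ or $2^{-k-1}(1-x)$ on $[0,1]$ if $k$ is the least one, have their
  zeros at $0$ and at $1$ in the latter case, and one of these is far from the value of $\Phi$ at the
  zero function.
\<close>

section \<open>Substitutions\<close>

text \<open>In a model, induction is available for quantifier-free formulas only. An invariant must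
  therefore be written in the object language, with its witnesses given by terms, before
  \<open>qf_ind\<close> applies; bounded searches enter such formulas as bounded sums. The field of
  values may contain infinitesimals with respect to the standard numbers. A gap between two
  rationals is thus of use only once it exceeds 2^-k for a standard k, which the standardness of
  their codes ensures (\<open>arch\<close>). The functional of (exists^2)^st is reliable at standard
  arguments only, yet the bisection calls it at every stage: the invariants speak about its answers,
  right or wrong, and what an answer means is used at standard stages alone. PF-TP_forall has a
  single variable and no parameters; hence a sequence and a candidate for its zero are packed into
  one object of type 1, and the functional in the transferred formula has to be a constant of the
  language.\<close>

definition scons :: "ty \<Rightarrow> 'a \<Rightarrow> (ty \<Rightarrow> nat \<Rightarrow> 'a) \<Rightarrow> ty \<Rightarrow> nat \<Rightarrow> 'a" where
  "scons \<sigma> d e = (\<lambda>\<tau> i. if \<tau> = \<sigma> then (case i of 0 \<Rightarrow> d | Suc j \<Rightarrow> e \<tau> j) else e \<tau> i)"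

lemma scons_0 [simp]: "scons \<sigma> d e \<sigma> 0 = d"
  and scons_Suc [simp]: "scons \<sigma> d e \<sigma> (Suc i) = e \<sigma> i"
  and scons_numeral [simp]: "scons \<sigma> d e \<sigma> (numeral k) = e \<sigma> (pred_numeral k)"
  and scons_other [simp]: "\<tau> \<noteq> \<sigma> \<Longrightarrow> scons \<sigma> d e \<tau> i = e \<tau> i"
  and scons_1 [simp]: "scons \<sigma> d e \<sigma> 1 = e \<sigma> 0"
  by (auto simp: scons_def numeral_eq_Suc)

text \<open>Substitutions and environments of models are both built with \<open>scons\<close>, so
  one set of simplification rules serves the syntax and its interpretation.\<close>

lemma inst_eq: "inst \<sigma> t = scons \<sigma> t Var"
  by (auto simp: inst_def scons_def fun_eq_iff split: nat.splits)

lemma push_eq: "push \<sigma> s = scons \<sigma> (Var \<sigma> 0) (\<lambda>\<tau> i. lift \<sigma> (s \<tau> i))"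
  by (auto simp: push_def scons_def fun_eq_iff split: nat.splits)

lemma lift_eq: "lift \<sigma> t = subst_tm (shift \<sigma>) t"
  by (induction t) (auto simp: shift_def)

lemma subst_tm_cong: "(\<And>\<sigma> i. (\<sigma>, i) \<in> fv_tm t \<Longrightarrow> s \<sigma> i = s' \<sigma> i) \<Longrightarrow> subst_tm s t = subst_tm s' t"
  by (induction t) auto

lemma subst_fm_cong: "(\<And>\<sigma> i. (\<sigma>, i) \<in> fv A \<Longrightarrow> s \<sigma> i = s' \<sigma> i) \<Longrightarrow> subst_fm s A = subst_fm s' A"
proof (induction A arbitrary: s s')
  case (Eq t u)
  then show ?case by (auto intro!: subst_tm_cong)
next
  case (St t)
  then show ?case by (auto intro!: subst_tm_cong)
next
  case (Forall \<sigma> A)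
  have "push \<sigma> s \<tau> i = push \<sigma> s' \<tau> i" if "(\<tau>, i) \<in> fv A" for \<tau> i
    using that Forall.prems[of \<tau> "i - 1"] Forall.prems[of \<tau> i]
    by (cases i) (auto simp: push_def)
  then show ?case by (auto intro: Forall.IH)
next
  case (Imp A B)
  have "subst_fm s A = subst_fm s' A" "subst_fm s B = subst_fm s' B"
    by (auto intro!: Imp)
  then show ?case by simp
qed auto

lemma subst_tm_comp: "subst_tm s (subst_tm s' t) = subst_tm (\<lambda>\<sigma> i. subst_tm s (s' \<sigma> i)) t"
  by (induction t) auto

lemma subst_tm_push_lift: "subst_tm (push \<sigma> s) (lift \<sigma> t) = lift \<sigma> (subst_tm s t)"
  by (induction t) (auto simp: push_def)

lemma push_comp: "(\<lambda>\<tau> i. subst_tm (push \<sigma> s) (push \<sigma> s' \<tau> i)) = push \<sigma> (\<lambda>\<tau> i. subst_tm s (s' \<tau> i))"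
  by (auto simp: push_eq[of _ s'] push_eq[of _ "\<lambda>\<tau> i. subst_tm s (s' \<tau> i)"] fun_eq_iff scons_def
      subst_tm_push_lift split: nat.splits) (auto simp: push_def)

lemma subst_fm_comp: "subst_fm s (subst_fm s' A) = subst_fm (\<lambda>\<sigma> i. subst_tm s (s' \<sigma> i)) A"
  by (induction A arbitrary: s s') (auto simp: subst_tm_comp push_comp)

lemma subst_tm_Var [simp]: "subst_tm Var t = t"
  by (induction t) auto

lemma push_Var [simp]: "push \<sigma> Var = Var"
  by (auto simp: push_def fun_eq_iff split: nat.splits)

lemma subst_fm_Var [simp]: "subst_fm Var A = A"
  by (induction A) auto

lemma subst_tm_scons_lift [simp]: "subst_tm (scons \<sigma> d s) (lift \<sigma> t) = subst_tm s t"
  by (induction t) auto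

text \<open>An instance of a substituted quantified formula is again a single substitution of its
  body. This is the form in which the quantifier rules are used.\<close>

lemma subst_inst_push: "subst_fm (inst \<sigma> t) (subst_fm (push \<sigma> s) A) = subst_fm (scons \<sigma> t s) A"
  unfolding subst_fm_comp
  by (rule arg_cong[where f = "\<lambda>s. subst_fm s A"])
    (auto simp: inst_eq push_eq fun_eq_iff scons_def[of _ _ "\<lambda>\<tau> i. lift \<sigma> (s \<tau> i)"]
      scons_def[of \<sigma> t s] split: nat.splits)

definition wt_subst :: "sig \<Rightarrow> subst \<Rightarrow> bool" where
  "wt_subst D s \<longleftrightarrow> (\<forall>\<sigma> i. wt D (s \<sigma> i) \<and> ty_of (s \<sigma> i) = \<sigma>)"

lemma wt_substD: "wt_subst D s \<Longrightarrow> wt D (s \<sigma> i)" "wt_subst D s \<Longrightarrow> ty_of (s \<sigma> i) = \<sigma>"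
  by (auto simp: wt_subst_def)

lemma ty_of_subst [simp]: "wt_subst D s \<Longrightarrow> ty_of (subst_tm s t) = ty_of t"
  by (induction t) (auto simp: wt_substD)

lemma wt_subst_tm [simp]: "wt_subst D s \<Longrightarrow> wt D t \<Longrightarrow> wt D (subst_tm s t)"
  by (induction t) (auto simp: wt_substD(1) split: ty.splits)

lemma wt_subst_Var [simp]: "wt_subst D Var"
  by (simp add: wt_subst_def)

lemma wt_subst_shift [simp]: "wt_subst D (shift \<sigma>)"
  by (simp add: wt_subst_def shift_def)

lemma ty_of_lift [simp]: "ty_of (lift \<sigma> t) = ty_of t"
  by (simp add: lift_eq)

lemma wt_lift [simp]: "wt D (lift \<sigma> t) \<longleftrightarrow> wt D t"
  by (induction t) (auto split: ty.splits)

lemma wt_subst_scons [simp]: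
  "wt D t \<Longrightarrow> ty_of t = \<sigma> \<Longrightarrow> wt_subst D s \<Longrightarrow> wt_subst D (scons \<sigma> t s)"
  by (auto simp: wt_subst_def scons_def split: nat.splits)

lemma wt_subst_push [simp]: "wt_subst D s \<Longrightarrow> wt_subst D (push \<sigma> s)"
  by (auto simp: push_eq wt_subst_def scons_def split: nat.splits)

lemma wf_subst [simp]: "wt_subst D s \<Longrightarrow> wf D A \<Longrightarrow> wf D (subst_fm s A)"
  by (induction A arbitrary: s) auto

lemma finite_fv_tm [simp]: "finite (fv_tm t)"
  by (induction t) auto

lemma finite_fv [simp]: "finite (fv A)"
proof (induction A)
  case (Forall \<sigma> A)
  let ?g = "\<lambda>(\<tau>, i). (\<tau>, if \<tau> = \<sigma> then i - Suc 0 else i)"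
  have "fv (\<^bold>\<forall>\<sigma>. A) \<subseteq> ?g ` fv A"
    by (force simp: image_iff split: if_splits)
  then show ?case
    using Forall finite_surj by blast
qed auto

subsection \<open>Derivable formulas are closed under substitution\<close>

text \<open>The head of the list becomes the innermost quantifier, so a list is processed by
  repeated use of the rule \<open>gen\<close>.\<close>

primrec foralls :: "ty list \<Rightarrow> fm \<Rightarrow> fm" where
  "foralls [] A = A"
| "foralls (\<sigma> # \<sigma>s) A = foralls \<sigma>s (\<^bold>\<forall>\<sigma>. A)"

lemma proves_foralls: "proves D T A \<Longrightarrow> proves D T (foralls \<sigma>s A)"
  by (induction \<sigma>s arbitrary: A) (auto intro: proves.gen)

lemma fv_foralls: "fv (foralls \<sigma>s A) = {(\<tau>, i). (\<tau>, i + count_list \<sigma>s \<tau>) \<in> fv A}"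
  by (induction \<sigma>s arbitrary: A) auto

text \<open>It suffices to quantify n times over each type that occurs free, where n exceeds all
  free indices.\<close>

lemma closed_foralls: "\<exists>\<sigma>s. fv (foralls \<sigma>s A) = {}"
proof -
  define n where "n = Suc (Max (snd ` fv A))"
  obtain ts where ts: "set ts = fst ` fv A"
    using finite_list by (metis finite_fv finite_imageI)
  have 1: "snd p < n" if "p \<in> fv A" for p
    using that unfolding n_def by (simp add: less_Suc_eq_le)
  have cl: "count_list (concat (map (replicate n) ts)) \<tau> \<ge> n" if "\<tau> \<in> set ts" for \<tau>
    using that by (induction ts) (auto simp: count_list_eq_length_filter trans_le_add2)
  have "fv (foralls (concat (map (replicate n) ts)) A) = {}"
  proof (unfold fv_foralls, safe)
    fix \<tau> i assume a: "(\<tau>, i + count_list (concat (map (replicate n) ts)) \<tau>) \<in> fv A"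
    then have "\<tau> \<in> set ts" unfolding ts by force
    with cl 1[OF a] show "(\<tau>, i) \<in> {}" by fastforce
  qed
  then show ?thesis ..
qed

text \<open>The quantifiers are peeled off by \<open>all_inst\<close>: a substitution for A amounts
  to one for its generalisation together with the term for the bound variable.\<close>

lemma proves_subst_strip:
  assumes "\<And>s. wt_subst D s \<Longrightarrow> proves D T (subst_fm s (foralls \<sigma>s A))" "wf D A" "wt_subst D s"
  shows "proves D T (subst_fm s A)"
  using assms
proof (induction \<sigma>s arbitrary: A s)
  case (Cons \<sigma> \<sigma>s)
  define s' where "s' = (\<lambda>\<tau> i. if \<tau> = \<sigma> then s \<tau> (Suc i) else s \<tau> i)"
  have s': "wt_subst D s'" "s = scons \<sigma> (s \<sigma> 0) s'"
    using Cons.prems(3) by (auto simp: s'_def wt_subst_def scons_def fun_eq_iff split: nat.splits)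
  have "proves D T (subst_fm s' (\<^bold>\<forall>\<sigma>. A))"
    using Cons.IH[of "\<^bold>\<forall>\<sigma>. A" s'] Cons.prems s' by simp
  moreover have "proves D T ((\<^bold>\<forall>\<sigma>. subst_fm (push \<sigma> s') A) \<^bold>\<longrightarrow> subst_fm (inst \<sigma> (s \<sigma> 0)) (subst_fm (push \<sigma> s') A))"
    using Cons.prems s' by (intro proves.all_inst) (auto simp: wt_substD)
  ultimately have "proves D T (subst_fm (inst \<sigma> (s \<sigma> 0)) (subst_fm (push \<sigma> s') A))"
    by (auto intro: proves.mp)
  then show ?case
    unfolding subst_inst_push using s' by simp
qed auto

text \<open>A closed generalisation is not affected by substitution, so the substituted terms can be
  supplied when its quantifiers are instantiated.\<close>

lemma proves_subst:
  assumes "proves D T A" "wf D A" "wt_subst D s"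
  shows "proves D T (subst_fm s A)"
proof -
  obtain \<sigma>s where \<sigma>s: "fv (foralls \<sigma>s A) = {}"
    using closed_foralls by blast
  have "subst_fm s (foralls \<sigma>s A) = foralls \<sigma>s A" for s
    using subst_fm_cong[of "foralls \<sigma>s A" s Var] \<sigma>s by simp
  then show ?thesis
    using proves_subst_strip[of D T \<sigma>s A s] assms proves_foralls[of D T A \<sigma>s] by simp
qed

section \<open>Completeness\<close>

text \<open>The Henkin construction treats all formulas in an enumeration, so the whole syntax has
  to be countable.\<close>

instance ty :: countable by countable_datatype

primrec cst_code :: "cst \<Rightarrow> nat \<times> ty \<times> ty \<times> ty" where
  "cst_code Zero = (0, T0, T0, T0)"
| "cst_code Succ = (1, T0, T0, T0)"
| "cst_code Rec = (2, T0, T0, T0)"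
| "cst_code (Pi \<rho> \<sigma>) = (3, \<rho>, \<sigma>, T0)"
| "cst_code (Sig \<rho> \<sigma> \<tau>) = (4, \<rho>, \<sigma>, \<tau>)"
| "cst_code (Len \<sigma>) = (5, \<sigma>, T0, T0)"
| "cst_code (Entry \<sigma>) = (6, \<sigma>, T0, T0)"
| "cst_code (Seg \<sigma>) = (7, \<sigma>, T0, T0)"
| "cst_code (Xi \<sigma> i) = (8 + i, \<sigma>, T0, T0)"

instance cst :: countable
proof (rule countable_classI)
  fix c d assume "to_nat (cst_code c) = to_nat (cst_code d)"
  then have "cst_code c = cst_code d"
    by (rule injD[OF inj_to_nat])
  then show "c = d"
    by (cases c; cases d) simp_all
qed

instance tm :: countable by countable_datatype
instance fm :: countable by countable_datatype

text \<open>Free variables are read universally in \<open>T\<close> but as constants in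
  \<open>S\<close>. Generalisation is therefore not a rule here, and the deduction theorem holds
  without side conditions.\<close>

inductive ded :: "sig \<Rightarrow> fm set \<Rightarrow> fm set \<Rightarrow> fm \<Rightarrow> bool" for D T S where
  ded_thm: "proves D T A \<Longrightarrow> wf D A \<Longrightarrow> ded D T S A"
| ded_hyp: "A \<in> S \<Longrightarrow> wf D A \<Longrightarrow> ded D T S A"
| ded_mp: "ded D T S (A \<^bold>\<longrightarrow> B) \<Longrightarrow> ded D T S A \<Longrightarrow> ded D T S B"

lemma ded_wf: "ded D T S A \<Longrightarrow> wf D A"
  by (induction rule: ded.induct) auto

lemma ded_mono: "ded D T S A \<Longrightarrow> S \<subseteq> S' \<Longrightarrow> ded D T S' A"
  by (induction rule: ded.induct) (auto intro: ded.intros)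

lemma ded_empty: "ded D T {} A \<Longrightarrow> proves D T A"
  by (induction rule: ded.induct) (auto intro: proves.mp)

lemma ded_compact: "ded D T S A \<Longrightarrow> \<exists>F. finite F \<and> F \<subseteq> S \<and> ded D T F A"
proof (induction rule: ded.induct)
  case (ded_thm A)
  then show ?case by (intro exI[of _ "{}"]) (auto intro: ded.intros)
next
  case (ded_hyp A)
  then show ?case by (intro exI[of _ "{A}"]) (auto intro: ded.intros)
next
  case (ded_mp A B)
  then obtain F G where "finite F" "F \<subseteq> S" "ded D T F (A \<^bold>\<longrightarrow> B)" "finite G" "G \<subseteq> S" "ded D T G A"
    by blast
  then show ?case
    by (intro exI[of _ "F \<union> G"]) (auto intro: ded.ded_mp ded_mono)
qed

lemma ded_K: "wf D A \<Longrightarrow> ded D T S B \<Longrightarrow> ded D T S (A \<^bold>\<longrightarrow> B)"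
  by (rule ded_mp[OF ded_thm[OF proves.imp_K]]) (auto dest: ded_wf)

lemma ded_S: "ded D T S (A \<^bold>\<longrightarrow> B \<^bold>\<longrightarrow> C) \<Longrightarrow> ded D T S (A \<^bold>\<longrightarrow> B) \<Longrightarrow> ded D T S (A \<^bold>\<longrightarrow> C)"
  by (rule ded_mp[OF ded_mp[OF ded_thm[OF proves.imp_S[of D A B C]]]]) (auto dest: ded_wf)

lemma ded_I: "wf D A \<Longrightarrow> ded D T S (A \<^bold>\<longrightarrow> A)"
  by (rule ded_S[of D T S A "A \<^bold>\<longrightarrow> A"]) (auto intro!: ded_thm proves.imp_K)

lemma ded_imp_intro:
  assumes "ded D T (insert A S) B" "wf D A"
  shows "ded D T S (A \<^bold>\<longrightarrow> B)"
  using assms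
proof (induction rule: ded.induct)
  case (ded_thm B)
  then show ?case by (auto intro: ded_K ded.ded_thm)
next
  case (ded_hyp B)
  then show ?case by (auto intro: ded_K ded_I ded.ded_hyp)
next
  case (ded_mp B C)
  then show ?case by (blast intro: ded_S)
qed

lemma ded_imp_elim: "ded D T S (A \<^bold>\<longrightarrow> B) \<Longrightarrow> S \<subseteq> S' \<Longrightarrow> A \<in> S' \<Longrightarrow> ded D T S' B"
  using ded_wf[of D T S "A \<^bold>\<longrightarrow> B"] by (intro ded_mp[of D T S' A B]) (auto intro: ded_mono ded_hyp)

lemma ded_NN: "ded D T S (\<^bold>\<not> (\<^bold>\<not> A)) \<Longrightarrow> ded D T S A"
  by (rule ded_mp[OF ded_thm[OF proves.classical]]) (auto dest: ded_wf)

lemma ded_ccontr: "wf D A \<Longrightarrow> ded D T (insert (\<^bold>\<not> A) S) Fls \<Longrightarrow> ded D T S A"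
  by (rule ded_NN, rule ded_imp_intro) auto

lemma ded_Fls: "ded D T S Fls \<Longrightarrow> wf D A \<Longrightarrow> ded D T S A"
  by (rule ded_ccontr) (auto intro: ded_mono)

lemma ded_subst: "ded D T S A \<Longrightarrow> wt_subst D s \<Longrightarrow> ded D T (subst_fm s ` S) (subst_fm s A)"
  by (induction rule: ded.induct) (auto intro: ded.intros proves_subst)

text \<open>The hypotheses are discharged one by one; \<open>all_imp\<close> moves each of them out
  of the scope of the new quantifier.\<close>

lemma ded_gen:
  assumes "finite S" "\<forall>A\<in>S. wf D A" "ded D T (subst_fm (shift \<sigma>) ` S) B"
  shows "ded D T S (\<^bold>\<forall>\<sigma>. B)"
  using assms
proof (induction S arbitrary: B rule: finite_induct)
  case empty
  then have B: "ded D T {} B" by simp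
  then have "proves D T (\<^bold>\<forall>\<sigma>. B)"
    by (intro proves.gen ded_empty)
  with ded_wf[OF B] show ?case
    by (auto intro: ded_thm)
next
  case (insert A S)
  have "ded D T (subst_fm (shift \<sigma>) ` S) (subst_fm (shift \<sigma>) A \<^bold>\<longrightarrow> B)"
    using insert.prems by (intro ded_imp_intro) auto
  with insert have "ded D T S (\<^bold>\<forall>\<sigma>. (subst_fm (shift \<sigma>) A \<^bold>\<longrightarrow> B))"
    by simp
  moreover have "ded D T S ((\<^bold>\<forall>\<sigma>. (subst_fm (shift \<sigma>) A \<^bold>\<longrightarrow> B)) \<^bold>\<longrightarrow> A \<^bold>\<longrightarrow> (\<^bold>\<forall>\<sigma>. B))"
    using insert.prems by (auto intro!: ded_thm proves.all_imp dest: ded_wf)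
  ultimately have "ded D T S (A \<^bold>\<longrightarrow> (\<^bold>\<forall>\<sigma>. B))"
    by (blast intro: ded_mp)
  then show ?case
    by (rule ded_imp_elim) auto
qed

lemma ded_all_inst: "ded D T S (\<^bold>\<forall>\<sigma>. A) \<Longrightarrow> wt D t \<Longrightarrow> ty_of t = \<sigma> \<Longrightarrow> ded D T S (subst_fm (inst \<sigma> t) A)"
  by (rule ded_mp[OF ded_thm[OF proves.all_inst]]) (auto dest: ded_wf simp: inst_eq)

text \<open>A variable that does not occur in the hypotheses can be renamed to the bound one, which
  reduces the rule to \<open>ded_gen\<close>.\<close>

lemma ded_gen_fresh:
  assumes S: "finite S" "\<forall>A\<in>S. wf D A" and B: "wf D B"
    and fresh: "\<forall>A\<in>S. (\<sigma>, k) \<notin> fv A" "(\<sigma>, k) \<notin> fv (\<^bold>\<forall>\<sigma>. B)"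
    and ded: "ded D T S (subst_fm (inst \<sigma> (Var \<sigma> k)) B)"
  shows "ded D T S (\<^bold>\<forall>\<sigma>. B)"
proof -
  \<comment> \<open>On formulas without the fresh variable this is the shift, and the fresh variable
    goes to the index that the quantifier binds.\<close>
  define s where "s = (\<lambda>\<tau> i. if \<tau> = \<sigma> \<and> i = k then Var \<sigma> 0 else shift \<sigma> \<tau> i)"
  have s: "wt_subst D s"
    by (auto simp: s_def wt_subst_def shift_def)
  have "subst_fm s A = subst_fm (shift \<sigma>) A" if "A \<in> S" for A
    using fresh that by (auto intro!: subst_fm_cong simp: s_def)
  then have *: "subst_fm s ` S = subst_fm (shift \<sigma>) ` S"
    by (auto simp: image_iff)
  have "subst_fm s (subst_fm (inst \<sigma> (Var \<sigma> k)) B) = subst_fm Var B"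
    unfolding subst_fm_comp
  proof (rule subst_fm_cong)
    fix \<tau> i assume "(\<tau>, i) \<in> fv B"
    then show "subst_tm s (inst \<sigma> (Var \<sigma> k) \<tau> i) = Var \<tau> i"
      using fresh(2) by (cases i) (auto simp: inst_def s_def shift_def)
  qed
  then have "ded D T (subst_fm (shift \<sigma>) ` S) B"
    using ded_subst[OF ded s] * by simp
  then show ?thesis
    by (rule ded_gen[OF S])
qed

definition consistent :: "sig \<Rightarrow> fm set \<Rightarrow> fm set \<Rightarrow> bool" where
  "consistent D T S \<longleftrightarrow> \<not> ded D T S Fls"

lemma ex_fresh:
  assumes "finite S"
  shows "\<exists>k. \<forall>A\<in>S. (\<sigma>, k) \<notin> fv A"
proof -
  have "finite (snd ` (\<Union>A\<in>S. fv A))"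
    using assms by auto
  then obtain k where "k \<notin> snd ` (\<Union>A\<in>S. fv A)"
    using ex_new_if_finite infinite_UNIV_nat by blast
  then show ?thesis by (force simp: image_iff)
qed

text \<open>One stage of Lindenbaum's construction: A is added if this is consistent, and the
  negation of a universal formula is accompanied by a counterexample. Stages stay finite so that a
  fresh variable can name it.\<close>

lemma ex_henkin_step:
  assumes "finite S" "\<forall>A\<in>S. wf D A" "consistent D T S"
  shows "\<exists>S'. finite S' \<and> S \<subseteq> S' \<and> (\<forall>A\<in>S'. wf D A) \<and> consistent D T S' \<and>
    (wf D A \<longrightarrow> A \<in> S' \<or> \<not> consistent D T (insert A S)) \<and>
    (\<forall>\<sigma> B. A = (\<^bold>\<not> (\<^bold>\<forall>\<sigma>. B)) \<longrightarrow> A \<in> S' \<longrightarrow> (\<exists>k. (\<^bold>\<not> subst_fm (inst \<sigma> (Var \<sigma> k)) B) \<in> S'))"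
proof (cases "wf D A \<and> consistent D T (insert A S)")
  case False
  show ?thesis
  proof (cases "A \<in> S")
    case True
    with False assms show ?thesis by (auto simp: insert_absorb)
  qed (use False assms in \<open>intro exI[of _ S], auto\<close>)
next
  case True
  show ?thesis
  proof (cases "\<exists>\<sigma> B. A = (\<^bold>\<not> (\<^bold>\<forall>\<sigma>. B))")
    case False
    with True assms show ?thesis by (intro exI[of _ "insert A S"]) auto
  next
    case neg: True
    then obtain \<sigma> B where A: "A = (\<^bold>\<not> (\<^bold>\<forall>\<sigma>. B))" by blast
    obtain k where k: "\<forall>C\<in>insert A S. (\<sigma>, k) \<notin> fv C"
      using ex_fresh[of "insert A S"] assms by blast
    let ?C = "\<^bold>\<not> subst_fm (inst \<sigma> (Var \<sigma> k)) B"
    have B: "wf D B" "wf D (subst_fm (inst \<sigma> (Var \<sigma> k)) B)"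
      using True A by (auto simp: inst_eq)
    \<comment> \<open>Otherwise the instance at the fresh variable would be derivable, hence also
      the universal formula that A negates.\<close>
    have "consistent D T (insert ?C (insert A S))"
      unfolding consistent_def
    proof
      assume "ded D T (insert ?C (insert A S)) Fls"
      then have "ded D T (insert A S) (subst_fm (inst \<sigma> (Var \<sigma> k)) B)"
        using B by (auto intro: ded_ccontr[OF B(2)])
      then have "ded D T (insert A S) (\<^bold>\<forall>\<sigma>. B)"
        using k A B True assms by (intro ded_gen_fresh[of "insert A S" D B]) auto
      moreover have "ded D T (insert A S) A"
        using True by (auto intro: ded_hyp)
      ultimately have "ded D T (insert A S) Fls"
        unfolding A by (blast intro: ded_mp)
      then show False using True by (auto simp: consistent_def)
    qed
    then show ?thesis
      using A B True assms by (intro exI[of _ "insert ?C (insert A S)"]) auto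
  qed
qed

text \<open>The last condition is Henkin's: counterexamples to universal formulas are named by variables.\<close>

definition henkin :: "sig \<Rightarrow> fm set \<Rightarrow> fm set \<Rightarrow> bool" where
  "henkin D T H \<longleftrightarrow> (\<forall>A\<in>H. wf D A) \<and> consistent D T H \<and>
     (\<forall>A. wf D A \<longrightarrow> A \<in> H \<or> (\<^bold>\<not> A) \<in> H) \<and>
     (\<forall>\<sigma> B. (\<^bold>\<not> (\<^bold>\<forall>\<sigma>. B)) \<in> H \<longrightarrow> (\<exists>k. (\<^bold>\<not> subst_fm (inst \<sigma> (Var \<sigma> k)) B) \<in> H))"

lemma ex_henkin:
  assumes "finite S" "\<forall>A\<in>S. wf D A" "consistent D T S"
  shows "\<exists>H. henkin D T H \<and> S \<subseteq> H"
proof -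
  define P where "P n X Y \<longleftrightarrow> finite Y \<and> X \<subseteq> Y \<and> (\<forall>A\<in>Y. wf D A) \<and> consistent D T Y \<and>
    (wf D (from_nat n) \<longrightarrow> from_nat n \<in> Y \<or> \<not> consistent D T (insert (from_nat n) X)) \<and>
    (\<forall>\<sigma> B. from_nat n = (\<^bold>\<not> (\<^bold>\<forall>\<sigma>. B)) \<longrightarrow> from_nat n \<in> Y \<longrightarrow>
      (\<exists>k. (\<^bold>\<not> subst_fm (inst \<sigma> (Var \<sigma> k)) B) \<in> Y))" for n X Y
  have ex: "\<exists>Y. P n X Y" if "finite X" "\<forall>A\<in>X. wf D A" "consistent D T X" for n X
    using ex_henkin_step[OF that] unfolding P_def by blast
  define step where "step n X = (SOME Y. P n X Y)" for n X
  have step: "P n X (step n X)" if "finite X" "\<forall>A\<in>X. wf D A" "consistent D T X" for n X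
    unfolding step_def using ex[OF that] by (rule someI_ex)
  define F where "F = rec_nat S step"
  have F0: "F 0 = S" and FS: "F (Suc n) = step n (F n)" for n
    by (auto simp: F_def)
  have F: "finite (F n) \<and> (\<forall>A\<in>F n. wf D A) \<and> consistent D T (F n)" for n
  proof (induction n)
    case (Suc n)
    then have "P n (F n) (F (Suc n))" using step FS by simp
    then show ?case by (auto simp: P_def)
  qed (use assms F0 in auto)
  then have P: "P n (F n) (F (Suc n))" for n
    using step FS by simp
  have mono: "F m \<subseteq> F n" if "m \<le> n" for m n
    by (rule lift_Suc_mono_le[OF _ that]) (use P in \<open>auto simp: P_def\<close>)
  let ?H = "\<Union>n. F n"
  have fin: "\<exists>n. G \<subseteq> F n" if "finite G" "G \<subseteq> ?H" for G
    using that
  proof (induction G rule: finite_induct)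
    case (insert A G)
    from insert.prems obtain m where m: "A \<in> F m" by blast
    from insert obtain n where n: "G \<subseteq> F n" by blast
    have "insert A G \<subseteq> F (max m n)"
      using m n mono[of m "max m n"] mono[of n "max m n"] by auto
    then show ?case ..
  qed auto
  have con: "consistent D T ?H"
    unfolding consistent_def
  proof
    assume "ded D T ?H Fls"
    from ded_compact[OF this] obtain G where G: "finite G" "G \<subseteq> ?H" "ded D T G Fls"
      by blast
    from fin[OF G(1,2)] obtain n where "G \<subseteq> F n" ..
    with G(3) have "ded D T (F n) Fls"
      by (rule ded_mono)
    with F show False by (auto simp: consistent_def)
  qed
  have max: "A \<in> ?H \<or> ded D T ?H (\<^bold>\<not> A)" if "wf D A" for A
  proof (cases "A \<in> F (Suc (to_nat A))")
    case False
    then have "\<not> consistent D T (insert A (F (to_nat A)))"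
      using P[of "to_nat A"] that by (auto simp: P_def)
    then have "ded D T (F (to_nat A)) (\<^bold>\<not> A)"
      using that by (auto simp: consistent_def intro: ded_imp_intro)
    then show ?thesis by (auto intro: ded_mono)
  qed auto
  \<comment> \<open>If neither formula belonged to the limit, the stages of both would make the
    negation of A and its double negation derivable.\<close>
  have "A \<in> ?H \<or> (\<^bold>\<not> A) \<in> ?H" if "wf D A" for A
  proof (rule ccontr)
    assume "\<not> ?thesis"
    with max[of A] max[of "\<^bold>\<not> A"] that have "ded D T ?H (\<^bold>\<not> A)" "ded D T ?H (\<^bold>\<not> (\<^bold>\<not> A))"
      by auto
    with con show False by (auto simp: consistent_def intro: ded_mp)
  qed
  moreover have "\<exists>k. (\<^bold>\<not> subst_fm (inst \<sigma> (Var \<sigma> k)) B) \<in> ?H" if "(\<^bold>\<not> (\<^bold>\<forall>\<sigma>. B)) \<in> ?H" for \<sigma> B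
  proof -
    let ?A = "\<^bold>\<not> (\<^bold>\<forall>\<sigma>. B)"
    \<comment> \<open>A counterexample is supplied only at the stage that treats the formula, so a
      member of the limit has to be present by then.\<close>
    have "?A \<in> F (Suc (to_nat ?A))"
    proof (rule ccontr)
      assume "?A \<notin> F (Suc (to_nat ?A))"
      moreover have "wf D ?A" using that F by blast
      ultimately have "\<not> consistent D T (insert ?A (F (to_nat ?A)))"
        using P[of "to_nat ?A"] unfolding P_def from_nat_to_nat by blast
      moreover have "insert ?A (F (to_nat ?A)) \<subseteq> ?H"
        using that by auto
      ultimately show False
        using con ded_mono unfolding consistent_def by blast
    qed
    then obtain k where "(\<^bold>\<not> subst_fm (inst \<sigma> (Var \<sigma> k)) B) \<in> F (Suc (to_nat ?A))"
      using P[of "to_nat ?A"] unfolding P_def from_nat_to_nat by blast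
    then show ?thesis by blast
  qed
  moreover have "S \<subseteq> ?H" using F0 by blast
  ultimately show ?thesis
    using con F by (intro exI[of _ ?H]) (auto simp: henkin_def)
qed

lemma henkin_ded: "henkin D T H \<Longrightarrow> ded D T H A \<Longrightarrow> A \<in> H"
  unfolding henkin_def consistent_def by (metis ded_wf ded_hyp ded_mp)

lemma henkin_proves: "henkin D T H \<Longrightarrow> proves D T A \<Longrightarrow> wf D A \<Longrightarrow> A \<in> H"
  by (blast intro: henkin_ded ded_thm)

lemma henkin_Fls: "henkin D T H \<Longrightarrow> Fls \<notin> H"
  unfolding henkin_def consistent_def by (auto intro: ded_hyp)

lemma henkin_Neg: "henkin D T H \<Longrightarrow> wf D A \<Longrightarrow> A \<notin> H \<Longrightarrow> (\<^bold>\<not> A) \<in> H"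
  by (auto simp: henkin_def)

lemma henkin_Imp: "henkin D T H \<Longrightarrow> wf D A \<Longrightarrow> wf D B \<Longrightarrow> (A \<^bold>\<longrightarrow> B) \<in> H \<longleftrightarrow> (A \<in> H \<longrightarrow> B \<in> H)"
proof safe
  assume H: "henkin D T H" and wf: "wf D A" "wf D B"
  {
    assume "(A \<^bold>\<longrightarrow> B) \<in> H" "A \<in> H"
    then have "ded D T H B" using wf by (intro ded_mp[of _ _ _ A B] ded_hyp) auto
    with H show "B \<in> H" by (rule henkin_ded)
  next
    assume "A \<notin> H"
    then have "(\<^bold>\<not> A) \<in> H" using H wf by (auto intro: henkin_Neg)
    then have "ded D T (insert A H) Fls"
      using wf by (intro ded_mp[of _ _ _ A Fls] ded_hyp) auto
    then have "ded D T H (A \<^bold>\<longrightarrow> B)" using wf by (auto intro: ded_imp_intro ded_Fls[OF _ wf(2)])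
    with H show "(A \<^bold>\<longrightarrow> B) \<in> H" by (rule henkin_ded)
  next
    assume "B \<in> H"
    then have "ded D T H (A \<^bold>\<longrightarrow> B)" by (rule ded_K[OF wf(1) ded_hyp[OF _ wf(2)]])
    with H show "(A \<^bold>\<longrightarrow> B) \<in> H" by (rule henkin_ded)
  }
qed

lemma henkin_Forall:
  assumes H: "henkin D T H" and wf: "wf D A"
  shows "(\<^bold>\<forall>\<sigma>. A) \<in> H \<longleftrightarrow> (\<forall>t. wt D t \<and> ty_of t = \<sigma> \<longrightarrow> subst_fm (inst \<sigma> t) A \<in> H)"
proof (intro iffI allI impI)
  fix t assume "(\<^bold>\<forall>\<sigma>. A) \<in> H" "wt D t \<and> ty_of t = \<sigma>"
  then show "subst_fm (inst \<sigma> t) A \<in> H"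
    using wf by (intro henkin_ded[OF H] ded_all_inst) (auto intro: ded_hyp)
next
  assume *: "\<forall>t. wt D t \<and> ty_of t = \<sigma> \<longrightarrow> subst_fm (inst \<sigma> t) A \<in> H"
  show "(\<^bold>\<forall>\<sigma>. A) \<in> H"
  proof (rule ccontr)
    assume "(\<^bold>\<forall>\<sigma>. A) \<notin> H"
    then have "(\<^bold>\<not> (\<^bold>\<forall>\<sigma>. A)) \<in> H" using H wf by (auto intro: henkin_Neg)
    then obtain k where k: "(\<^bold>\<not> subst_fm (inst \<sigma> (Var \<sigma> k)) A) \<in> H"
      using H unfolding henkin_def by blast
    moreover have "subst_fm (inst \<sigma> (Var \<sigma> k)) A \<in> H"
      using * by simp
    ultimately show False
      using henkin_Imp[OF H, of "subst_fm (inst \<sigma> (Var \<sigma> k)) A" Fls] henkin_Fls[OF H] wf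
      by (auto simp: inst_eq)
  qed
qed

section \<open>Bracket abstraction\<close>

lemma wt_App_cases:
  assumes "wt D (t \<cdot> u)"
  obtains \<tau> where "wt D t" "wt D u" "ty_of t = ty_of u \<rightarrow> \<tau>"
  using assms by (auto split: ty.splits)

lemma wt_subst_inst_Var [simp]: "wt_subst D (inst \<sigma> (Var \<sigma> 0))"
  by (simp add: inst_eq)

lemma ty_of_lam [simp]: "wt D t \<Longrightarrow> ty_of (lam \<sigma> t) = \<sigma> \<rightarrow> ty_of t"
proof (induction t)
  case (App t u)
  then show ?case
    by (elim wt_App_cases) (auto simp: const_lam_def)
qed (auto simp: const_lam_def)

lemma wt_lam [simp]: "wt D t \<Longrightarrow> wt D (lam \<sigma> t)"
proof (induction t)
  case (App t u)
  then show ?case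
    by (elim wt_App_cases) (auto simp: const_lam_def)
qed (auto simp: const_lam_def inst_def split: nat.split)

lemma fv_tm_subst: "fv_tm (subst_tm s t) = (\<Union>(\<tau>, i)\<in>fv_tm t. fv_tm (s \<tau> i))"
  by (induction t) auto

lemma fv_tm_const_lam:
  assumes "(\<sigma>, 0) \<notin> fv_tm t"
  shows "fv_tm (const_lam \<sigma> t) = {(\<tau>, i). (\<tau>, if \<tau> = \<sigma> then Suc i else i) \<in> fv_tm t}" (is "_ = ?R")
proof
  show "fv_tm (const_lam \<sigma> t) \<subseteq> ?R"
    using assms by (auto simp: const_lam_def fv_tm_subst inst_def split: if_splits nat.splits)
  show "?R \<subseteq> fv_tm (const_lam \<sigma> t)"
    by (force simp: const_lam_def fv_tm_subst inst_def split: if_splits nat.splits)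
qed

lemma fv_tm_lam [simp]: "fv_tm (lam \<sigma> t) = {(\<tau>, i). (\<tau>, if \<tau> = \<sigma> then Suc i else i) \<in> fv_tm t}"
proof (induction t)
  case (App t u)
  show ?case
  proof (cases "(\<sigma>, 0) \<in> fv_tm (t \<cdot> u)")
    case True
    then show ?thesis using App by auto
  next
    case False
    then show ?thesis by (simp add: fv_tm_const_lam del: fv_tm.simps)
  qed
qed (auto simp: fv_tm_const_lam)

text \<open>From here on abstraction is used through its type, its free variables and, in models,
  beta reduction; its clauses are unfolded only to prove the latter.\<close>

declare lam.simps [simp del]

lemma add_c_typing [simp]: "fv_tm add_c = {}" "wt D add_c" "ty_of add_c = T0 \<rightarrow> T0 \<rightarrow> T0"
  by (auto simp: add_c_def split: if_splits)

lemma mult_c_typing [simp]: "fv_tm mult_c = {}" "wt D mult_c" "ty_of mult_c = T0 \<rightarrow> T0 \<rightarrow> T0"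
  by (auto simp: mult_c_def split: if_splits)

lemma pred_c_typing [simp]: "fv_tm pred_c = {}" "wt D pred_c" "ty_of pred_c = T1"
  by (auto simp: pred_c_def split: if_splits)

lemma monus_c_typing [simp]: "fv_tm monus_c = {}" "wt D monus_c" "ty_of monus_c = T0 \<rightarrow> T0 \<rightarrow> T0"
  by (auto simp: monus_c_def split: if_splits)

lemma dist_c_typing [simp]: "fv_tm dist_c = {}" "wt D dist_c" "ty_of dist_c = T0 \<rightarrow> T0 \<rightarrow> T0"
  by (auto simp: dist_c_def split: if_splits)

lemma pow2_c_typing [simp]: "fv_tm pow2_c = {}" "wt D pow2_c" "ty_of pow2_c = T1"
  by (auto simp: pow2_c_def split: if_splits)

lemma cond_c_typing [simp]: "fv_tm cond_c = {}" "wt D cond_c" "ty_of cond_c = T0 \<rightarrow> T0 \<rightarrow> T0 \<rightarrow> T0"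
  by (auto simp: cond_c_def split: if_splits)

lemma sum_c_typing [simp]: "fv_tm sum_c = {}" "wt D sum_c" "ty_of sum_c = T1 \<rightarrow> T1"
  by (auto simp: sum_c_def split: if_splits)

lemma tri_c_typing [simp]: "fv_tm tri_c = {}" "wt D tri_c" "ty_of tri_c = T1"
  by (auto simp: tri_c_def split: if_splits)

lemma pair_c_typing [simp]: "fv_tm pair_c = {}" "wt D pair_c" "ty_of pair_c = T0 \<rightarrow> T0 \<rightarrow> T0"
  by (auto simp: pair_c_def split: if_splits)

lemma root_c_typing [simp]: "fv_tm root_c = {}" "wt D root_c" "ty_of root_c = T1"
  by (auto simp: root_c_def split: if_splits)

lemma fst_c_typing [simp]: "fv_tm fst_c = {}" "wt D fst_c" "ty_of fst_c = T1"
  by (auto simp: fst_c_def split: if_splits)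

lemma snd_c_typing [simp]: "fv_tm snd_c = {}" "wt D snd_c" "ty_of snd_c = T1"
  by (auto simp: snd_c_def split: if_splits)

lemma subst_closed: "fv_tm t = {} \<Longrightarrow> subst_tm s t = t"
  using subst_tm_cong[of t s Var] by simp

lemma lift_closed: "fv_tm t = {} \<Longrightarrow> lift \<sigma> t = t"
  by (simp add: lift_eq subst_closed)

lemma wf_eqt [simp]: "wt D t \<Longrightarrow> wt D u \<Longrightarrow> ty_of t = \<sigma> \<Longrightarrow> ty_of u = \<sigma> \<Longrightarrow> wf D (eqt \<sigma> t u)"
  by (induction \<sigma> arbitrary: t u) (auto simp: ball_def lt_def)

section \<open>Interpretations\<close>

text \<open>There is one untyped universe with a subset for each type, and application is total on
  it. \<open>Eqn\<close> may be any relation at first; it becomes equality in extensional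
  models.\<close>

record 'm interp =
  Dom :: "ty \<Rightarrow> 'm set"
  Ap :: "'m \<Rightarrow> 'm \<Rightarrow> 'm"
  Cst :: "cst \<Rightarrow> 'm"
  Std :: "'m \<Rightarrow> bool"
  Eqn :: "'m \<Rightarrow> 'm \<Rightarrow> bool"

primrec eval :: "'m interp \<Rightarrow> (ty \<Rightarrow> nat \<Rightarrow> 'm) \<Rightarrow> tm \<Rightarrow> 'm" where
  "eval M e (Var \<sigma> i) = e \<sigma> i"
| "eval M e (Cn c) = Cst M c"
| "eval M e (t \<cdot> u) = Ap M (eval M e t) (eval M e u)"

primrec sat :: "'m interp \<Rightarrow> (ty \<Rightarrow> nat \<Rightarrow> 'm) \<Rightarrow> fm \<Rightarrow> bool" where
  "sat M e (t \<^bold>= u) \<longleftrightarrow> Eqn M (eval M e t) (eval M e u)"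
| "sat M e (St t) \<longleftrightarrow> Std M (eval M e t)"
| "sat M e Fls \<longleftrightarrow> False"
| "sat M e (A \<^bold>\<longrightarrow> B) \<longleftrightarrow> (sat M e A \<longrightarrow> sat M e B)"
| "sat M e (\<^bold>\<forall>\<sigma>. A) \<longleftrightarrow> (\<forall>d\<in>Dom M \<sigma>. sat M (scons \<sigma> d e) A)"

definition is_env :: "'m interp \<Rightarrow> (ty \<Rightarrow> nat \<Rightarrow> 'm) \<Rightarrow> bool" where
  "is_env M e \<longleftrightarrow> (\<forall>\<sigma> i. e \<sigma> i \<in> Dom M \<sigma>)"

lemma is_env_scons [simp]: "is_env M e \<Longrightarrow> d \<in> Dom M \<sigma> \<Longrightarrow> is_env M (scons \<sigma> d e)"
  by (auto simp: is_env_def scons_def split: nat.splits)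

lemma eval_cong: "(\<And>\<sigma> i. (\<sigma>, i) \<in> fv_tm t \<Longrightarrow> e \<sigma> i = e' \<sigma> i) \<Longrightarrow> eval M e t = eval M e' t"
  by (induction t) auto

lemma eval_closed: "fv_tm t = {} \<Longrightarrow> eval M e t = eval M e' t"
  by (rule eval_cong) simp

lemma eval_lift [simp]: "eval M (scons \<sigma> d e) (lift \<sigma> t) = eval M e t"
  by (induction t) auto

lemma eval_subst: "eval M e (subst_tm s t) = eval M (\<lambda>\<sigma> i. eval M e (s \<sigma> i)) t"
  by (induction t) auto

lemma sat_subst: "sat M e (subst_fm s A) = sat M (\<lambda>\<sigma> i. eval M e (s \<sigma> i)) A"
proof (induction A arbitrary: e s)
  case (Forall \<sigma> A)
  have "(\<lambda>\<tau> i. eval M (scons \<sigma> d e) (push \<sigma> s \<tau> i)) = scons \<sigma> d (\<lambda>\<tau> i. eval M e (s \<tau> i))" for d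
    by (auto simp: fun_eq_iff push_eq scons_def[of _ d "\<lambda>\<tau> i. eval M e (s \<tau> i)"]
        scons_def[of _ "Var \<sigma> 0"] split: nat.splits)
  then show ?case by (simp add: Forall.IH)
qed (auto simp: eval_subst)

text \<open>The semantic counterpart of \<open>eqt\<close>. No order on the elements is available in
  an arbitrary interpretation, so the bound on indices is stated as satisfaction of the formula
  \<open>lt\<close>.\<close>

primrec eqR :: "'m interp \<Rightarrow> ty \<Rightarrow> 'm \<Rightarrow> 'm \<Rightarrow> bool" where
  "eqR M T0 = Eqn M"
| "eqR M (\<sigma> \<rightarrow> \<tau>) = (\<lambda>f g. \<forall>x\<in>Dom M \<sigma>. eqR M \<tau> (Ap M f x) (Ap M g x))"
| "eqR M (Sq \<sigma>) = (\<lambda>x y. Eqn M (Ap M (Cst M (Len \<sigma>)) x) (Ap M (Cst M (Len \<sigma>)) y) \<and>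
     (\<forall>i\<in>Dom M T0. sat M (scons T0 i (scons T0 (Ap M (Cst M (Len \<sigma>)) x) undefined)) (lt (v 0) (v 1)) \<longrightarrow>
        eqR M \<sigma> (Ap M (Ap M (Cst M (Entry \<sigma>)) x) i) (Ap M (Ap M (Cst M (Entry \<sigma>)) y) i)))"

lemma sat_lt: "sat M e (lt t u) \<longleftrightarrow> sat M (scons T0 (eval M e t) (scons T0 (eval M e u) undefined)) (lt (v 0) (v 1))"
  using eval_closed[of monus_c M e "scons T0 (eval M e t) (scons T0 (eval M e u) undefined)"]
  by (simp add: lt_def)

lemma sat_eqt: "sat M e (eqt \<sigma> t u) \<longleftrightarrow> eqR M \<sigma> (eval M e t) (eval M e u)"
proof (induction \<sigma> arbitrary: e t u)
  case (Sq \<sigma>)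
  show ?case
    by (auto simp: ball_def Sq sat_lt[of M "scons _ _ e"])
qed auto

section \<open>Extensional models\<close>

subsection \<open>The term model\<close>

text \<open>Open terms are elements too: the variables play the part of Henkin constants.\<close>

definition term_model :: "sig \<Rightarrow> fm set \<Rightarrow> tm interp" where
  "term_model D H = \<lparr>Dom = \<lambda>\<sigma>. {t. wt D t \<and> ty_of t = \<sigma>}, Ap = App, Cst = Cn,
     Std = \<lambda>t. St t \<in> H, Eqn = \<lambda>t u. (t \<^bold>= u) \<in> H\<rparr>"

lemma term_model_simps [simp]:
  "Dom (term_model D H) = (\<lambda>\<sigma>. {t. wt D t \<and> ty_of t = \<sigma>})"
  "Ap (term_model D H) = App"
  "Cst (term_model D H) = Cn"
  "Std (term_model D H) t \<longleftrightarrow> St t \<in> H"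
  "Eqn (term_model D H) t u \<longleftrightarrow> (t \<^bold>= u) \<in> H"
  by (auto simp: term_model_def)

lemma eval_term_model [simp]: "eval (term_model D H) s t = subst_tm s t"
  by (induction t) auto

lemma sat_term_model:
  assumes "henkin D T H"
  shows "wf D A \<Longrightarrow> wt_subst D s \<Longrightarrow> sat (term_model D H) s A \<longleftrightarrow> subst_fm s A \<in> H"
proof (induction A arbitrary: s)
  case Fls
  then show ?case using henkin_Fls[OF assms] by auto
next
  case (Imp A B)
  then show ?case using henkin_Imp[OF assms] by auto
next
  case (Forall \<sigma> A)
  have "sat (term_model D H) s (\<^bold>\<forall>\<sigma>. A) \<longleftrightarrow>
      (\<forall>t. wt D t \<and> ty_of t = \<sigma> \<longrightarrow> subst_fm (scons \<sigma> t s) A \<in> H)"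
    using Forall by auto
  then show ?case
    using Forall.prems by (simp add: henkin_Forall[OF assms] subst_inst_push)
qed auto

text \<open>Axioms have to hold under every assignment of terms to their free variables; closure of
  derivability under substitution was proved for this.\<close>

lemma sat_term_model_axiom:
  assumes "henkin D T H" "A \<in> T" "wf D A" "wt_subst D s"
  shows "sat (term_model D H) s A"
  unfolding sat_term_model[OF assms(1,3,4)]
  using henkin_proves[OF assms(1) proves_subst[OF proves.axiom[OF assms(2)] assms(3,4)]] assms(3,4)
  by simp

subsection \<open>Making equality genuine\<close>

text \<open>Satisfaction is asked of well-formed axioms only, since a Henkin set contains no other
  formulas.\<close>

locale ext_model =
  fixes D :: sig and M :: "'m interp"
  assumes Ap_Dom: "f \<in> Dom M (\<sigma> \<rightarrow> \<tau>) \<Longrightarrow> x \<in> Dom M \<sigma> \<Longrightarrow> Ap M f x \<in> Dom M \<tau>"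
    and Cst_Dom: "wt D (Cn c) \<Longrightarrow> Cst M c \<in> Dom M (cty c)"
    and Eqn_eq [simp]: "Eqn M = (=)"
    and eqR_imp_eq: "eqR M \<sigma> x y \<Longrightarrow> x \<in> Dom M \<sigma> \<Longrightarrow> y \<in> Dom M \<sigma> \<Longrightarrow> x = y"
    and axioms: "A \<in> RCA0_Omega D \<Longrightarrow> wf D A \<Longrightarrow> is_env M e \<Longrightarrow> sat M e A"

context
  fixes D :: sig and H :: "fm set"
  assumes H: "henkin D (RCA0_Omega D) H"
begin

abbreviation (input) "TM \<equiv> term_model D H"

lemma TM_axiom: "A \<in> RCA0_omega D \<Longrightarrow> wf D A \<Longrightarrow> wt_subst D s \<Longrightarrow> sat TM s A"
  by (rule sat_term_model_axiom[OF H]) (auto intro: RCA0_Omega.intros)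

abbreviation wtt :: "ty \<Rightarrow> tm \<Rightarrow> bool" where
  "wtt \<sigma> t \<equiv> wt D t \<and> ty_of t = \<sigma>"

lemma TM_Eqn_refl: "wtt T0 t \<Longrightarrow> Eqn TM t t"
  using TM_axiom[OF RCA0_omega.eq_refl, of "scons T0 t Var"] by simp

lemma TM_Eqn_sym: "Eqn TM t u \<Longrightarrow> wtt T0 t \<Longrightarrow> wtt T0 u \<Longrightarrow> Eqn TM u t"
  using TM_axiom[OF RCA0_omega.eq_sym, of "scons T0 t (scons T0 u Var)"] by simp

lemma TM_Eqn_trans:
  "Eqn TM t u \<Longrightarrow> Eqn TM u w \<Longrightarrow> wtt T0 t \<Longrightarrow> wtt T0 u \<Longrightarrow> wtt T0 w \<Longrightarrow> Eqn TM t w"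
  using TM_axiom[OF RCA0_omega.eq_trans, of "scons T0 t (scons T0 u (scons T0 w Var))"] by simp

lemma TM_ext:
  assumes "eqR TM \<rho> t u" "wtt \<rho> t" "wtt \<rho> u" "wtt (\<rho> \<rightarrow> \<tau>) f"
  shows "eqR TM \<tau> (f \<cdot> t) (f \<cdot> u)"
proof -
  \<comment> \<open>A type differs from a function type built from it, so the entries of the
    environment do not overwrite each other.\<close>
  have ne: "\<rho> \<noteq> \<rho> \<rightarrow> \<tau>" "\<rho> \<rightarrow> \<tau> \<noteq> \<rho>" by (auto dest: arg_cong[where f = size])
  have "sat TM (scons (\<rho> \<rightarrow> \<tau>) f (scons \<rho> t (scons \<rho> u Var)))
    (eqt \<rho> (Var \<rho> 0) (Var \<rho> 1) \<^bold>\<longrightarrow> eqt \<tau> (Var (\<rho> \<rightarrow> \<tau>) 0 \<cdot> Var \<rho> 0) (Var (\<rho> \<rightarrow> \<tau>) 0 \<cdot> Var \<rho> 1))"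
    using assms by (intro TM_axiom[OF RCA0_omega.extensionality]) auto
  then show ?thesis
    using assms ne by (simp add: sat_eqt)
qed

text \<open>At sequence types \<open>eqR\<close> bounds the index by the length of its left
  argument; symmetry and transitivity have to exchange that length for an equal one.\<close>

lemma TM_lt_cong:
  assumes "Eqn TM n m" "wtt T0 n" "wtt T0 m" "wtt T0 i"
    "sat TM (scons T0 i (scons T0 n undefined)) (lt (v 0) (v 1))"
  shows "sat TM (scons T0 i (scons T0 m undefined)) (lt (v 0) (v 1))"
proof -
  have "Eqn TM (monus_c \<cdot> suc i \<cdot> n) (monus_c \<cdot> suc i \<cdot> m)"
    using TM_ext[of T0 n m "monus_c \<cdot> suc i" T0] assms by simp
  from TM_Eqn_sym[OF this] show ?thesis
    using assms TM_Eqn_trans[of "monus_c \<cdot> suc i \<cdot> m" "monus_c \<cdot> suc i \<cdot> n" zero]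
    by (simp add: lt_def subst_closed)
qed

lemma TM_eqR_refl: "wtt \<sigma> t \<Longrightarrow> eqR TM \<sigma> t t"
proof (induction \<sigma> arbitrary: t)
  case T0
  then show ?case using TM_Eqn_refl by simp
next
  case (Sq \<sigma>)
  then have "Eqn TM (Cn (Len \<sigma>) \<cdot> t) (Cn (Len \<sigma>) \<cdot> t)"
    by (intro TM_Eqn_refl) simp
  then show ?case using Sq by simp
qed simp

lemma TM_eqR_sym: "eqR TM \<sigma> t u \<Longrightarrow> wtt \<sigma> t \<Longrightarrow> wtt \<sigma> u \<Longrightarrow> eqR TM \<sigma> u t"
proof (induction \<sigma> arbitrary: t u)
  case T0
  then show ?case using TM_Eqn_sym by simp
next
  case (Fn \<sigma> \<tau>)
  show ?case unfolding eqR.simps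
  proof
    fix x assume "x \<in> Dom TM \<sigma>"
    then show "eqR TM \<tau> (Ap TM u x) (Ap TM t x)"
      using Fn.prems by (simp add: Fn.IH(2))
  qed
next
  case (Sq \<sigma>)
  let ?l = "App (Cn (Len \<sigma>))"
  have 1: "Eqn TM (?l u) (?l t)"
    using Sq.prems TM_Eqn_sym[of "?l t" "?l u"] by simp
  show ?case unfolding eqR.simps
  proof (intro conjI ballI impI)
    show "Eqn TM (Ap TM (Cst TM (Len \<sigma>)) u) (Ap TM (Cst TM (Len \<sigma>)) t)"
      using 1 by simp
    fix i assume i: "i \<in> Dom TM T0" "sat TM (scons T0 i (scons T0 (Ap TM (Cst TM (Len \<sigma>)) u) undefined)) (lt (v 0) (v 1))"
    then have "sat TM (scons T0 i (scons T0 (?l t) undefined)) (lt (v 0) (v 1))"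
      using Sq.prems 1 by (intro TM_lt_cong[of "?l u" "?l t" i]) auto
    then show "eqR TM \<sigma> (Ap TM (Ap TM (Cst TM (Entry \<sigma>)) u) i) (Ap TM (Ap TM (Cst TM (Entry \<sigma>)) t) i)"
      using Sq.prems i by (simp add: Sq.IH)
  qed
qed

lemma TM_eqR_trans:
  "eqR TM \<sigma> t u \<Longrightarrow> eqR TM \<sigma> u w \<Longrightarrow> wtt \<sigma> t \<Longrightarrow> wtt \<sigma> u \<Longrightarrow> wtt \<sigma> w \<Longrightarrow> eqR TM \<sigma> t w"
proof (induction \<sigma> arbitrary: t u w)
  case T0
  then show ?case using TM_Eqn_trans by simp
next
  case (Fn \<sigma> \<tau>)
  show ?case unfolding eqR.simps
  proof
    fix x assume "x \<in> Dom TM \<sigma>"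
    with Fn.prems show "eqR TM \<tau> (Ap TM t x) (Ap TM w x)"
      using Fn.IH(2)[of "t \<cdot> x" "u \<cdot> x" "w \<cdot> x"] by simp
  qed
next
  case (Sq \<sigma>)
  let ?l = "App (Cn (Len \<sigma>))"
  have 1: "Eqn TM (?l t) (?l w)"
    using Sq.prems TM_Eqn_trans[of "?l t" "?l u" "?l w"] by simp
  show ?case unfolding eqR.simps
  proof (intro conjI ballI impI)
    show "Eqn TM (Ap TM (Cst TM (Len \<sigma>)) t) (Ap TM (Cst TM (Len \<sigma>)) w)"
      using 1 by simp
    fix i assume i: "i \<in> Dom TM T0" "sat TM (scons T0 i (scons T0 (Ap TM (Cst TM (Len \<sigma>)) t) undefined)) (lt (v 0) (v 1))"
    then have "sat TM (scons T0 i (scons T0 (?l u) undefined)) (lt (v 0) (v 1))"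
      using Sq.prems by (intro TM_lt_cong[of "?l t" "?l u" i]) auto
    with Sq.prems i show "eqR TM \<sigma> (Ap TM (Ap TM (Cst TM (Entry \<sigma>)) t) i) (Ap TM (Ap TM (Cst TM (Entry \<sigma>)) w) i)"
      using Sq.IH[of "Cn (Entry \<sigma>) \<cdot> t \<cdot> i" "Cn (Entry \<sigma>) \<cdot> u \<cdot> i" "Cn (Entry \<sigma>) \<cdot> w \<cdot> i"]
      by simp
  qed
qed

lemma TM_App_cong:
  assumes "eqR TM (\<sigma> \<rightarrow> \<tau>) f g" "eqR TM \<sigma> t u" "wtt (\<sigma> \<rightarrow> \<tau>) f" "wtt (\<sigma> \<rightarrow> \<tau>) g" "wtt \<sigma> t" "wtt \<sigma> u"
  shows "eqR TM \<tau> (f \<cdot> t) (g \<cdot> u)"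
  using assms TM_ext[of \<sigma> t u g \<tau>] TM_eqR_trans[of \<tau> "f \<cdot> t" "g \<cdot> t" "g \<cdot> u"] by simp

text \<open>The predicate under the choice operator depends only on the class of \<open>t\<close>,
  hence so does the representative. The quotient thus stays in the type of terms.\<close>

definition rep :: "tm \<Rightarrow> tm" where
  "rep t = (SOME u. wtt (ty_of t) u \<and> eqR TM (ty_of t) t u)"

lemma rep: "wtt \<sigma> t \<Longrightarrow> wtt \<sigma> (rep t) \<and> eqR TM \<sigma> t (rep t)"
  using TM_eqR_refl[of t \<sigma>] someI[of "\<lambda>u. wtt (ty_of t) u \<and> eqR TM (ty_of t) t u" t]
  by (auto simp: rep_def)

lemma rep_eq_iff:
  assumes "wtt \<sigma> t" "wtt \<sigma> u"
  shows "rep t = rep u \<longleftrightarrow> eqR TM \<sigma> t u"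
proof
  assume "rep t = rep u"
  then show "eqR TM \<sigma> t u"
    using rep[OF assms(1)] rep[OF assms(2)] assms TM_eqR_sym[of \<sigma> u "rep u"] TM_eqR_trans[of \<sigma> t "rep u" u]
    by auto
next
  assume *: "eqR TM \<sigma> t u"
  have "eqR TM \<sigma> t w \<longleftrightarrow> eqR TM \<sigma> u w" if "wtt \<sigma> w" for w
    using * that assms TM_eqR_sym[of \<sigma> t u] TM_eqR_trans[of \<sigma> t u w] TM_eqR_trans[of \<sigma> u t w] by blast
  then have "(\<lambda>w. wtt (ty_of t) w \<and> eqR TM (ty_of t) t w) = (\<lambda>w. wtt (ty_of u) w \<and> eqR TM (ty_of u) u w)"
    using assms by auto
  then show "rep t = rep u"
    by (simp add: rep_def)
qed

definition quot_model :: "tm interp" where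
  "quot_model = \<lparr>Dom = \<lambda>\<sigma>. rep ` Dom TM \<sigma>, Ap = \<lambda>t u. rep (t \<cdot> u), Cst = \<lambda>c. rep (Cn c),
     Std = \<lambda>t. St t \<in> H, Eqn = (=)\<rparr>"

lemma quot_model_simps [simp]:
  "Dom quot_model = (\<lambda>\<sigma>. rep ` {t. wtt \<sigma> t})"
  "Ap quot_model = (\<lambda>t u. rep (t \<cdot> u))"
  "Cst quot_model = (\<lambda>c. rep (Cn c))"
  "Std quot_model = (\<lambda>t. St t \<in> H)"
  "Eqn quot_model = (=)"
  by (auto simp: quot_model_def)

lemma rep_App: "wtt (\<sigma> \<rightarrow> \<tau>) f \<Longrightarrow> wtt \<sigma> t \<Longrightarrow> rep (rep f \<cdot> rep t) = rep (f \<cdot> t)"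
  using rep[of f "\<sigma> \<rightarrow> \<tau>"] rep[of t \<sigma>] TM_App_cong[of \<sigma> \<tau> f "rep f" t "rep t"]
    rep_eq_iff[of "f \<cdot> t" \<tau> "rep f \<cdot> rep t"] by auto

lemma eval_quot: "wt D t \<Longrightarrow> wt_subst D s \<Longrightarrow> eval quot_model (\<lambda>\<sigma> i. rep (s \<sigma> i)) t = rep (subst_tm s t)"
proof (induction t)
  case (App t u)
  from App.prems(1) obtain \<tau> where "wt D t" "wt D u" "ty_of t = ty_of u \<rightarrow> \<tau>"
    by (rule wt_App_cases)
  then show ?case
    using App rep_App[of "subst_tm s t" "ty_of u" \<tau> "subst_tm s u"] by auto
qed auto

lemma St_rep: "wtt \<sigma> t \<Longrightarrow> St (rep t) \<in> H \<longleftrightarrow> St t \<in> H"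
proof -
  assume t: "wtt \<sigma> t"
  have *: "Std TM u" if "eqR TM \<sigma> t u" "Std TM t" "wtt \<sigma> t" "wtt \<sigma> u" for t u
  proof -
    have "sat TM (scons \<sigma> t (scons \<sigma> u Var)) (eqt \<sigma> (Var \<sigma> 0) (Var \<sigma> 1) \<^bold>\<longrightarrow> St (Var \<sigma> 0) \<^bold>\<longrightarrow> St (Var \<sigma> 1))"
      using that by (intro sat_term_model_axiom[OF H] RCA0_Omega.st_eq) auto
    then show ?thesis
      using that by (simp add: sat_eqt)
  qed
  show ?thesis
    using *[of t "rep t"] *[of "rep t" t] t rep[OF t] TM_eqR_sym[of \<sigma> t "rep t"] by auto
qed

lemma sat_quot:
  "wf D A \<Longrightarrow> wt_subst D s \<Longrightarrow> sat quot_model (\<lambda>\<sigma> i. rep (s \<sigma> i)) A \<longleftrightarrow> sat TM s A"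
proof (induction A arbitrary: s)
  case (Eq t u)
  then show ?case by (auto simp: eval_quot rep_eq_iff[of _ T0])
next
  case (St t)
  then show ?case using St_rep[of "subst_tm s t" "ty_of t"] by (auto simp: eval_quot)
next
  case (Forall \<sigma> A)
  have "scons \<sigma> (rep d) (\<lambda>\<tau> i. rep (s \<tau> i)) = (\<lambda>\<tau> i. rep (scons \<sigma> d s \<tau> i))" for d
    by (auto simp: scons_def fun_eq_iff split: nat.splits)
  then show ?case using Forall by auto
qed auto

lemma ext_model_quot: "ext_model D quot_model"
proof
  fix f x \<sigma> \<tau> assume "f \<in> Dom quot_model (\<sigma> \<rightarrow> \<tau>)" "x \<in> Dom quot_model \<sigma>"
  then show "Ap quot_model f x \<in> Dom quot_model \<tau>"
    using rep by (fastforce intro!: imageI)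
next
  fix c assume "wt D (Cn c)"
  then show "Cst quot_model c \<in> Dom quot_model (cty c)" by (auto intro!: imageI)
next
  show "Eqn quot_model = (=)" by simp
next
  fix \<sigma> x y assume eq: "eqR quot_model \<sigma> x y" and xy: "x \<in> Dom quot_model \<sigma>" "y \<in> Dom quot_model \<sigma>"
  obtain t u where t: "x = rep t" "wtt \<sigma> t" "y = rep u" "wtt \<sigma> u"
    using xy by auto
  let ?s = "scons \<sigma> t (scons \<sigma> u Var)"
  have "sat quot_model (\<lambda>\<tau> i. rep (?s \<tau> i)) (eqt \<sigma> (Var \<sigma> 0) (Var \<sigma> 1))"
    using eq t by (simp add: sat_eqt)
  then have "sat TM ?s (eqt \<sigma> (Var \<sigma> 0) (Var \<sigma> 1))"
    using t by (subst (asm) sat_quot) auto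
  then show "x = y"
    using t by (simp add: sat_eqt rep_eq_iff)
next
  fix A e assume A: "A \<in> RCA0_Omega D" "wf D A" and e: "is_env quot_model e"
  have "\<exists>t. e \<sigma> i = rep t \<and> wtt \<sigma> t" for \<sigma> i
    using e by (auto simp: is_env_def)
  then obtain s where s: "\<And>\<sigma> i. e \<sigma> i = rep (s \<sigma> i) \<and> wtt \<sigma> (s \<sigma> i)" by metis
  then have "e = (\<lambda>\<sigma> i. rep (s \<sigma> i))" "wt_subst D s"
    by (auto simp: fun_eq_iff wt_subst_def)
  then show "sat quot_model e A"
    using sat_quot[OF A(2)] sat_term_model_axiom[OF H A] by simp
qed

end

text \<open>The negation of an unprovable formula is consistent and extends to a Henkin set; the
  quotient of its term model refutes the formula when every variable denotes its own class.\<close>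

theorem completeness:
  assumes "\<not> (RCA0\<Omega>[D] \<turnstile> G)" "wf D G"
  shows "\<exists>(M :: tm interp) e. ext_model D M \<and> is_env M e \<and> \<not> sat M e G"
proof -
  have "consistent D (RCA0_Omega D) {\<^bold>\<not> G}"
    unfolding consistent_def using assms(1) ded_empty[OF ded_ccontr[OF assms(2)]] by blast
  then obtain H where H: "henkin D (RCA0_Omega D) H" "{\<^bold>\<not> G} \<subseteq> H"
    using ex_henkin[of "{\<^bold>\<not> G}" D "RCA0_Omega D"] assms(2) by force
  then have G: "G \<notin> H"
    using H(2) henkin_Imp[OF H(1), of G Fls] henkin_Fls[OF H(1)] assms(2) by simp
  let ?M = "quot_model D H" and ?e = "\<lambda>\<sigma> i. rep D H (Var \<sigma> i)"
  have "\<not> sat ?M ?e G"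
    using sat_quot[OF H(1) assms(2), of Var] sat_term_model[OF H(1) assms(2), of Var] G by simp
  moreover have "is_env ?M ?e"
    by (auto simp: is_env_def quot_model_simps[OF H(1)])
  ultimately show ?thesis
    using ext_model_quot[OF H(1)] by blast
qed

section \<open>Arithmetic in extensional models\<close>

text \<open>Being closed, these terms yield a default environment that consists of standard
  elements.\<close>

primrec inhabitant :: "ty \<Rightarrow> tm" where
  "inhabitant T0 = zero"
| "inhabitant (\<sigma> \<rightarrow> \<tau>) = Cn (Pi \<tau> \<sigma>) \<cdot> inhabitant \<tau>"
| "inhabitant (Sq \<sigma>) = Cn (Seg \<sigma>) \<cdot> (Cn (Pi \<sigma> T0) \<cdot> inhabitant \<sigma>) \<cdot> zero"

lemma inhabitant [simp]:
  "ty_of (inhabitant \<sigma>) = \<sigma>" "wt D (inhabitant \<sigma>)" "fv_tm (inhabitant \<sigma>) = {}"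
proof -
  show "ty_of (inhabitant \<sigma>) = \<sigma>" by (induction \<sigma>) auto
  show "fv_tm (inhabitant \<sigma>) = {}" by (induction \<sigma>) auto
  have "ty_of (inhabitant \<sigma>) = \<sigma> \<and> wt D (inhabitant \<sigma>)" by (induction \<sigma>) auto
  then show "wt D (inhabitant \<sigma>)" ..
qed

lemma eqR_refl: "Eqn M = (=) \<Longrightarrow> eqR M \<sigma> x x"
  by (induction \<sigma> arbitrary: x) auto

lemma qfree_wf_replace [simp]: "wt D t \<Longrightarrow> ty_of t = \<sigma> \<Longrightarrow> wt_subst D (replace \<sigma> k t)"
  by (auto simp: wt_subst_def replace_def)

context ext_model
begin

lemmas ty_of_lam_D [simp] = ty_of_lam[of D]

abbreviation app (infixl "\<bullet>" 90) where "f \<bullet> x \<equiv> Ap M f x"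
abbreviation "N \<equiv> Dom M T0"
abbreviation "Z \<equiv> Cst M Zero"
abbreviation "S n \<equiv> Cst M Succ \<bullet> n"

lemma ext:
  assumes "f \<in> Dom M (\<sigma> \<rightarrow> \<tau>)" "g \<in> Dom M (\<sigma> \<rightarrow> \<tau>)" "\<And>x. x \<in> Dom M \<sigma> \<Longrightarrow> f \<bullet> x = g \<bullet> x"
  shows "f = g"
  using assms by (intro eqR_imp_eq[of "\<sigma> \<rightarrow> \<tau>"]) (auto intro!: eqR_refl)

lemma eval_Dom:
  "wt D t \<Longrightarrow> (\<And>\<sigma> i. (\<sigma>, i) \<in> fv_tm t \<Longrightarrow> e \<sigma> i \<in> Dom M \<sigma>) \<Longrightarrow> eval M e t \<in> Dom M (ty_of t)"
proof (induction t)
  case (App t u)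
  from App.prems(1) obtain \<tau> where "wt D t" "wt D u" "ty_of t = ty_of u \<rightarrow> \<tau>"
    by (rule wt_App_cases)
  then show ?case using App by (auto intro: Ap_Dom)
next
  case (Cn c)
  then show ?case using Cst_Dom[of c] by simp
qed auto

lemma eval_in: "wt D t \<Longrightarrow> ty_of t = \<sigma> \<Longrightarrow> is_env M e \<Longrightarrow> eval M e t \<in> Dom M \<sigma>"
  using eval_Dom[of t e] by (auto simp: is_env_def)

definition dflt :: "ty \<Rightarrow> nat \<Rightarrow> 'm" where
  "dflt \<sigma> i = eval M undefined (inhabitant \<sigma>)"

lemma is_env_dflt [simp]: "is_env M dflt"
  using eval_Dom[of "inhabitant \<sigma>" for \<sigma>] by (simp add: is_env_def dflt_def)

lemma Dom_consts [simp]: "Z \<in> N" "n \<in> N \<Longrightarrow> S n \<in> N"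
  using Cst_Dom[of Zero] Cst_Dom[of Succ] Ap_Dom[of "Cst M Succ" T0 T0] by auto

subsection \<open>Combinators\<close>

text \<open>The combinator axioms give distinct indices to variables whose types may coincide.
  Overriding single variables without shifting assigns them uniformly in all these cases.\<close>

definition env2 :: "ty \<Rightarrow> nat \<Rightarrow> 'm \<Rightarrow> (ty \<Rightarrow> nat \<Rightarrow> 'm) \<Rightarrow> ty \<Rightarrow> nat \<Rightarrow> 'm" where
  "env2 \<sigma> k x e = (\<lambda>\<tau> i. if \<tau> = \<sigma> \<and> i = k then x else e \<tau> i)"

lemma is_env_env2 [simp]: "is_env M e \<Longrightarrow> x \<in> Dom M \<sigma> \<Longrightarrow> is_env M (env2 \<sigma> k x e)"
  by (auto simp: is_env_def env2_def)

lemma axiom': "A \<in> RCA0_omega D \<Longrightarrow> wf D A \<Longrightarrow> is_env M e \<Longrightarrow> sat M e A"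
  by (intro axioms RCA0_Omega.intros)

lemma Pi_eq: "x \<in> Dom M \<rho> \<Longrightarrow> y \<in> Dom M \<sigma> \<Longrightarrow> Cst M (Pi \<rho> \<sigma>) \<bullet> x \<bullet> y = x"
proof -
  assume xy: "x \<in> Dom M \<rho>" "y \<in> Dom M \<sigma>"
  let ?e = "env2 \<rho> 0 x (env2 \<sigma> 1 y dflt)"
  have e: "is_env M ?e" using xy by simp
  have "eqR M \<rho> (eval M ?e (Cn (Pi \<rho> \<sigma>) \<cdot> Var \<rho> 0 \<cdot> Var \<sigma> 1)) (eval M ?e (Var \<rho> 0))"
    using axiom'[OF RCA0_omega.comb_Pi _ e] by (simp add: sat_eqt del: eval.simps)
  from eqR_imp_eq[OF this] show ?thesis
    using eval_in[OF _ _ e, of "Cn (Pi \<rho> \<sigma>) \<cdot> Var \<rho> 0 \<cdot> Var \<sigma> 1" \<rho>] xy by (simp add: env2_def)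
qed

lemma Sig_eq:
  assumes "f \<in> Dom M (\<rho> \<rightarrow> \<sigma> \<rightarrow> \<tau>)" "g \<in> Dom M (\<rho> \<rightarrow> \<sigma>)" "x \<in> Dom M \<rho>"
  shows "Cst M (Sig \<rho> \<sigma> \<tau>) \<bullet> f \<bullet> g \<bullet> x = f \<bullet> x \<bullet> (g \<bullet> x)"
proof -
  let ?e = "env2 (\<rho> \<rightarrow> \<sigma> \<rightarrow> \<tau>) 0 f (env2 (\<rho> \<rightarrow> \<sigma>) 1 g (env2 \<rho> 2 x dflt))"
  let ?l = "Cn (Sig \<rho> \<sigma> \<tau>) \<cdot> Var (\<rho> \<rightarrow> \<sigma> \<rightarrow> \<tau>) 0 \<cdot> Var (\<rho> \<rightarrow> \<sigma>) 1 \<cdot> Var \<rho> 2"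
  let ?r = "Var (\<rho> \<rightarrow> \<sigma> \<rightarrow> \<tau>) 0 \<cdot> Var \<rho> 2 \<cdot> (Var (\<rho> \<rightarrow> \<sigma>) 1 \<cdot> Var \<rho> 2)"
  have e: "is_env M ?e" using assms by simp
  have "eqR M \<tau> (eval M ?e ?l) (eval M ?e ?r)"
    using axiom'[OF RCA0_omega.comb_Sig _ e] by (simp add: sat_eqt del: eval.simps)
  from eqR_imp_eq[OF this] have "eval M ?e ?l = eval M ?e ?r"
    using eval_in[OF _ _ e, of ?l \<tau>] eval_in[OF _ _ e, of ?r \<tau>] by simp
  then show ?thesis by (simp add: env2_def)
qed

lemma eval_const_lam:
  assumes "wt D t" "is_env M e" "d \<in> Dom M \<sigma>" "(\<sigma>, 0) \<notin> fv_tm t"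
  shows "eval M e (const_lam \<sigma> t) \<bullet> d = eval M (scons \<sigma> d e) t"
proof -
  have *: "eval M e (subst_tm (inst \<sigma> (Var \<sigma> 0)) t) = eval M (scons \<sigma> d e) t"
    unfolding eval_subst
  proof (rule eval_cong)
    fix \<tau> i assume "(\<tau>, i) \<in> fv_tm t"
    then show "eval M e (inst \<sigma> (Var \<sigma> 0) \<tau> i) = scons \<sigma> d e \<tau> i"
      using assms by (cases i) (auto simp: inst_def scons_def)
  qed
  have "eval M e (subst_tm (inst \<sigma> (Var \<sigma> 0)) t) \<in> Dom M (ty_of t)"
    using assms by (intro eval_in) auto
  then show ?thesis
    using assms * by (simp add: const_lam_def Pi_eq)
qed

lemma eval_lam [simp]:
  "wt D t \<Longrightarrow> is_env M e \<Longrightarrow> d \<in> Dom M \<sigma> \<Longrightarrow> eval M e (lam \<sigma> t) \<bullet> d = eval M (scons \<sigma> d e) t"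
proof (induction t)
  case (Var \<tau> i)
  show ?case
  proof (cases "\<tau> = \<sigma> \<and> i = 0")
    case True
    have "Cst M (Pi \<sigma> (\<sigma> \<rightarrow> \<sigma>)) \<in> Dom M (\<sigma> \<rightarrow> (\<sigma> \<rightarrow> \<sigma>) \<rightarrow> \<sigma>)" "Cst M (Pi \<sigma> \<sigma>) \<in> Dom M (\<sigma> \<rightarrow> \<sigma> \<rightarrow> \<sigma>)"
      using Cst_Dom[of "Pi \<sigma> (\<sigma> \<rightarrow> \<sigma>)"] Cst_Dom[of "Pi \<sigma> \<sigma>"] by auto
    with True Var show ?thesis
      by (simp add: lam.simps Sig_eq[where \<sigma> = "\<sigma> \<rightarrow> \<sigma>"] Pi_eq[where \<sigma> = "\<sigma> \<rightarrow> \<sigma>"] Ap_Dom[where \<sigma> = \<sigma>])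
  next
    case False
    with Var eval_const_lam[of "Var \<tau> i" e d \<sigma>] show ?thesis by (auto simp: lam.simps)
  qed
next
  case (Cn c)
  with eval_const_lam[of "Cn c" e d \<sigma>] show ?case by (auto simp: lam.simps)
next
  case (App t u)
  from App.prems(1) obtain \<tau> where t: "wt D t" "wt D u" "ty_of t = ty_of u \<rightarrow> \<tau>"
    by (rule wt_App_cases)
  show ?case
  proof (cases "(\<sigma>, 0) \<in> fv_tm (t \<cdot> u)")
    case True
    have "eval M e (lam \<sigma> t) \<in> Dom M (\<sigma> \<rightarrow> ty_of u \<rightarrow> \<tau>)" "eval M e (lam \<sigma> u) \<in> Dom M (\<sigma> \<rightarrow> ty_of u)"
      using t App.prems by (auto intro!: eval_in)
    with True t App show ?thesis
      by (simp add: lam.simps Sig_eq[where \<sigma> = "ty_of u"])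
  next
    case False
    with App.prems eval_const_lam[of "t \<cdot> u" e d \<sigma>] show ?thesis by (simp add: lam.simps)
  qed
qed

subsection \<open>Recursion and induction\<close>

lemma rec_0:
  assumes "a \<in> N" "h \<in> Dom M (T0 \<rightarrow> T0 \<rightarrow> T0)"
  shows "Cst M Rec \<bullet> a \<bullet> h \<bullet> Z = a"
  using axiom'[OF RCA0_omega.rec_zero, of "scons T0 a (scons (T0 \<rightarrow> T0 \<rightarrow> T0) h dflt)"] assms by simp

lemma rec_S:
  assumes "a \<in> N" "h \<in> Dom M (T0 \<rightarrow> T0 \<rightarrow> T0)" "n \<in> N"
  shows "Cst M Rec \<bullet> a \<bullet> h \<bullet> (S n) = h \<bullet> (Cst M Rec \<bullet> a \<bullet> h \<bullet> n) \<bullet> n"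
  using axiom'[OF RCA0_omega.rec_suc, of "scons T0 a (scons T0 n (scons (T0 \<rightarrow> T0 \<rightarrow> T0) h dflt))"] assms by simp

lemma rec_N:
  assumes "a \<in> N" "h \<in> Dom M (T0 \<rightarrow> T0 \<rightarrow> T0)" "n \<in> N"
  shows "Cst M Rec \<bullet> a \<bullet> h \<bullet> n \<in> N"
  using eval_in[of "Cn Rec \<cdot> v 0 \<cdot> Var (T0 \<rightarrow> T0 \<rightarrow> T0) 0 \<cdot> v 1" T0
    "scons T0 a (scons T0 n (scons (T0 \<rightarrow> T0 \<rightarrow> T0) h dflt))"] assms by simp

lemma eval_rec:
  assumes "wt D h" "ty_of h = T0" "is_env M e" "a \<in> N"
  shows "Cst M Rec \<bullet> a \<bullet> eval M e (lam T0 (lam T0 h)) \<bullet> Z = a"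
    and "n \<in> N \<Longrightarrow> Cst M Rec \<bullet> a \<bullet> eval M e (lam T0 (lam T0 h)) \<bullet> n \<in> N"
    and "n \<in> N \<Longrightarrow> Cst M Rec \<bullet> a \<bullet> eval M e (lam T0 (lam T0 h)) \<bullet> S n =
      eval M (scons T0 n (scons T0 (Cst M Rec \<bullet> a \<bullet> eval M e (lam T0 (lam T0 h)) \<bullet> n) e)) h"
proof -
  have *: "eval M e (lam T0 (lam T0 h)) \<in> Dom M (T0 \<rightarrow> T0 \<rightarrow> T0)"
    using assms by (intro eval_in) auto
  show "Cst M Rec \<bullet> a \<bullet> eval M e (lam T0 (lam T0 h)) \<bullet> Z = a"
    using * assms by (simp add: rec_0)
  show N: "n \<in> N \<Longrightarrow> Cst M Rec \<bullet> a \<bullet> eval M e (lam T0 (lam T0 h)) \<bullet> n \<in> N"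
    using * assms by (simp add: rec_N)
  show "n \<in> N \<Longrightarrow> Cst M Rec \<bullet> a \<bullet> eval M e (lam T0 (lam T0 h)) \<bullet> S n =
      eval M (scons T0 n (scons T0 (Cst M Rec \<bullet> a \<bullet> eval M e (lam T0 (lam T0 h)) \<bullet> n) e)) h"
    using * assms N by (simp add: rec_S)
qed

lemma qf_ind:
  assumes "wf D A" "qfree A" "is_env M e" "n \<in> N" "sat M (scons T0 Z e) A"
    "\<And>n. n \<in> N \<Longrightarrow> sat M (scons T0 n e) A \<Longrightarrow> sat M (scons T0 (S n) e) A"
  shows "sat M (scons T0 n e) A"
proof -
  have 1: "(\<lambda>\<sigma> i. eval M e (inst T0 zero \<sigma> i)) = scons T0 Z e"
    by (auto simp: fun_eq_iff inst_def scons_def split: nat.splits)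
  have 2: "(\<lambda>\<sigma> i. eval M (scons T0 d e) (replace T0 0 (suc (v 0)) \<sigma> i)) = scons T0 (S d) e" for d
    by (auto simp: fun_eq_iff replace_def scons_def split: nat.splits)
  have "sat M e (subst_fm (inst T0 zero) A \<^bold>\<longrightarrow>
       (\<^bold>\<forall>T0. (A \<^bold>\<longrightarrow> subst_fm (replace T0 0 (suc (v 0))) A)) \<^bold>\<longrightarrow> (\<^bold>\<forall>T0. A))"
    using assms by (intro axiom' RCA0_omega.qf_induction) (auto simp: inst_eq)
  then show ?thesis
    using assms by (simp add: sat_subst 1 2)
qed

definition "ADD = eval M dflt add_c"
definition "MULT = eval M dflt mult_c"
definition "PRED = eval M dflt pred_c"
definition "MONUS = eval M dflt monus_c"
definition "DIST = eval M dflt dist_c"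
definition "POW2 = eval M dflt pow2_c"
definition "COND = eval M dflt cond_c"
definition "SUMB = eval M dflt sum_c"
definition "TRI = eval M dflt tri_c"
definition "PAIR = eval M dflt pair_c"
definition "ROOT = eval M dflt root_c"
definition "FST = eval M dflt fst_c"
definition "SND = eval M dflt snd_c"

lemma eval_consts [simp]:
  "eval M e add_c = ADD" "eval M e mult_c = MULT" "eval M e pred_c = PRED" "eval M e monus_c = MONUS"
  "eval M e dist_c = DIST" "eval M e pow2_c = POW2" "eval M e cond_c = COND" "eval M e sum_c = SUMB"
  "eval M e tri_c = TRI" "eval M e pair_c = PAIR" "eval M e root_c = ROOT" "eval M e fst_c = FST"
  "eval M e snd_c = SND"
  by (auto simp: ADD_def MULT_def PRED_def MONUS_def DIST_def POW2_def COND_def SUMB_def TRI_def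
      PAIR_def ROOT_def FST_def SND_def intro!: eval_closed)

abbreviation plus' (infixl "\<oplus>" 65) where "x \<oplus> y \<equiv> ADD \<bullet> x \<bullet> y"
abbreviation times' (infixl "\<otimes>" 70) where "x \<otimes> y \<equiv> MULT \<bullet> x \<bullet> y"
abbreviation minus' (infixl "\<ominus>" 65) where "x \<ominus> y \<equiv> MONUS \<bullet> x \<bullet> y"

lemma N_closed [simp]:
  "x \<in> N \<Longrightarrow> y \<in> N \<Longrightarrow> x \<oplus> y \<in> N" "x \<in> N \<Longrightarrow> y \<in> N \<Longrightarrow> x \<otimes> y \<in> N"
  "x \<in> N \<Longrightarrow> PRED \<bullet> x \<in> N" "x \<in> N \<Longrightarrow> y \<in> N \<Longrightarrow> x \<ominus> y \<in> N"
  "x \<in> N \<Longrightarrow> y \<in> N \<Longrightarrow> DIST \<bullet> x \<bullet> y \<in> N" "x \<in> N \<Longrightarrow> POW2 \<bullet> x \<in> N"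
  "x \<in> N \<Longrightarrow> y \<in> N \<Longrightarrow> z \<in> N \<Longrightarrow> COND \<bullet> x \<bullet> y \<bullet> z \<in> N"
  "f \<in> Dom M T1 \<Longrightarrow> x \<in> N \<Longrightarrow> SUMB \<bullet> f \<bullet> x \<in> N"
  "x \<in> N \<Longrightarrow> TRI \<bullet> x \<in> N" "x \<in> N \<Longrightarrow> y \<in> N \<Longrightarrow> PAIR \<bullet> x \<bullet> y \<in> N"
  "x \<in> N \<Longrightarrow> ROOT \<bullet> x \<in> N" "x \<in> N \<Longrightarrow> FST \<bullet> x \<in> N" "x \<in> N \<Longrightarrow> SND \<bullet> x \<in> N"
proof -
  have "eval M (scons T1 f (scons T0 x dflt)) (sum_below (Var T1 0) (v 0)) \<in> N" if "f \<in> Dom M T1" "x \<in> N"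
    using that by (intro eval_in) auto
  then show "f \<in> Dom M T1 \<Longrightarrow> x \<in> N \<Longrightarrow> SUMB \<bullet> f \<bullet> x \<in> N" by simp
  have *: "eval M (scons T0 x (scons T0 y (scons T0 z dflt))) t \<in> N"
    if "wt D t" "ty_of t = T0" "x \<in> N" "y \<in> N" "z \<in> N" for x y z t
    using that by (intro eval_in) auto
  show "x \<in> N \<Longrightarrow> y \<in> N \<Longrightarrow> x \<oplus> y \<in> N" using *[of "add (v 0) (v 1)" x y Z] by simp
  show "x \<in> N \<Longrightarrow> y \<in> N \<Longrightarrow> x \<otimes> y \<in> N" using *[of "mult (v 0) (v 1)" x y Z] by simp
  show "x \<in> N \<Longrightarrow> PRED \<bullet> x \<in> N" using *[of "pred_c \<cdot> v 0" x Z Z] by simp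
  show "x \<in> N \<Longrightarrow> y \<in> N \<Longrightarrow> x \<ominus> y \<in> N" using *[of "monus (v 0) (v 1)" x y Z] by simp
  show "x \<in> N \<Longrightarrow> y \<in> N \<Longrightarrow> DIST \<bullet> x \<bullet> y \<in> N" using *[of "dist (v 0) (v 1)" x y Z] by simp
  show "x \<in> N \<Longrightarrow> POW2 \<bullet> x \<in> N" using *[of "pow2 (v 0)" x Z Z] by simp
  show "x \<in> N \<Longrightarrow> y \<in> N \<Longrightarrow> z \<in> N \<Longrightarrow> COND \<bullet> x \<bullet> y \<bullet> z \<in> N"
    using *[of "cond (v 0) (v 1) (v 2)" x y z] by simp
  show "x \<in> N \<Longrightarrow> TRI \<bullet> x \<in> N" using *[of "tri_c \<cdot> v 0" x Z Z] by simp
  show "x \<in> N \<Longrightarrow> y \<in> N \<Longrightarrow> PAIR \<bullet> x \<bullet> y \<in> N" using *[of "pair (v 0) (v 1)" x y Z] by simp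
  show "x \<in> N \<Longrightarrow> ROOT \<bullet> x \<in> N" using *[of "root_c \<cdot> v 0" x Z Z] by simp
  show "x \<in> N \<Longrightarrow> FST \<bullet> x \<in> N" using *[of "fst_c \<cdot> v 0" x Z Z] by simp
  show "x \<in> N \<Longrightarrow> SND \<bullet> x \<in> N" using *[of "snd_c \<cdot> v 0" x Z Z] by simp
qed

lemma S_neq_Z [simp]: "n \<in> N \<Longrightarrow> S n \<noteq> Z"
  using axiom'[OF RCA0_omega.suc_not_zero, of "scons T0 n dflt"] by simp

lemma S_inject [simp]: "n \<in> N \<Longrightarrow> m \<in> N \<Longrightarrow> S n = S m \<longleftrightarrow> n = m"
  using axiom'[OF RCA0_omega.suc_inject, of "scons T0 n (scons T0 m dflt)"] by auto

text \<open>In \<open>x \<oplus> S y\<close> the step term of the recursion is evaluated in an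
  environment that holds \<open>S y\<close>, in \<open>x \<oplus> y\<close> in one that holds
  \<open>y\<close>. The step term does not contain this variable, so both values agree and the
  recursion equation closes up.\<close>

lemma eval_scons_indep: "(\<sigma>, 0) \<notin> fv_tm t \<Longrightarrow> eval M (scons \<sigma> d e) t = eval M (scons \<sigma> d' e) t"
  by (rule eval_cong) (auto simp: scons_def split: nat.splits)

lemma add_rec [simp]:
  "x \<in> N \<Longrightarrow> x \<oplus> Z = x"
  "x \<in> N \<Longrightarrow> y \<in> N \<Longrightarrow> x \<oplus> S y = S (x \<oplus> y)"
  by (simp_all add: ADD_def add_c_def eval_rec eval_scons_indep[where d = "S y" and d' = y for y])

lemma mult_rec [simp]:
  "x \<in> N \<Longrightarrow> x \<otimes> Z = Z"
  "x \<in> N \<Longrightarrow> y \<in> N \<Longrightarrow> x \<otimes> S y = x \<otimes> y \<oplus> x"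
  by (simp_all add: MULT_def mult_c_def eval_rec eval_scons_indep[where d = "S y" and d' = y for y])

lemma pred_rec [simp]: "PRED \<bullet> Z = Z" "x \<in> N \<Longrightarrow> PRED \<bullet> S x = x"
  by (simp_all add: PRED_def pred_c_def eval_rec eval_scons_indep[where d = "S y" and d' = y for y])

lemma monus_rec [simp]:
  "x \<in> N \<Longrightarrow> x \<ominus> Z = x"
  "x \<in> N \<Longrightarrow> y \<in> N \<Longrightarrow> x \<ominus> S y = PRED \<bullet> (x \<ominus> y)"
  by (simp_all add: MONUS_def monus_c_def eval_rec eval_scons_indep[where d = "S y" and d' = y for y])

subsection \<open>The ordered semiring of numbers\<close>

lemma N_cases: "n \<in> N \<Longrightarrow> n = Z \<or> n = S (PRED \<bullet> n)"
proof -
  assume n: "n \<in> N"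
  have "sat M (scons T0 n dflt) (\<^bold>\<not> (v 0 \<^bold>= zero) \<^bold>\<longrightarrow> v 0 \<^bold>= suc (pred_c \<cdot> v 0))"
    by (rule qf_ind) (use n in simp_all)
  then show ?thesis by auto
qed

lemma add_Z_left [simp]: "n \<in> N \<Longrightarrow> Z \<oplus> n = n"
proof -
  assume n: "n \<in> N"
  have "sat M (scons T0 n dflt) (add zero (v 0) \<^bold>= v 0)"
    by (rule qf_ind) (use n in simp_all)
  then show ?thesis by simp
qed

lemma add_S_left [simp]: "n \<in> N \<Longrightarrow> x \<in> N \<Longrightarrow> S x \<oplus> n = S (x \<oplus> n)"
proof -
  assume n: "n \<in> N" "x \<in> N"
  have "sat M (scons T0 n (scons T0 x dflt)) (add (suc (v 1)) (v 0) \<^bold>= suc (add (v 1) (v 0)))"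
    by (rule qf_ind) (use n in simp_all)
  then show ?thesis by simp
qed

lemma add_commute: "n \<in> N \<Longrightarrow> x \<in> N \<Longrightarrow> x \<oplus> n = n \<oplus> x"
proof -
  assume n: "n \<in> N" "x \<in> N"
  have "sat M (scons T0 n (scons T0 x dflt)) (add (v 1) (v 0) \<^bold>= add (v 0) (v 1))"
    by (rule qf_ind) (use n in simp_all)
  then show ?thesis by simp
qed

lemma add_assoc: "n \<in> N \<Longrightarrow> x \<in> N \<Longrightarrow> y \<in> N \<Longrightarrow> x \<oplus> y \<oplus> n = x \<oplus> (y \<oplus> n)"
proof -
  assume n: "n \<in> N" "x \<in> N" "y \<in> N"
  have "sat M (scons T0 n (scons T0 x (scons T0 y dflt)))
      (add (add (v 1) (v 2)) (v 0) \<^bold>= add (v 1) (add (v 2) (v 0)))"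
    by (rule qf_ind) (use n in simp_all)
  then show ?thesis by simp
qed

lemma add_left_commute: "n \<in> N \<Longrightarrow> x \<in> N \<Longrightarrow> y \<in> N \<Longrightarrow> x \<oplus> (y \<oplus> n) = y \<oplus> (x \<oplus> n)"
  by (metis add_assoc add_commute)

lemma mult_Z_left [simp]: "n \<in> N \<Longrightarrow> Z \<otimes> n = Z"
proof -
  assume n: "n \<in> N"
  have "sat M (scons T0 n dflt) (mult zero (v 0) \<^bold>= zero)"
    by (rule qf_ind) (use n in simp_all)
  then show ?thesis by simp
qed

lemma mult_S_left [simp]: "n \<in> N \<Longrightarrow> x \<in> N \<Longrightarrow> S x \<otimes> n = x \<otimes> n \<oplus> n"
proof -
  assume n: "n \<in> N" "x \<in> N"
  have "sat M (scons T0 n (scons T0 x dflt)) (mult (suc (v 1)) (v 0) \<^bold>= add (mult (v 1) (v 0)) (v 0))"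
    by (rule qf_ind) (use n in \<open>simp_all add: add_assoc add_commute add_left_commute\<close>)
  then show ?thesis by simp
qed

lemma mult_commute: "n \<in> N \<Longrightarrow> x \<in> N \<Longrightarrow> x \<otimes> n = n \<otimes> x"
proof -
  assume n: "n \<in> N" "x \<in> N"
  have "sat M (scons T0 n (scons T0 x dflt)) (mult (v 1) (v 0) \<^bold>= mult (v 0) (v 1))"
    by (rule qf_ind) (use n in simp_all)
  then show ?thesis by simp
qed

lemma distrib: "n \<in> N \<Longrightarrow> x \<in> N \<Longrightarrow> y \<in> N \<Longrightarrow> (x \<oplus> y) \<otimes> n = x \<otimes> n \<oplus> y \<otimes> n"
proof -
  assume n: "n \<in> N" "x \<in> N" "y \<in> N"
  have "sat M (scons T0 n (scons T0 x (scons T0 y dflt)))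
      (mult (add (v 1) (v 2)) (v 0) \<^bold>= add (mult (v 1) (v 0)) (mult (v 2) (v 0)))"
    by (rule qf_ind) (use n in \<open>simp_all add: add_assoc add_left_commute\<close>)
  then show ?thesis by simp
qed

lemma mult_assoc: "n \<in> N \<Longrightarrow> x \<in> N \<Longrightarrow> y \<in> N \<Longrightarrow> x \<otimes> y \<otimes> n = x \<otimes> (y \<otimes> n)"
proof -
  assume n: "n \<in> N" "x \<in> N" "y \<in> N"
  have *: "x \<otimes> (a \<oplus> b) = x \<otimes> a \<oplus> x \<otimes> b" if "a \<in> N" "b \<in> N" for a b
    using that n distrib[of x a b] by (simp add: mult_commute[of _ x])
  have "sat M (scons T0 n (scons T0 x (scons T0 y dflt)))
      (mult (mult (v 1) (v 2)) (v 0) \<^bold>= mult (v 1) (mult (v 2) (v 0)))"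
    by (rule qf_ind) (use n * in simp_all)
  then show ?thesis by simp
qed

lemma monus_S_S: "n \<in> N \<Longrightarrow> x \<in> N \<Longrightarrow> S x \<ominus> S n = x \<ominus> n"
proof -
  assume n: "n \<in> N" "x \<in> N"
  have "sat M (scons T0 n (scons T0 x dflt)) (monus (suc (v 1)) (suc (v 0)) \<^bold>= monus (v 1) (v 0))"
    by (rule qf_ind) (use n in \<open>simp_all\<close>)
  then show ?thesis by simp
qed

lemma monus_add: "n \<in> N \<Longrightarrow> x \<in> N \<Longrightarrow> x \<oplus> n \<ominus> n = x"
proof -
  assume n: "n \<in> N" "x \<in> N"
  have "sat M (scons T0 n (scons T0 x dflt)) (monus (add (v 1) (v 0)) (v 0) \<^bold>= v 1)"
    by (rule qf_ind) (use n in \<open>simp_all add: monus_S_S del: monus_rec(2)\<close>)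
  then show ?thesis by simp
qed

lemma monus_add': "n \<in> N \<Longrightarrow> x \<in> N \<Longrightarrow> n \<oplus> x \<ominus> n = x"
  using monus_add[of n x] add_commute[of n x] by simp

lemma Z_monus: "n \<in> N \<Longrightarrow> Z \<ominus> n = Z"
proof -
  assume n: "n \<in> N"
  have "sat M (scons T0 n dflt) (monus zero (v 0) \<^bold>= zero)"
    by (rule qf_ind) (use n in simp_all)
  then show ?thesis by simp
qed

lemma monus_add_eq_Z: "n \<in> N \<Longrightarrow> x \<in> N \<Longrightarrow> n \<ominus> (n \<oplus> x) = Z"
proof -
  assume n: "n \<in> N" "x \<in> N"
  have "sat M (scons T0 n (scons T0 x dflt)) (monus (v 0) (add (v 0) (v 1)) \<^bold>= zero)"
    by (rule qf_ind) (use n in \<open>simp_all add: monus_S_S Z_monus del: monus_rec(2)\<close>)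
  then show ?thesis by simp
qed

lemma add_left_cancel: "x \<in> N \<Longrightarrow> y \<in> N \<Longrightarrow> n \<in> N \<Longrightarrow> n \<oplus> x = n \<oplus> y \<Longrightarrow> x = y"
  by (metis monus_add')

text \<open>Linearity of the order. Truncated subtraction names the difference explicitly, which
  keeps the disjunction quantifier-free and accessible to induction.\<close>

lemma monus_total: "x \<in> N \<Longrightarrow> n \<in> N \<Longrightarrow> x \<oplus> (n \<ominus> x) = n \<or> n \<oplus> (x \<ominus> n) = x"
proof -
  assume n: "x \<in> N" "n \<in> N"
  have "sat M (scons T0 n (scons T0 x dflt)) (\<^bold>\<not> (add (v 1) (monus (v 0) (v 1)) \<^bold>= v 0) \<^bold>\<longrightarrow>
      add (v 0) (monus (v 1) (v 0)) \<^bold>= v 1)"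
  proof (rule qf_ind)
    fix n assume n: "n \<in> N" and *: "sat M (scons T0 n (scons T0 x dflt)) (\<^bold>\<not> (add (v 1) (monus (v 0) (v 1)) \<^bold>= v 0) \<^bold>\<longrightarrow>
      add (v 0) (monus (v 1) (v 0)) \<^bold>= v 1)"
    have *: "x \<oplus> (n \<ominus> x) = n \<or> n \<oplus> (x \<ominus> n) = x" using * by auto
    have "x \<oplus> (S n \<ominus> x) = S n" if "x \<oplus> (n \<ominus> x) = n"
    proof -
      have "S n = x \<oplus> S (n \<ominus> x)" using that n \<open>x \<in> N\<close> by simp
      then have "S n \<ominus> x = S (n \<ominus> x)" using monus_add'[of x "S (n \<ominus> x)"] n \<open>x \<in> N\<close> by simp
      then show ?thesis using that n \<open>x \<in> N\<close> by simp
    qed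
    moreover have "S n \<oplus> (x \<ominus> S n) = x" if "n \<oplus> (x \<ominus> n) = x" "x \<oplus> (n \<ominus> x) \<noteq> n"
    proof -
      \<comment> \<open>The first disjunct fails at n, so n lies strictly below x and the difference
        has a predecessor.\<close>
      have ne: "x \<ominus> n \<noteq> Z"
      proof
        assume "x \<ominus> n = Z"
        then have "n = x" using that n by simp
        then show False using that monus_add[of x Z] n by simp
      qed
      define w where "w = PRED \<bullet> (x \<ominus> n)"
      have w: "x \<ominus> n = S w" "w \<in> N"
        using N_cases[of "x \<ominus> n"] ne n \<open>x \<in> N\<close> by (auto simp: w_def)
      then have "x = S n \<oplus> w" using that n by simp
      then have "x \<ominus> S n = w" using monus_add'[of "S n" w] w n by simp
      then show ?thesis using \<open>x = S n \<oplus> w\<close> by simp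
    qed
    ultimately show "sat M (scons T0 (S n) (scons T0 x dflt)) (\<^bold>\<not> (add (v 1) (monus (v 0) (v 1)) \<^bold>= v 0) \<^bold>\<longrightarrow>
      add (v 0) (monus (v 1) (v 0)) \<^bold>= v 1)"
      using * by (simp del: monus_rec(2)) blast
  qed (use n in \<open>simp_all add: Z_monus\<close>)
  then show ?thesis by auto
qed

lemma add_eq_Z: "x \<in> N \<Longrightarrow> y \<in> N \<Longrightarrow> x \<oplus> y = Z \<Longrightarrow> x = Z"
  using N_cases[of x] N_cases[of y] by (metis N_closed(1,3) add_rec(1,2) S_neq_Z)

lemma mult_eq_Z: "x \<in> N \<Longrightarrow> y \<in> N \<Longrightarrow> x \<otimes> y = Z \<Longrightarrow> x = Z \<or> y = Z"
  using N_cases[of x] N_cases[of y] by (metis N_closed(1,2,3) add_rec(2) mult_rec(2) S_neq_Z)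

end

section \<open>The ordered field of a counterexample\<close>

text \<open>The arithmetic of a model, detached from the rest so that its carrier can be made into a
  type.\<close>

record 'm arith =
  Car :: "'m set"
  Zer :: 'm
  One :: 'm
  Pls :: "'m \<Rightarrow> 'm \<Rightarrow> 'm"
  Tms :: "'m \<Rightarrow> 'm \<Rightarrow> 'm"

locale arith =
  fixes A :: "'m arith"
  assumes zero_Car: "Zer A \<in> Car A" and one_Car: "One A \<in> Car A" and one_neq_zero: "One A \<noteq> Zer A"
    and plus_Car: "x \<in> Car A \<Longrightarrow> y \<in> Car A \<Longrightarrow> Pls A x y \<in> Car A"
    and times_Car: "x \<in> Car A \<Longrightarrow> y \<in> Car A \<Longrightarrow> Tms A x y \<in> Car A"
    and plus_assoc: "x \<in> Car A \<Longrightarrow> y \<in> Car A \<Longrightarrow> z \<in> Car A \<Longrightarrow> Pls A (Pls A x y) z = Pls A x (Pls A y z)"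
    and plus_comm: "x \<in> Car A \<Longrightarrow> y \<in> Car A \<Longrightarrow> Pls A x y = Pls A y x"
    and plus_zero: "x \<in> Car A \<Longrightarrow> Pls A (Zer A) x = x"
    and times_assoc: "x \<in> Car A \<Longrightarrow> y \<in> Car A \<Longrightarrow> z \<in> Car A \<Longrightarrow> Tms A (Tms A x y) z = Tms A x (Tms A y z)"
    and times_comm: "x \<in> Car A \<Longrightarrow> y \<in> Car A \<Longrightarrow> Tms A x y = Tms A y x"
    and times_one: "x \<in> Car A \<Longrightarrow> Tms A (One A) x = x"
    and times_zero: "x \<in> Car A \<Longrightarrow> Tms A (Zer A) x = Zer A"
    and distr: "x \<in> Car A \<Longrightarrow> y \<in> Car A \<Longrightarrow> z \<in> Car A \<Longrightarrow> Tms A (Pls A x y) z = Pls A (Tms A x z) (Tms A y z)"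
    and plus_cancel: "x \<in> Car A \<Longrightarrow> y \<in> Car A \<Longrightarrow> z \<in> Car A \<Longrightarrow> Pls A x y = Pls A x z \<Longrightarrow> y = z"
    and plus_eq_zero: "x \<in> Car A \<Longrightarrow> y \<in> Car A \<Longrightarrow> Pls A x y = Zer A \<Longrightarrow> x = Zer A"
    and times_eq_zero: "x \<in> Car A \<Longrightarrow> y \<in> Car A \<Longrightarrow> Tms A x y = Zer A \<Longrightarrow> x = Zer A \<or> y = Zer A"
    and total: "x \<in> Car A \<Longrightarrow> y \<in> Car A \<Longrightarrow> (\<exists>w\<in>Car A. Pls A x w = y) \<or> (\<exists>w\<in>Car A. Pls A y w = x)"

definition arith_of :: "'m interp \<Rightarrow> 'm arith" where
  "arith_of M = \<lparr>Car = Dom M T0, Zer = Cst M Zero, One = eval M undefined (suc zero),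
     Pls = \<lambda>x y. eval M (scons T0 x (scons T0 y undefined)) (add (v 0) (v 1)),
     Tms = \<lambda>x y. eval M (scons T0 x (scons T0 y undefined)) (mult (v 0) (v 1))\<rparr>"

lemma (in ext_model) arith_of_simps:
  "Car (arith_of M) = N" "Zer (arith_of M) = Z" "One (arith_of M) = S Z"
  "Pls (arith_of M) x y = x \<oplus> y" "Tms (arith_of M) x y = x \<otimes> y"
  by (auto simp: arith_of_def)

lemma (in ext_model) arith_arith_of: "arith (arith_of M)"
proof (unfold_locales, unfold arith_of_simps)
  fix x y z assume x: "x \<in> N"
  show "Z \<oplus> x = x" "S Z \<otimes> x = x" "Z \<otimes> x = Z"
    using x by simp_all
  assume y: "y \<in> N"
  show "x \<oplus> y \<in> N" "x \<otimes> y \<in> N"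
    using x y by simp_all
  show "x \<oplus> y = y \<oplus> x" "x \<otimes> y = y \<otimes> x"
    using x y by (simp_all add: add_commute mult_commute)
  show "x \<oplus> y = Z \<Longrightarrow> x = Z" "x \<otimes> y = Z \<Longrightarrow> x = Z \<or> y = Z"
    using x y add_eq_Z mult_eq_Z by blast+
  show "(\<exists>w\<in>N. x \<oplus> w = y) \<or> (\<exists>w\<in>N. y \<oplus> w = x)"
    using monus_total[OF x y] N_closed(4)[OF x y] N_closed(4)[OF y x] by blast
  assume z: "z \<in> N"
  show "x \<oplus> y \<oplus> z = x \<oplus> (y \<oplus> z)" "x \<otimes> y \<otimes> z = x \<otimes> (y \<otimes> z)" "(x \<oplus> y) \<otimes> z = x \<otimes> z \<oplus> y \<otimes> z"
    using x y z by (simp_all add: add_assoc mult_assoc distrib)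
  show "x \<oplus> y = x \<oplus> z \<Longrightarrow> y = z"
    using add_left_cancel x y z by blast
qed simp_all

text \<open>A structure to fall back on if there is no counterexample. Its numbers are the variables
  of type \<open>T0\<close>, because the universe consists of terms.\<close>

lemma arith_nat:
  "arith \<lparr>Car = range (Var T0), Zer = Var T0 0, One = Var T0 1,
     Pls = \<lambda>x y. case x of Var _ i \<Rightarrow> (case y of Var _ j \<Rightarrow> Var T0 (i + j)),
     Tms = \<lambda>x y. case x of Var _ i \<Rightarrow> (case y of Var _ j \<Rightarrow> Var T0 (i * j))\<rparr>"
proof -
  have "\<exists>w. i + w = j \<or> j + w = i" for i j :: nat
    using le_Suc_ex[of i j] le_Suc_ex[of j i] nat_le_linear[of i j] by metis
  then show ?thesis
    by unfold_locales (auto simp: algebra_simps, metis)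
qed

text \<open>
  Models have no types of their own, but a proof by contradiction has a model to be refuted, and that
  model can be selected by choice before the types are defined.
\<close>

definition counterexample :: "tm interp \<Rightarrow> bool" where
  "counterexample M \<longleftrightarrow> (\<exists>D i e A. ext_model D M \<and> D T2 i = Some exists2_spec \<and> is_env M e \<and>
     A \<in> {relat exists2 \<^bold>\<longleftrightarrow> Pi01_TRANS, Pi01_TRANS \<^bold>\<longleftrightarrow> IVT_star, IVT_star \<^bold>\<longleftrightarrow> E_UIVT_st} \<and>
     \<not> sat M e A)"

definition the_counterexample :: "tm interp" where
  "the_counterexample = (SOME M. counterexample M)"

text \<open>The class instances below cannot depend on an assumption, so the laws of
  \<open>arith\<close> must hold unconditionally; the tie to the counterexample is conditional on
  its existence.\<close>

definition the_arith :: "tm arith" where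
  "the_arith = (SOME A. arith A \<and> ((\<exists>M. counterexample M) \<longrightarrow> A = arith_of the_counterexample))"

lemma the_counterexample: "counterexample M \<Longrightarrow> counterexample the_counterexample"
  unfolding the_counterexample_def by (rule someI)

lemma ext_model_counterexample: "counterexample M \<Longrightarrow> \<exists>D. ext_model D M"
  by (auto simp: counterexample_def)

lemma the_arith: "arith the_arith" "counterexample M \<Longrightarrow> the_arith = arith_of the_counterexample"
proof -
  have "\<exists>A. arith A \<and> ((\<exists>M. counterexample M) \<longrightarrow> A = arith_of the_counterexample)"
  proof (cases "\<exists>M. counterexample M")
    case True
    then obtain M where "counterexample M" ..
    from ext_model_counterexample[OF the_counterexample[OF this]]
    have "arith (arith_of the_counterexample)"
      by (auto intro: ext_model.arith_arith_of)
    then show ?thesis by auto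
  next
    case False
    with arith_nat show ?thesis by auto
  qed
  from someI_ex[OF this]
  show "arith the_arith" "counterexample M \<Longrightarrow> the_arith = arith_of the_counterexample"
    unfolding the_arith_def[symmetric] by auto
qed

interpretation the: arith the_arith
  by (rule the_arith)

typedef mnum = "Car the_arith"
  using the.zero_Car by blast

setup_lifting type_definition_mnum

instantiation mnum :: linordered_semidom
begin

lift_definition zero_mnum :: mnum is "Zer the_arith" by (rule the.zero_Car)
lift_definition one_mnum :: mnum is "One the_arith" by (rule the.one_Car)
lift_definition plus_mnum :: "mnum \<Rightarrow> mnum \<Rightarrow> mnum" is "Pls the_arith" by (rule the.plus_Car)
lift_definition times_mnum :: "mnum \<Rightarrow> mnum \<Rightarrow> mnum" is "Tms the_arith" by (rule the.times_Car)

definition less_eq_mnum :: "mnum \<Rightarrow> mnum \<Rightarrow> bool" where "(x::mnum) \<le> y \<longleftrightarrow> (\<exists>w. x + w = y)"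
definition less_mnum :: "mnum \<Rightarrow> mnum \<Rightarrow> bool" where "(x::mnum) < y \<longleftrightarrow> x \<le> y \<and> x \<noteq> y"
text \<open>The value 0 where no difference exists makes \<open>a - b - c = a - (b + c)\<close> and
  distributivity over differences hold throughout, as the class demands.\<close>

definition minus_mnum :: "mnum \<Rightarrow> mnum \<Rightarrow> mnum" where
  "(x::mnum) - y = (if y \<le> x then THE w. y + w = x else 0)"

instance
proof
  have cancel: "x + y = x + z \<Longrightarrow> y = z" for x y z :: mnum
    by transfer (rule the.plus_cancel)
  have comm: "x + y = y + x" for x y :: mnum
    by transfer (rule the.plus_comm)
  have assoc: "x + y + z = x + (y + z)" for x y z :: mnum
    by transfer (rule the.plus_assoc)
  have lcomm: "x + (y + z) = y + (x + z)" for x y z :: mnum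
    by (metis comm assoc)
  have zero: "0 + x = x" "x + 0 = x" for x :: mnum
    by (transfer, rule the.plus_zero, assumption) (metis comm plus_mnum.rep_eq the.plus_zero Rep_mnum zero_mnum.rep_eq Rep_mnum_inject)
  have sum0: "x + y = 0 \<Longrightarrow> x = 0" for x y :: mnum
    by transfer (rule the.plus_eq_zero)
  have total: "x \<le> y \<or> y \<le> x" for x y :: mnum
    unfolding less_eq_mnum_def by transfer (use the.total in blast)
  have antisym: "x = y" if le: "x \<le> y" "y \<le> x" for x y :: mnum
  proof -
    obtain w u where "x + w = y" "y + u = x" using le unfolding less_eq_mnum_def by blast
    then have "x + (w + u) = x + 0" by (simp add: assoc[symmetric] zero)
    then have "w = 0" using cancel sum0 by blast
    then show ?thesis using \<open>x + w = y\<close> zero by simp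
  qed
  have minus: "x + y - x = y" for x y :: mnum
    unfolding minus_mnum_def less_eq_mnum_def using cancel by (auto intro!: the_equality)
  have minus0: "x - y = 0" if "\<not> y \<le> x" for x y :: mnum
    using that by (simp add: minus_mnum_def)
  fix a b c :: mnum
  show "a + b + c = a + (b + c)" by (rule assoc)
  show "a + b = b + a" by (rule comm)
  show "0 + a = a" by (rule zero)
  show tassoc: "a * b * c = a * (b * c)" by transfer (rule the.times_assoc)
  have tcomm: "a * b = b * a" for a b :: mnum by transfer (rule the.times_comm)
  show "a * b = b * a" by (rule tcomm)
  show "1 * a = a" by transfer (rule the.times_one)
  have dist: "(a + b) * c = a * c + b * c" for a b c :: mnum by transfer (rule the.distr)
  show "(a + b) * c = a * c + b * c" by (rule dist)
  show "a * (b + c) = a * b + a * c" by (simp add: dist tcomm[of a])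
  have tzero: "0 * a = 0" for a :: mnum by transfer (rule the.times_zero)
  show "0 * a = 0" "a * 0 = 0" using tzero[of a] tcomm[of a 0] by auto
  show "(0::mnum) \<noteq> 1" by transfer (use the.one_neq_zero in auto)
  have nzd: "a * b \<noteq> 0" if "a \<noteq> 0" "b \<noteq> 0" for a b :: mnum
    using that by transfer (use the.times_eq_zero in blast)
  show "a \<noteq> 0 \<Longrightarrow> b \<noteq> 0 \<Longrightarrow> a * b \<noteq> 0" by (rule nzd)
  have refl: "a \<le> a" for a :: mnum unfolding less_eq_mnum_def using zero by blast
  show "a \<le> a" by (rule refl)
  show "a < b \<longleftrightarrow> a \<le> b \<and> \<not> b \<le> a"
    unfolding less_mnum_def using antisym refl by blast
  have trans: "a \<le> b \<Longrightarrow> b \<le> c \<Longrightarrow> a \<le> c" for a b c :: mnum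
    unfolding less_eq_mnum_def by (metis assoc)
  show "a \<le> b \<Longrightarrow> b \<le> c \<Longrightarrow> a \<le> c" by (rule trans)
  show "a \<le> b \<Longrightarrow> b \<le> a \<Longrightarrow> a = b" by (rule antisym)
  show "a \<le> b \<or> b \<le> a" by (rule total)
  show "a \<le> b \<Longrightarrow> c + a \<le> c + b"
    unfolding less_eq_mnum_def by (metis assoc)
  show "a + b - a = b" by (rule minus)
  have mono: "b + c \<le> a" if "b \<le> a" "c \<le> a - b" for a b c :: mnum
  proof -
    obtain w where w: "a = b + w" using \<open>b \<le> a\<close> unfolding less_eq_mnum_def by blast
    then have "c \<le> w" using \<open>c \<le> a - b\<close> minus by simp
    then obtain u where "c + u = w" unfolding less_eq_mnum_def by blast
    then have "b + c + u = a" using w by (auto simp: assoc)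
    then show ?thesis unfolding less_eq_mnum_def by blast
  qed
  have zdiff: "0 - x = 0" for x :: mnum
  proof (cases "x \<le> 0")
    case True
    then have "x = 0" unfolding less_eq_mnum_def using sum0 by blast
    then show ?thesis using minus[of 0 0] zero by simp
  qed (rule minus0)
  show "a - b - c = a - (b + c)"
  proof (cases "b + c \<le> a")
    case True
    then obtain w where "b + c + w = a" unfolding less_eq_mnum_def by blast
    then have "a - (b + c) = w" "a - b = c + w" using minus[of "b + c" w] minus[of b "c + w"] assoc by auto
    then show ?thesis using minus by simp
  next
    case False
    then have "a - (b + c) = 0" by (rule minus0)
    moreover have "a - b - c = 0"
    proof (cases "b \<le> a")
      case True
      with False mono show ?thesis by (auto intro!: minus0)
    next
      case False
      then have "a - b = 0" by (rule minus0)
      then show ?thesis by (simp add: zdiff)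
    qed
    ultimately show ?thesis by simp
  qed
  show "a * (b - c) = a * b - a * c"
  proof (cases "c \<le> b")
    case True
    then obtain w where w: "c + w = b" unfolding less_eq_mnum_def by blast
    then have "a * b = a * c + a * w" using dist[of c w a] by (simp add: tcomm[of a])
    then show ?thesis using w minus by auto
  next
    case False
    with total have "b \<le> c" by blast
    then obtain w where w: "b + w = c" unfolding less_eq_mnum_def by blast
    have "a * b - (a * b + a * w) = 0"
    proof (cases "a * b + a * w \<le> a * b")
      case True
      then obtain u where "a * b + a * w + u = a * b" unfolding less_eq_mnum_def by blast
      then have "a * b + (a * w + u) = a * b + 0" by (simp add: assoc zero)
      then have "a * w = 0" using cancel sum0 by blast
      then show ?thesis using minus[of "a * b" 0] by (simp add: zero)
    qed (rule minus0)
    moreover have "a * c = a * b + a * w" using w dist[of b w a] by (auto simp: tcomm[of a])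
    ultimately show ?thesis
      using False minus0[of c b] tcomm[of a 0] tzero[of a] by simp
  qed
  show "(0::mnum) < 1"
  proof -
    have "(0::mnum) \<le> 1" unfolding less_eq_mnum_def using zero by blast
    moreover have "(0::mnum) \<noteq> 1" by transfer (use the.one_neq_zero in auto)
    ultimately show ?thesis by (simp add: less_mnum_def)
  qed
  show "c * a < c * b" if ab: "a < b" and c: "0 < c"
  proof -
    obtain w where w: "a + w = b" using ab unfolding less_mnum_def less_eq_mnum_def by blast
    then have "w \<noteq> 0" "c \<noteq> 0" using ab c zero by (auto simp: less_mnum_def)
    then have "c * w \<noteq> 0" by (rule nzd[rotated])
    moreover have cb: "c * b = c * a + c * w" using w dist[of a w c] by (auto simp: tcomm[of c])
    ultimately have "c * a \<noteq> c * b" using cancel[of "c * a" "c * w" 0] zero by auto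
    moreover have "c * a \<le> c * b" unfolding less_eq_mnum_def using cb by auto
    ultimately show ?thesis by (simp add: less_mnum_def)
  qed
  show "b \<le> a \<Longrightarrow> a - b + b = a"
    unfolding less_eq_mnum_def by (metis comm minus)
qed

end

section \<open>The ring of differences and its fraction field\<close>

definition zrel :: "mnum \<times> mnum \<Rightarrow> mnum \<times> mnum \<Rightarrow> bool" where
  "zrel = (\<lambda>(x, y) (u, k). x + k = u + y)"

lemma zrel_iff [simp]: "zrel (x, y) (u, k) \<longleftrightarrow> x + k = u + y"
  by (simp add: zrel_def)

lemma zrel_trans: "x + k = u + y \<Longrightarrow> u + b = a + k \<Longrightarrow> x + b = a + (y::mnum)"
proof -
  assume "x + k = u + y" "u + b = a + k"
  then have "(x + k) + (u + b) = (u + y) + (a + k)" by simp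
  then have "(x + b) + (u + k) = (a + y) + (u + k)" by (simp add: ac_simps)
  then show ?thesis by (simp only: add_right_cancel)
qed

quotient_type mint = "mnum \<times> mnum" / zrel
  morphisms Rep_mint Abs_mint
proof (rule equivpI)
  show "reflp zrel" by (auto intro: reflpI)
  show "symp zrel" by (auto intro!: sympI)
  show "transp zrel" by (auto intro!: transpI elim: zrel_trans)
qed

lemma zrel_le: "x + k = u + y \<Longrightarrow> x' + k' = u' + y' \<Longrightarrow> x + y' \<le> x' + y \<longleftrightarrow> u + k' \<le> u' + (k::mnum)"
proof -
  assume 1: "x + k = u + y" and 2: "x' + k' = u' + y'"
  have "x + y' \<le> x' + y \<longleftrightarrow> (x + y') + (k + k') \<le> (x' + y) + (k + k')" by simp
  also have "(x + y') + (k + k') = (x + k) + (y' + k')" by (simp add: ac_simps)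
  also have "\<dots> = (u + y) + (y' + k')" by (simp only: 1)
  also have "\<dots> = (u + k') + (y + y')" by (simp add: ac_simps)
  also have "(x' + y) + (k + k') = (x' + k') + (y + k)" by (simp add: ac_simps)
  also have "\<dots> = (u' + y') + (y + k)" by (simp only: 2)
  also have "\<dots> = (u' + k) + (y + y')" by (simp add: ac_simps)
  finally show ?thesis by simp
qed

lemma zrel_plus:
  fixes x y u k x' y' u' k' :: mnum
  assumes "x + k = u + y" "x' + k' = u' + y'"
  shows "x + x' + (k + k') = u + u' + (y + y')"
proof -
  have "x + x' + (k + k') = (x + k) + (x' + k')" by (simp add: ac_simps)
  also have "\<dots> = (u + y) + (u' + y')" by (simp only: assms)
  finally show ?thesis by (simp add: ac_simps)
qed

lemma zrel_times:
  fixes x y u k x' y' u' k' :: mnum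
  assumes "x + k = u + y" "x' + k' = u' + y'"
  shows "x * x' + y * y' + (u * k' + k * u') = u * u' + k * k' + (x * y' + y * x')"
\<comment> \<open>The factors are exchanged one at a time; the intermediate product is that of the
  pairs (u, k) and (x', y').\<close>
proof (rule zrel_trans[of _ "u * y' + k * x'" "u * x' + k * y'"])
  have "x * x' + y * y' + (u * y' + k * x') = (x + k) * x' + (u + y) * y'"
    by (simp add: algebra_simps)
  also have "\<dots> = (u + y) * x' + (x + k) * y'" using assms by simp
  finally show "x * x' + y * y' + (u * y' + k * x') = u * x' + k * y' + (x * y' + y * x')"
    by (simp add: algebra_simps)
  have "u * x' + k * y' + (u * k' + k * u') = u * (x' + k') + k * (u' + y')"
    by (simp add: algebra_simps)
  also have "\<dots> = u * (u' + y') + k * (x' + k')" using assms by simp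
  finally show "u * x' + k * y' + (u * k' + k * u') = u * u' + k * k' + (u * y' + k * x')"
    by (simp add: algebra_simps)
qed

text \<open>This is 0 < (p - q) * (t - s), rearranged so that no negative terms occur.\<close>

lemma mnum_mult_strict:
  fixes s t p q :: mnum
  assumes "s < t" "q < p"
  shows "p * s + q * t < p * t + q * s"
proof -
  have "0 < p - q" using assms by (metis add.right_neutral add_less_cancel_left le_add_diff_inverse less_imp_le)
  then have "(p - q) * s < (p - q) * t" using assms by (intro mult_strict_left_mono)
  then have "(p - q) * s + (q * s + q * t) < (p - q) * t + (q * s + q * t)" by simp
  also have "(p - q) * s + (q * s + q * t) = (p - q + q) * s + q * t" by (simp add: algebra_simps)
  also have "(p - q) * t + (q * s + q * t) = (p - q + q) * t + q * s" by (simp add: algebra_simps)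
  also have "p - q + q = p" using assms by simp
  finally show ?thesis .
qed

lemma mnum_mult:
  fixes x y u k p q :: mnum
  assumes "x + k < u + y" "q < p"
  shows "p * x + q * y + (p * k + q * u) < p * u + q * k + (p * y + q * x)"
  using mnum_mult_strict[OF assms] by (simp add: algebra_simps)

lemma mnum_le_add:
  fixes x y u k c d :: mnum
  assumes "x + k \<le> u + y"
  shows "c + x + (d + k) \<le> c + u + (d + y)"
proof -
  have "(x + k) + (c + d) \<le> (u + y) + (c + d)"
    using assms by simp
  then show ?thesis by (simp add: ac_simps)
qed

lemma mnum_le_trans:
  fixes x y u k a b :: mnum
  assumes "x + k \<le> u + y" "u + b \<le> a + k"
  shows "x + b \<le> a + y"
proof -
  have "(x + k) + (u + b) \<le> (u + y) + (a + k)"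
    using assms by (rule add_mono)
  then have "(x + b) + (u + k) \<le> (a + y) + (u + k)" by (simp add: ac_simps)
  then show ?thesis by (simp only: add_le_cancel_right)
qed

instantiation mint :: linordered_idom
begin

lift_definition zero_mint :: mint is "(0, 0)" .
lift_definition one_mint :: mint is "(1, 0)" .
lift_definition plus_mint :: "mint \<Rightarrow> mint \<Rightarrow> mint" is "\<lambda>(x, y) (u, k). (x + u, y + k)"
  by (simp only: split_paired_all prod.case zrel_iff, erule (1) zrel_plus)
lift_definition uminus_mint :: "mint \<Rightarrow> mint" is "\<lambda>(x, y). (y, x)"
  by (auto simp: add.commute)
definition minus_mint :: "mint \<Rightarrow> mint \<Rightarrow> mint" where "(x::mint) - y = x + - y"
lift_definition times_mint :: "mint \<Rightarrow> mint \<Rightarrow> mint" is "\<lambda>(x, y) (u, k). (x * u + y * k, x * k + y * u)"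
  by (simp only: split_paired_all prod.case zrel_iff, erule (1) zrel_times)
lift_definition less_eq_mint :: "mint \<Rightarrow> mint \<Rightarrow> bool" is "\<lambda>(x, y) (u, k). x + k \<le> u + y"
  by (simp only: split_paired_all prod.case zrel_iff, erule (1) zrel_le)
definition less_mint :: "mint \<Rightarrow> mint \<Rightarrow> bool" where "(x::mint) < y \<longleftrightarrow> x \<le> y \<and> \<not> y \<le> x"
definition abs_mint :: "mint \<Rightarrow> mint" where "\<bar>x::mint\<bar> = (if x < 0 then - x else x)"
definition sgn_mint :: "mint \<Rightarrow> mint" where "sgn (x::mint) = (if x = 0 then 0 else if 0 < x then 1 else - 1)"

instance
proof
  fix a b c :: mint
  show "a + b + c = a + (b + c)" by transfer (auto simp: ac_simps)
  show "a + b = b + a" by transfer (auto simp: ac_simps)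
  show "0 + a = a" by transfer auto
  show "- a + a = 0" by transfer (auto simp: ac_simps)
  show "a - b = a + - b" by (rule minus_mint_def)
  show "a + b - a = b" "a - b - c = a - (b + c)"
    unfolding minus_mint_def by (transfer; auto simp: ac_simps)+
  show "0 * a = 0" "a * 0 = 0" by (transfer; auto)+
  show "a * b * c = a * (b * c)" by transfer (auto simp: algebra_simps)
  show "a * b = b * a" by transfer (auto simp: algebra_simps)
  show "1 * a = a" by transfer auto
  show "(a + b) * c = a * c + b * c" by transfer (auto simp: algebra_simps)
  show "(0::mint) \<noteq> 1" by transfer auto
  show "a \<le> a" by transfer auto
  show "a \<le> b \<Longrightarrow> b \<le> a \<Longrightarrow> a = b" by transfer auto
  show "a \<le> b \<or> b \<le> a" by transfer auto
  show "a < b \<longleftrightarrow> a \<le> b \<and> \<not> b \<le> a" by (rule less_mint_def)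
  show "a \<le> b \<Longrightarrow> c + a \<le> c + b"
    by transfer (simp only: split_paired_all prod.case, erule mnum_le_add)
  show "\<bar>a\<bar> = (if a < 0 then - a else a)" by (rule abs_mint_def)
  show "sgn a = (if a = 0 then 0 else if 0 < a then 1 else - 1)" by (rule sgn_mint_def)
  show "a \<le> b \<Longrightarrow> b \<le> c \<Longrightarrow> a \<le> c"
    by transfer (simp only: split_paired_all prod.case, erule (1) mnum_le_trans)
  show "a < b \<Longrightarrow> 0 < c \<Longrightarrow> c * a < c * b"
    unfolding less_mint_def
    by transfer (simp only: split_paired_all prod.case not_le add_0_left add_0_right,
      blast intro: mnum_mult less_imp_le)
qed

end

definition mint_of :: "mnum \<Rightarrow> mint" where
  "mint_of x = Abs_mint (x, 0)"

lemma mnum_nonneg: "0 \<le> (x::mnum)"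
  by (auto simp: less_eq_mnum_def)

lemma mint_of:
  "mint_of 0 = 0" "mint_of 1 = 1" "mint_of (x + y) = mint_of x + mint_of y"
  "mint_of (x * y) = mint_of x * mint_of y" "0 \<le> mint_of x" "mint_of x = mint_of y \<longleftrightarrow> x = y"
  by (simp_all add: mint_of_def zero_mint_def one_mint_def plus_mint.abs_eq times_mint.abs_eq
      less_eq_mint.abs_eq mint.abs_eq_iff mnum_nonneg)

definition field_of :: "tm \<Rightarrow> mint fract" where
  "field_of x = Fract (mint_of (Abs_mnum x)) 1"

lemma field_of:
  assumes "counterexample M" "x \<in> Dom the_counterexample T0" "y \<in> Dom the_counterexample T0"
  shows "field_of (Zer (arith_of the_counterexample)) = 0" "field_of (One (arith_of the_counterexample)) = 1"
    "field_of (Pls (arith_of the_counterexample) x y) = field_of x + field_of y"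
    "field_of (Tms (arith_of the_counterexample) x y) = field_of x * field_of y"
    "0 \<le> field_of x" "field_of x = field_of y \<longleftrightarrow> x = y"
proof -
  have A: "the_arith = arith_of the_counterexample"
    by (rule the_arith(2)[OF assms(1)])
  have xy: "x \<in> Car the_arith" "y \<in> Car the_arith"
    using assms by (auto simp: A arith_of_def)
  have "Abs_mnum (Zer the_arith) = 0" "Abs_mnum (One the_arith) = 1"
    by (simp_all add: zero_mnum_def one_mnum_def)
  moreover have "Abs_mnum (Pls the_arith x y) = Abs_mnum x + Abs_mnum y"
    "Abs_mnum (Tms the_arith x y) = Abs_mnum x * Abs_mnum y"
    using xy by (simp_all add: plus_mnum_def times_mnum_def Abs_mnum_inverse)
  ultimately show "field_of (Zer (arith_of the_counterexample)) = 0" "field_of (One (arith_of the_counterexample)) = 1"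
    "field_of (Pls (arith_of the_counterexample) x y) = field_of x + field_of y"
    "field_of (Tms (arith_of the_counterexample) x y) = field_of x * field_of y"
    by (simp_all add: A[symmetric] field_of_def mint_of Zero_fract_def One_fract_def)
  show "0 \<le> field_of x"
    by (simp add: field_of_def mint_of Zero_fract_def)
  show "field_of x = field_of y \<longleftrightarrow> x = y"
    using xy by (simp add: field_of_def mint_of eq_fract Abs_mnum_inject)
qed

text \<open>The analysis is carried out in any model whose numbers embed in an ordered field. Such
  an embedding is constructed for the counterexample only, which is enough to refute it.\<close>

locale num_model = ext_model D M for D :: sig and M :: "'m interp" +
  fixes nu :: "'m \<Rightarrow> 'q::linordered_field"
  assumes nu_Z [simp]: "nu Z = 0"
    and nu_S [simp]: "n \<in> N \<Longrightarrow> nu (S n) = nu n + 1"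
    and nu_add [simp]: "n \<in> N \<Longrightarrow> m \<in> N \<Longrightarrow> nu (n \<oplus> m) = nu n + nu m"
    and nu_mult [simp]: "n \<in> N \<Longrightarrow> m \<in> N \<Longrightarrow> nu (n \<otimes> m) = nu n * nu m"
    and nu_nonneg [simp]: "n \<in> N \<Longrightarrow> 0 \<le> nu n"
    and nu_inject: "n \<in> N \<Longrightarrow> m \<in> N \<Longrightarrow> nu n = nu m \<longleftrightarrow> n = m"

lemma (in ext_model) num_modelI:
  fixes nu :: "'m \<Rightarrow> 'q::linordered_field"
  assumes "nu Z = 0" "nu (S Z) = 1" "\<And>n m. n \<in> N \<Longrightarrow> m \<in> N \<Longrightarrow> nu (n \<oplus> m) = nu n + nu m"
    "\<And>n m. n \<in> N \<Longrightarrow> m \<in> N \<Longrightarrow> nu (n \<otimes> m) = nu n * nu m" "\<And>n. n \<in> N \<Longrightarrow> 0 \<le> nu n"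
    "\<And>n m. n \<in> N \<Longrightarrow> m \<in> N \<Longrightarrow> nu n = nu m \<longleftrightarrow> n = m"
  shows "num_model D M nu"
proof
  fix n assume n: "n \<in> N"
  then have "nu (n \<oplus> S Z) = nu n + nu (S Z)" by (intro assms) auto
  then show "nu (S n) = nu n + 1" using n assms(2) by simp
qed (use assms in auto)

lemma num_model_counterexample:
  assumes "counterexample M"
  obtains D i e A where "num_model D the_counterexample field_of" "D T2 i = Some exists2_spec"
    "is_env the_counterexample e" "\<not> sat the_counterexample e A"
    "A \<in> {relat exists2 \<^bold>\<longleftrightarrow> Pi01_TRANS, Pi01_TRANS \<^bold>\<longleftrightarrow> IVT_star, IVT_star \<^bold>\<longleftrightarrow> E_UIVT_st}"
proof -
  let ?M = the_counterexample
  obtain D i e A where *: "ext_model D ?M" "D T2 i = Some exists2_spec" "is_env ?M e" "\<not> sat ?M e A"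
    "A \<in> {relat exists2 \<^bold>\<longleftrightarrow> Pi01_TRANS, Pi01_TRANS \<^bold>\<longleftrightarrow> IVT_star, IVT_star \<^bold>\<longleftrightarrow> E_UIVT_st}"
    using the_counterexample[OF assms] unfolding counterexample_def by blast
  interpret ext_model D ?M by (rule *)
  note f = field_of[OF assms, unfolded arith_of_simps]
  have "num_model D ?M field_of"
    by (rule num_modelI) (use f f(1,2)[OF Dom_consts(1) Dom_consts(1)] f(5)[OF _ Dom_consts(1)] in auto)
  with * show thesis by (intro that)
qed

context num_model
begin

section \<open>Rational numbers in models\<close>

subsection \<open>Arithmetical functions\<close>

lemma nu_monus [simp]: "n \<in> N \<Longrightarrow> m \<in> N \<Longrightarrow> nu (n \<ominus> m) = max 0 (nu n - nu m)"
proof -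
  assume n: "n \<in> N" and m: "m \<in> N"
  from monus_total[OF m n] show ?thesis
  proof
    assume "m \<oplus> (n \<ominus> m) = n"
    then have "nu m + nu (n \<ominus> m) = nu n" using n m nu_add[of m "n \<ominus> m"] by simp
    moreover have "0 \<le> nu (n \<ominus> m)" using n m by simp
    ultimately show ?thesis by (simp add: max_def)
  next
    assume *: "n \<oplus> (m \<ominus> n) = m"
    then have "n \<ominus> m = Z" using monus_add_eq_Z[of n "m \<ominus> n"] n m by simp
    moreover have "nu n \<le> nu m"
      using * n m nu_add[of n "m \<ominus> n"] nu_nonneg[of "m \<ominus> n"] by simp
    ultimately show ?thesis by (simp add: max_def)
  qed
qed

lemma nu_eq_0 [simp]: "n \<in> N \<Longrightarrow> nu n = 0 \<longleftrightarrow> n = Z"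
  using nu_inject[of n Z] by simp

text \<open>The field is dense, but the numbers are discrete in it: a nonzero truncated difference
  is a successor.\<close>

lemma nu_less_iff: "n \<in> N \<Longrightarrow> m \<in> N \<Longrightarrow> nu n < nu m \<longleftrightarrow> nu n + 1 \<le> nu m"
proof
  assume n: "n \<in> N" "m \<in> N" and less: "nu n < nu m"
  then have 1: "nu (m \<ominus> n) = nu m - nu n" by (simp add: max_def)
  then have "m \<ominus> n \<noteq> Z" using less by auto
  then have "m \<ominus> n = S (PRED \<bullet> (m \<ominus> n))" using N_cases[OF N_closed(4)[OF n(2,1)]] by blast
  then have "nu (m \<ominus> n) = nu (PRED \<bullet> (m \<ominus> n)) + 1"
    using n by (metis nu_S N_closed(3,4))
  moreover have "0 \<le> nu (PRED \<bullet> (m \<ominus> n))" using n by simp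
  ultimately show "nu n + 1 \<le> nu m" using 1 by linarith
qed simp

lemma monus_eq_Z: "n \<in> N \<Longrightarrow> m \<in> N \<Longrightarrow> n \<ominus> m = Z \<longleftrightarrow> nu n \<le> nu m"
  using nu_eq_0[of "n \<ominus> m"] nu_monus[of n m] by (auto simp: max_def split: if_splits)

lemma nu_less_S_iff: "n \<in> N \<Longrightarrow> m \<in> N \<Longrightarrow> nu n < nu m + 1 \<longleftrightarrow> nu n \<le> nu m"
  using nu_less_iff[of n "S m"] by simp

lemma nu_le_cases: "n \<in> N \<Longrightarrow> m \<in> N \<Longrightarrow> nu n \<le> nu m \<Longrightarrow> \<exists>k\<in>N. m = n \<oplus> k"
  using monus_total[of n m] monus_total[of m n] nu_inject[of m "n \<oplus> (m \<ominus> n)"]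
  by (intro bexI[of _ "m \<ominus> n"]) auto

abbreviation tmN :: "tm \<Rightarrow> bool" where "tmN t \<equiv> wt D t \<and> ty_of t = T0"

lemma eval_N [simp]: "wt D t \<Longrightarrow> ty_of t = T0 \<Longrightarrow> is_env M e \<Longrightarrow> eval M e t \<in> N"
  by (rule eval_in)

lemma sat_le [simp]:
  "wt D t \<Longrightarrow> ty_of t = T0 \<Longrightarrow> wt D u \<Longrightarrow> ty_of u = T0 \<Longrightarrow> is_env M e \<Longrightarrow>
   sat M e (le t u) \<longleftrightarrow> nu (eval M e t) \<le> nu (eval M e u)"
proof -
  assume a: "wt D t" "ty_of t = T0" "wt D u" "ty_of u = T0" "is_env M e"
  then have "sat M e (le t u) \<longleftrightarrow> nu (eval M e t \<ominus> eval M e u) = 0"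
    by (simp add: le_def del: nu_monus)
  also have "\<dots> \<longleftrightarrow> nu (eval M e t) \<le> nu (eval M e u)"
    using a by (subst nu_monus) (auto simp: max_def)
  finally show ?thesis .
qed

lemma sat_lt' [simp]:
  "wt D t \<Longrightarrow> ty_of t = T0 \<Longrightarrow> wt D u \<Longrightarrow> ty_of u = T0 \<Longrightarrow> is_env M e \<Longrightarrow>
   sat M e (lt t u) \<longleftrightarrow> nu (eval M e t) < nu (eval M e u)"
proof -
  assume a: "wt D t" "ty_of t = T0" "wt D u" "ty_of u = T0" "is_env M e"
  then have "sat M e (lt t u) \<longleftrightarrow> nu (S (eval M e t) \<ominus> eval M e u) = 0"
    by (simp add: lt_def del: nu_monus)
  also have "\<dots> \<longleftrightarrow> nu (eval M e t) < nu (eval M e u)"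
    using a by (subst nu_monus) (auto simp: max_def nu_less_iff)
  finally show ?thesis .
qed

lemma wf_le_lt [simp]:
  "wf D (le t u) \<longleftrightarrow> wf D (monus t u \<^bold>= zero)" "wf D (lt t u) \<longleftrightarrow> wf D (monus (suc t) u \<^bold>= zero)"
  "qfree (le t u)" "qfree (lt t u)"
  by (auto simp: le_def lt_def)

lemma dist_eq: "n \<in> N \<Longrightarrow> m \<in> N \<Longrightarrow> nu (DIST \<bullet> n \<bullet> m) = \<bar>nu n - nu m\<bar>"
  by (simp add: DIST_def dist_c_def max_def abs_if)

lemma pow2_rec [simp]: "POW2 \<bullet> Z = S Z" "n \<in> N \<Longrightarrow> POW2 \<bullet> S n = POW2 \<bullet> n \<oplus> POW2 \<bullet> n"
  by (simp_all add: POW2_def pow2_c_def eval_rec eval_scons_indep[where d = "S n" and d' = n for n])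

lemma cond_eq: "c \<in> N \<Longrightarrow> a \<in> N \<Longrightarrow> b \<in> N \<Longrightarrow> COND \<bullet> c \<bullet> a \<bullet> b = (if c = Z then a else b)"
proof (cases "c = Z")
  case False
  assume *: "c \<in> N" "a \<in> N" "b \<in> N"
  then obtain p where "p \<in> N" "c = S p"
    using N_cases[of c] False N_closed(3)[of c] by blast
  with * show ?thesis by (simp add: COND_def cond_c_def eval_rec)
qed (simp add: COND_def cond_c_def eval_rec)

lemma sum_rec [simp]:
  "f \<in> Dom M T1 \<Longrightarrow> SUMB \<bullet> f \<bullet> Z = Z"
  "f \<in> Dom M T1 \<Longrightarrow> n \<in> N \<Longrightarrow> SUMB \<bullet> f \<bullet> S n = SUMB \<bullet> f \<bullet> n \<oplus> f \<bullet> n"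
  by (simp_all add: SUMB_def sum_c_def eval_rec eval_scons_indep[where d = "S n" and d' = n for n])

lemma tri_rec [simp]: "TRI \<bullet> Z = Z" "n \<in> N \<Longrightarrow> TRI \<bullet> S n = TRI \<bullet> n \<oplus> S n"
  by (simp_all add: TRI_def tri_c_def eval_rec eval_scons_indep[where d = "S n" and d' = n for n])

lemma fun_N [simp]: "f \<in> Dom M T1 \<Longrightarrow> n \<in> N \<Longrightarrow> f \<bullet> n \<in> N"
  by (rule Ap_Dom)

text \<open>Partial sums are monotone, so a vanishing sum has vanishing terms. Through this lemma a
  term decides a bounded quantifier, where a formula for induction could not contain one.\<close>

lemma sum_eq_Z:
  assumes f: "f \<in> Dom M T1" and n: "n \<in> N"
  shows "SUMB \<bullet> f \<bullet> n = Z \<longleftrightarrow> (\<forall>k\<in>N. nu k < nu n \<longrightarrow> f \<bullet> k = Z)"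
proof
  assume 0: "SUMB \<bullet> f \<bullet> n = Z"
  show "\<forall>k\<in>N. nu k < nu n \<longrightarrow> f \<bullet> k = Z"
  proof (intro ballI impI)
    fix k assume k: "k \<in> N" "nu k < nu n"
    then obtain i where i: "i \<in> N" "n = S k \<oplus> i"
      using nu_le_cases[of "S k" n] n nu_less_iff[of k n] by auto
    have "sat M (scons T0 i (scons T0 (S k) (scons T1 f dflt)))
      (le (sum_below (Var T1 0) (v 1)) (sum_below (Var T1 0) (add (v 1) (v 0))))"
      by (rule qf_ind) (use f k i in \<open>auto intro: order_trans\<close>)
    then have "nu (SUMB \<bullet> f \<bullet> S k) \<le> nu (SUMB \<bullet> f \<bullet> n)"
      unfolding i(2) using f k i(1) by simp
    then have "nu (SUMB \<bullet> f \<bullet> k) + nu (f \<bullet> k) \<le> 0" using 0 f k by simp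
    moreover have "0 \<le> nu (SUMB \<bullet> f \<bullet> k)" "0 \<le> nu (f \<bullet> k)" using f k by auto
    ultimately have "nu (f \<bullet> k) = 0" by linarith
    then show "f \<bullet> k = Z" using f k by simp
  qed
next
  assume *: "\<forall>k\<in>N. nu k < nu n \<longrightarrow> f \<bullet> k = Z"
  \<comment> \<open>The bound n is kept as a parameter and compared with the running variable, as
    the terms are known to vanish only below n.\<close>
  have "sat M (scons T0 n (scons T0 n (scons T1 f dflt))) (le (v 0) (v 1) \<^bold>\<longrightarrow> sum_below (Var T1 0) (v 0) \<^bold>= zero)"
    by (rule qf_ind) (use f n * in auto)
  then show "SUMB \<bullet> f \<bullet> n = Z" using f n by simp
qed

lemma two_tri: "n \<in> N \<Longrightarrow> 2 * nu (TRI \<bullet> n) = nu n * (nu n + 1)"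
proof -
  assume n: "n \<in> N"
  have "sat M (scons T0 n dflt) (add (tri_c \<cdot> v 0) (tri_c \<cdot> v 0) \<^bold>= mult (v 0) (suc (v 0)))"
    by (rule qf_ind) (use n in \<open>simp_all add: nu_inject[symmetric] algebra_simps del: mult_rec\<close>)
  then show ?thesis using n by (simp add: nu_inject[symmetric] del: mult_rec)
qed

lemma tri_mono: "n \<in> N \<Longrightarrow> m \<in> N \<Longrightarrow> nu n \<le> nu m \<Longrightarrow> nu (TRI \<bullet> n) \<le> nu (TRI \<bullet> m)"
  using two_tri[of n] two_tri[of m] mult_mono[of "nu n" "nu m" "nu n + 1" "nu m + 1"] by simp

lemma root_rec:
  "ROOT \<bullet> Z = Z"
  "n \<in> N \<Longrightarrow> ROOT \<bullet> S n = (if nu (TRI \<bullet> S (ROOT \<bullet> n)) \<le> nu n + 1 then S (ROOT \<bullet> n) else ROOT \<bullet> n)"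
proof -
  show "ROOT \<bullet> Z = Z" by (simp add: ROOT_def root_c_def eval_rec)
  assume n: "n \<in> N"
  have "ROOT \<bullet> S n = COND \<bullet> (TRI \<bullet> S (ROOT \<bullet> n) \<ominus> S n) \<bullet> S (ROOT \<bullet> n) \<bullet> (ROOT \<bullet> n)"
    using n by (simp add: ROOT_def root_c_def eval_rec eval_scons_indep[where d = "S n" and d' = n for n]
        del: tri_rec monus_rec)
  moreover have "TRI \<bullet> S (ROOT \<bullet> n) \<ominus> S n = Z \<longleftrightarrow> nu (TRI \<bullet> S (ROOT \<bullet> n)) \<le> nu n + 1"
    using n by (simp add: monus_eq_Z del: tri_rec monus_rec)
  ultimately show "ROOT \<bullet> S n = (if nu (TRI \<bullet> S (ROOT \<bullet> n)) \<le> nu n + 1 then S (ROOT \<bullet> n) else ROOT \<bullet> n)"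
    using n by (simp add: cond_eq del: tri_rec monus_rec)
qed

lemma root_bounds: "z \<in> N \<Longrightarrow> nu (TRI \<bullet> (ROOT \<bullet> z)) \<le> nu z \<and> nu z < nu (TRI \<bullet> S (ROOT \<bullet> z))"
proof -
  assume z: "z \<in> N"
  have "sat M (scons T0 z dflt) (le (tri_c \<cdot> (root_c \<cdot> v 0)) (v 0) \<^bold>\<and> lt (v 0) (tri_c \<cdot> suc (root_c \<cdot> v 0)))"
  proof (rule qf_ind)
    fix z assume z: "z \<in> N" "sat M (scons T0 z dflt) (le (tri_c \<cdot> (root_c \<cdot> v 0)) (v 0) \<^bold>\<and> lt (v 0) (tri_c \<cdot> suc (root_c \<cdot> v 0)))"
    then have *: "nu (TRI \<bullet> (ROOT \<bullet> z)) \<le> nu z" "nu z + 1 \<le> nu (TRI \<bullet> S (ROOT \<bullet> z))"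
      by (simp_all add: nu_less_iff[of z] del: tri_rec)
    have "0 \<le> nu (ROOT \<bullet> z)" using z by simp
    then have "nu (TRI \<bullet> (ROOT \<bullet> S z)) \<le> nu z + 1 \<and> nu z + 1 < nu (TRI \<bullet> S (ROOT \<bullet> S z))"
      using * z by (auto simp: root_rec not_le)
    then show "sat M (scons T0 (S z) dflt) (le (tri_c \<cdot> (root_c \<cdot> v 0)) (v 0) \<^bold>\<and> lt (v 0) (tri_c \<cdot> suc (root_c \<cdot> v 0)))"
      using z by (simp del: tri_rec)
  qed (use z in \<open>simp_all add: root_rec\<close>)
  then show ?thesis using z by (simp del: tri_rec)
qed

lemma pair_eq: "a \<in> N \<Longrightarrow> b \<in> N \<Longrightarrow> PAIR \<bullet> a \<bullet> b = TRI \<bullet> (a \<oplus> b) \<oplus> a"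
  by (simp add: PAIR_def pair_c_def)

lemma fst_eq: "z \<in> N \<Longrightarrow> FST \<bullet> z = z \<ominus> TRI \<bullet> (ROOT \<bullet> z)"
  by (simp add: FST_def fst_c_def)

lemma snd_eq: "z \<in> N \<Longrightarrow> SND \<bullet> z = ROOT \<bullet> z \<ominus> FST \<bullet> z"
  by (simp add: SND_def snd_c_def)

text \<open>The code of the pair lies between the triangular numbers of a + b and a + b + 1. A
  smaller or larger root would contradict the monotonicity of \<open>TRI\<close>.\<close>

lemma root_pair: "a \<in> N \<Longrightarrow> b \<in> N \<Longrightarrow> ROOT \<bullet> (PAIR \<bullet> a \<bullet> b) = a \<oplus> b"
proof -
  assume ab: "a \<in> N" "b \<in> N"
  define r where "r = ROOT \<bullet> (PAIR \<bullet> a \<bullet> b)"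
  have r: "r \<in> N" using ab by (simp add: r_def)
  have p: "nu (PAIR \<bullet> a \<bullet> b) = nu (TRI \<bullet> (a \<oplus> b)) + nu a" using ab by (simp add: pair_eq)
  have b: "nu (TRI \<bullet> r) \<le> nu (TRI \<bullet> (a \<oplus> b)) + nu a" "nu (TRI \<bullet> (a \<oplus> b)) + nu a < nu (TRI \<bullet> r) + nu r + 1"
    using root_bounds[of "PAIR \<bullet> a \<bullet> b"] ab r unfolding r_def[symmetric] p by auto
  have 1: "\<not> nu r < nu (a \<oplus> b)"
  proof
    assume "nu r < nu (a \<oplus> b)"
    then have "nu (TRI \<bullet> S r) \<le> nu (TRI \<bullet> (a \<oplus> b))"
      using ab r nu_less_iff[of r "a \<oplus> b"] by (intro tri_mono) (auto simp del: tri_rec)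
    moreover have "nu (TRI \<bullet> S r) = nu (TRI \<bullet> r) + nu r + 1" using r by simp
    moreover have "0 \<le> nu a" using ab by simp
    ultimately show False using b by linarith
  qed
  have 2: "\<not> nu (a \<oplus> b) < nu r"
  proof
    assume "nu (a \<oplus> b) < nu r"
    then have "nu (TRI \<bullet> S (a \<oplus> b)) \<le> nu (TRI \<bullet> r)"
      using ab r nu_less_iff[of "a \<oplus> b" r] by (intro tri_mono) (auto simp del: tri_rec)
    moreover have "nu (TRI \<bullet> S (a \<oplus> b)) = nu (TRI \<bullet> (a \<oplus> b)) + nu a + nu b + 1" using ab by simp
    moreover have "0 \<le> nu b" using ab by simp
    ultimately show False using b by linarith
  qed
  from 1 2 show ?thesis
    unfolding r_def[symmetric] using r ab nu_inject[of r "a \<oplus> b"] by (simp del: nu_add)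
qed

lemma fst_pair [simp]: "a \<in> N \<Longrightarrow> b \<in> N \<Longrightarrow> FST \<bullet> (PAIR \<bullet> a \<bullet> b) = a"
  by (simp add: fst_eq root_pair) (simp add: pair_eq monus_add')

lemma snd_pair [simp]: "a \<in> N \<Longrightarrow> b \<in> N \<Longrightarrow> SND \<bullet> (PAIR \<bullet> a \<bullet> b) = b"
  by (simp add: snd_eq root_pair monus_add')

subsection \<open>Rationals\<close>

definition h :: "'m \<Rightarrow> 'q" where "h n = 1 / nu (POW2 \<bullet> n)"

lemma pow2_pos [simp]: "n \<in> N \<Longrightarrow> 0 < nu (POW2 \<bullet> n)"
proof -
  assume n: "n \<in> N"
  have "sat M (scons T0 n dflt) (lt zero (pow2 (v 0)))"
    by (rule qf_ind) (use n in auto)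
  then show ?thesis using n by simp
qed

lemma h_rec [simp]: "h Z = 1" "n \<in> N \<Longrightarrow> h (S n) = h n / 2"
  by (simp_all add: h_def)

lemma h_pos [simp]: "n \<in> N \<Longrightarrow> 0 < h n"
  by (simp add: h_def)

text \<open>This bound makes 2^-k smaller than 1/k, which is how \<open>arch\<close> finds its power
  of two.\<close>

lemma pow2_ge: "n \<in> N \<Longrightarrow> nu n + 1 \<le> nu (POW2 \<bullet> n)"
proof -
  assume n: "n \<in> N"
  have "sat M (scons T0 n dflt) (lt (v 0) (pow2 (v 0)))"
  proof (rule qf_ind)
    fix n assume "n \<in> N" "sat M (scons T0 n dflt) (lt (v 0) (pow2 (v 0)))"
    then have "n \<in> N" "nu n + 1 \<le> nu (POW2 \<bullet> n)" "0 \<le> nu n"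
      using nu_less_iff[of n "POW2 \<bullet> n"] by simp_all
    moreover from this have "nu n + 1 < nu (POW2 \<bullet> n) + nu (POW2 \<bullet> n)" by linarith
    ultimately show "sat M (scons T0 (S n) dflt) (lt (v 0) (pow2 (v 0)))"
      by simp
  qed (use n in auto)
  then show ?thesis using n by (simp add: nu_less_iff)
qed

lemma h_mono: "n \<in> N \<Longrightarrow> m \<in> N \<Longrightarrow> nu n \<le> nu m \<Longrightarrow> h m \<le> h n"
proof -
  assume n: "n \<in> N" "m \<in> N" "nu n \<le> nu m"
  then obtain k where k: "k \<in> N" "m = n \<oplus> k" using nu_le_cases by blast
  have "sat M (scons T0 k (scons T0 n dflt)) (le (pow2 (v 1)) (pow2 (add (v 1) (v 0))))"
  proof (rule qf_ind)
    fix k assume "k \<in> N" "sat M (scons T0 k (scons T0 n dflt)) (le (pow2 (v 1)) (pow2 (add (v 1) (v 0))))"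
    moreover from this have "nu (POW2 \<bullet> n) \<le> nu (POW2 \<bullet> (n \<oplus> k))" "0 \<le> nu (POW2 \<bullet> (n \<oplus> k))"
      using n by simp_all
    then have "nu (POW2 \<bullet> n) \<le> nu (POW2 \<bullet> (n \<oplus> k)) + nu (POW2 \<bullet> (n \<oplus> k))" by linarith
    ultimately show "sat M (scons T0 (S k) (scons T0 n dflt)) (le (pow2 (v 1)) (pow2 (add (v 1) (v 0))))"
      using n by simp
  qed (use k n in auto)
  then have "nu (POW2 \<bullet> n) \<le> nu (POW2 \<bullet> m)" using n k by simp
  then show ?thesis using n by (simp add: h_def frac_le)
qed

text \<open>The rational with code \<open>k\<close>, as an element of the field.\<close>

definition val :: "'m \<Rightarrow> 'q" where
  "val k = (nu (FST \<bullet> (FST \<bullet> k)) - nu (SND \<bullet> (FST \<bullet> k))) / (nu (SND \<bullet> k) + 1)"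

lemma val_pair [simp]:
  "a \<in> N \<Longrightarrow> b \<in> N \<Longrightarrow> d \<in> N \<Longrightarrow> val (PAIR \<bullet> (PAIR \<bullet> a \<bullet> b) \<bullet> d) = (nu a - nu b) / (nu d + 1)"
  by (simp add: val_def)

lemma val_Z [simp]: "val Z = 0"
proof -
  have "PAIR \<bullet> Z \<bullet> Z = Z" by (simp add: pair_eq)
  then show ?thesis using val_pair[of Z Z Z] by simp
qed

text \<open>The condition under which a formal fraction denotes: number terms and a positive
  denominator. Simplification propagates it through the operations on fractions.\<close>

definition fok :: "(ty \<Rightarrow> nat \<Rightarrow> 'm) \<Rightarrow> frac \<Rightarrow> bool" where
  "fok e p = (case p of (a, b, d) \<Rightarrow> tmN a \<and> tmN b \<and> tmN d \<and> is_env M e \<and> 0 < nu (eval M e d))"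

definition fval :: "(ty \<Rightarrow> nat \<Rightarrow> 'm) \<Rightarrow> frac \<Rightarrow> 'q" where
  "fval e p = (case p of (a, b, d) \<Rightarrow> (nu (eval M e a) - nu (eval M e b)) / nu (eval M e d))"

lemma fok_decode [simp]: "wt D t \<Longrightarrow> ty_of t = T0 \<Longrightarrow> is_env M e \<Longrightarrow> fok e (decode t)"
  by (simp add: fok_def decode_def add_nonneg_pos)

lemma fval_decode [simp]: "wt D t \<Longrightarrow> ty_of t = T0 \<Longrightarrow> is_env M e \<Longrightarrow> fval e (decode t) = val (eval M e t)"
  by (simp add: fval_def decode_def val_def)

lemma fok_pow [simp]: "wt D t \<Longrightarrow> ty_of t = T0 \<Longrightarrow> is_env M e \<Longrightarrow> fok e (frac_pow t)"
  by (simp add: fok_def frac_pow_def)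

lemma fval_pow [simp]: "wt D t \<Longrightarrow> ty_of t = T0 \<Longrightarrow> is_env M e \<Longrightarrow> fval e (frac_pow t) = h (eval M e t)"
  by (simp add: fval_def frac_pow_def h_def)

lemma fok_add [simp]: "fok e p \<Longrightarrow> fok e q \<Longrightarrow> fok e (frac_add p q)"
  by (cases p; cases q) (simp add: fok_def)

lemma frac_sum:
  fixes a b c d u w :: 'q
  assumes "0 < d" "0 < w"
  shows "(a - b) / d + (c - u) / w = ((a * w + c * d) - (b * w + u * d)) / (d * w)"
  using assms by (simp add: field_simps)

lemma fval_add [simp]: "fok e p \<Longrightarrow> fok e q \<Longrightarrow> fval e (frac_add p q) = fval e p + fval e q"
  by (cases p; cases q) (simp add: fok_def fval_def frac_sum)

lemma fok_dist [simp]: "fok e p \<Longrightarrow> fok e q \<Longrightarrow> fok e (frac_dist p q)"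
  by (cases p; cases q) (simp add: fok_def)

lemma frac_diff:
  fixes a b c d u w :: 'q
  assumes "0 < d" "0 < w"
  shows "(a - b) / d - (c - u) / w = ((a * w + u * d) - (c * d + b * w)) / (d * w)"
  using assms by (simp add: field_simps)

lemma fval_dist [simp]: "fok e p \<Longrightarrow> fok e q \<Longrightarrow> fval e (frac_dist p q) = \<bar>fval e p - fval e q\<bar>"
proof (cases p; cases q)
  fix a b d a' b' d' assume "fok e p" "fok e q" and [simp]: "p = (a, b, d)" "q = (a', b', d')"
  then have *: "tmN a" "tmN b" "tmN d" "tmN a'" "tmN b'" "tmN d'" "is_env M e" "0 < nu (eval M e d)" "0 < nu (eval M e d')"
    by (auto simp: fok_def)
  then show "fval e (frac_dist p q) = \<bar>fval e p - fval e q\<bar>"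
    by (simp add: fval_def frac_diff dist_eq abs_divide abs_mult)
qed

lemma frac_less_iff:
  fixes a b c d u w :: 'q
  assumes "0 < d" "0 < w"
  shows "(a - b) / d < (c - u) / w \<longleftrightarrow> a * w + u * d < c * d + b * w"
proof -
  have "(a - b) / d < (c - u) / w \<longleftrightarrow> (a - b) / d - (c - u) / w < 0" by simp
  also have "\<dots> \<longleftrightarrow> a * w + u * d < c * d + b * w"
    using mult_pos_pos[OF assms] by (simp add: frac_diff[OF assms] divide_less_0_iff)
  finally show ?thesis .
qed

lemma sat_frac_less [simp]: "fok e p \<Longrightarrow> fok e q \<Longrightarrow> sat M e (frac_less p q) \<longleftrightarrow> fval e p < fval e q"
  by (cases p; cases q) (simp add: fok_def fval_def frac_less_iff)

lemma sat_frac_le [simp]: "fok e p \<Longrightarrow> fok e q \<Longrightarrow> sat M e (frac_le p q) \<longleftrightarrow> fval e p \<le> fval e q"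
proof (cases p; cases q)
  fix a b d a' b' d' assume "fok e p" "fok e q" and [simp]: "p = (a, b, d)" "q = (a', b', d')"
  then have *: "tmN a" "tmN b" "tmN d" "tmN a'" "tmN b'" "tmN d'" "is_env M e" "0 < nu (eval M e d)" "0 < nu (eval M e d')"
    by (auto simp: fok_def)
  then have "fval e q < fval e p \<longleftrightarrow> sat M e (frac_less q p)"
    using \<open>fok e p\<close> \<open>fok e q\<close> by (simp only: sat_frac_less)
  then show "sat M e (frac_le p q) \<longleftrightarrow> fval e p \<le> fval e q"
    using * by (simp add: not_less[symmetric])
qed

lemma tmN_frac_less_char: "fok e p \<Longrightarrow> fok e q \<Longrightarrow> tmN (frac_less_char p q)"
  by (cases p; cases q) (simp add: fok_def)

lemma frac_less_char_eq: "fok e p \<Longrightarrow> fok e q \<Longrightarrow> eval M e (frac_less_char p q) = Z \<longleftrightarrow> fval e p < fval e q"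
proof (cases p; cases q)
  fix a b d a' b' d' assume f: "fok e p" "fok e q" and [simp]: "p = (a, b, d)" "q = (a', b', d')"
  then have *: "tmN a" "tmN b" "tmN d" "tmN a'" "tmN b'" "tmN d'" "is_env M e" "0 < nu (eval M e d)" "0 < nu (eval M e d')"
    by (auto simp: fok_def)
  let ?x = "eval M e (add (mult a' d) (mult b d'))" and ?y = "eval M e (add (mult a d') (mult b' d))"
  have xy: "?x \<in> N" "?y \<in> N" using * by (auto simp del: eval.simps intro!: eval_N)
  have "eval M e (frac_less_char p q) = S Z \<ominus> (?x \<ominus> ?y)" by simp
  then have "eval M e (frac_less_char p q) = Z \<longleftrightarrow> nu (S Z) \<le> nu (?x \<ominus> ?y)"
    using monus_eq_Z[of "S Z" "?x \<ominus> ?y"] xy by (simp del: eval.simps nu_monus monus_rec)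
  also have "\<dots> \<longleftrightarrow> nu ?y < nu ?x" using xy nu_less_iff[OF xy(2,1)] by (auto simp add: max_def simp del: eval.simps)
  also have "\<dots> \<longleftrightarrow> fval e p < fval e q"
    using * by (simp add: fval_def frac_less_iff)
  finally show "eval M e (frac_less_char p q) = Z \<longleftrightarrow> fval e p < fval e q" .
qed

lemma wf_fracs [simp]:
  "fok e p \<Longrightarrow> fok e q \<Longrightarrow> wf D (frac_less p q)" "fok e p \<Longrightarrow> fok e q \<Longrightarrow> wf D (frac_le p q)"
  "qfree (frac_less p q)" "qfree (frac_le p q)"
  by (cases p; cases q; simp add: fok_def)+

end

section \<open>Typing and relativisation of the terms for reals\<close>

lemma tmN_dist_char [simp]:
  assumes "wt D t" "ty_of t = T0" "wt D u" "ty_of u = T0" "wt D w" "ty_of w = T0"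
  shows "wt D (frac_less_char (frac_dist (decode t) (decode u)) (frac_pow w))"
    and "ty_of (frac_less_char (frac_dist (decode t) (decode u)) (frac_pow w)) = T0"
  using assms by (simp_all add: decode_def frac_pow_def)

lemma hat_typing [simp]:
  "fv_tm violations_c = {}" "wt D violations_c" "ty_of violations_c = T1 \<rightarrow> T1"
  "fv_tm hat_c = {}" "wt D hat_c" "ty_of hat_c = T1 \<rightarrow> T1"
proof -
  show 1: "fv_tm violations_c = {}"
    by (auto simp: violations_c_def decode_def frac_pow_def split: if_splits)
  show 2: "wt D violations_c" "ty_of violations_c = T1 \<rightarrow> T1" for D
    by (simp_all add: violations_c_def)
  then show "wt D hat_c" "ty_of hat_c = T1 \<rightarrow> T1"
    by (simp_all add: hat_c_def)
  show "fv_tm hat_c = {}"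
    using 1 by (auto simp: hat_c_def split: if_splits)
qed

lemma real_consts_typing [simp]:
  "fv_tm real_0 = {}" "wt D real_0" "ty_of real_0 = T1" "fv_tm real_1 = {}" "wt D real_1" "ty_of real_1 = T1"
  by (auto simp: real_0_def real_1_def)

lemma relat_frac [simp]:
  "relat (frac_le p q) = frac_le p q" "relat (frac_less p q) = frac_less p q"
  "\<not> bounded_body (frac_le p q)" "\<not> bounded_body (frac_less p q \<^bold>\<longrightarrow> B)"
  by (cases p; cases q; simp add: bounded_body_def le_def lt_def)+

text \<open>\<open>relat\<close> recognises bounded quantifiers by their syntax. These facts exclude
  that other number quantifiers are taken for bounded ones and escape relativisation.\<close>

lemma bounded_body_simps [simp]:
  "\<not> bounded_body (t \<^bold>= u)" "\<not> bounded_body ((\<^bold>\<forall>\<sigma>. A) \<^bold>\<longrightarrow> B)" "\<not> bounded_body (\<^bold>\<forall>\<sigma>. A)"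
  "\<not> bounded_body ((A \<^bold>\<longrightarrow> B) \<^bold>\<longrightarrow> C)"
  by (auto simp: bounded_body_def lt_def)

context ext_model
begin

section \<open>Standard elements\<close>

lemma sat_all_st [simp]: "sat M e (\<^bold>\<forall>st \<sigma>. A) \<longleftrightarrow> (\<forall>d\<in>Dom M \<sigma>. Std M d \<longrightarrow> sat M (scons \<sigma> d e) A)"
  by (simp add: all_st_def)

lemma sat_ex_st [simp]: "sat M e (\<^bold>\<exists>st \<sigma>. A) \<longleftrightarrow> (\<exists>d\<in>Dom M \<sigma>. Std M d \<and> sat M (scons \<sigma> d e) A)"
  by (auto simp: ex_st_def)

lemma Std_closed: "wt D t \<Longrightarrow> fv_tm t = {} \<Longrightarrow> Std M (eval M e t)"
  using axioms[OF RCA0_Omega.st_closed, of t dflt] eval_closed[of t M e dflt] by simp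

lemma Std_app: "f \<in> Dom M (\<sigma> \<rightarrow> \<tau>) \<Longrightarrow> x \<in> Dom M \<sigma> \<Longrightarrow> Std M f \<Longrightarrow> Std M x \<Longrightarrow> Std M (f \<bullet> x)"
proof -
  assume a: "f \<in> Dom M (\<sigma> \<rightarrow> \<tau>)" "x \<in> Dom M \<sigma>" "Std M f" "Std M x"
  have ne: "\<sigma> \<rightarrow> \<tau> \<noteq> \<sigma>" "\<sigma> \<noteq> \<sigma> \<rightarrow> \<tau>" by (auto dest: arg_cong[where f = size])
  have "sat M (scons \<sigma> x (scons (\<sigma> \<rightarrow> \<tau>) f dflt))
     (St (Var (\<sigma> \<rightarrow> \<tau>) 0) \<^bold>\<longrightarrow> St (Var \<sigma> 0) \<^bold>\<longrightarrow> St (Var (\<sigma> \<rightarrow> \<tau>) 0 \<cdot> Var \<sigma> 0))"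
    using a by (intro axioms RCA0_Omega.st_app) auto
  then show ?thesis using a ne by simp
qed

definition stenv :: "(ty \<Rightarrow> nat \<Rightarrow> 'm) \<Rightarrow> bool" where
  "stenv e \<longleftrightarrow> is_env M e \<and> (\<forall>\<sigma> i. Std M (e \<sigma> i))"

lemma stenv_dflt [simp]: "stenv dflt"
  using Std_closed[of "inhabitant \<sigma>" for \<sigma>] by (simp add: stenv_def) (simp add: dflt_def)

lemma stenv_is_env [simp]: "stenv e \<Longrightarrow> is_env M e"
  by (simp add: stenv_def)

lemma stenv_scons [simp]: "stenv e \<Longrightarrow> d \<in> Dom M \<sigma> \<Longrightarrow> Std M d \<Longrightarrow> stenv (scons \<sigma> d e)"
  unfolding stenv_def by (simp del: stenv_is_env) (auto simp: scons_def split: nat.splits)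

text \<open>Objects that are given by terms with standard parameters inherit standardness from this
  fact.\<close>

lemma Std_eval: "wt D t \<Longrightarrow> stenv e \<Longrightarrow> Std M (eval M e t)"
proof (induction t)
  case (Var \<sigma> i)
  then show ?case by (simp add: stenv_def del: stenv_is_env)
next
  case (Cn c)
  then show ?case using Std_closed[of "Cn c"] by simp
next
  case (App t u)
  from App.prems(1) obtain \<tau> where t: "wt D t" "wt D u" "ty_of t = ty_of u \<rightarrow> \<tau>"
    by (rule wt_App_cases)
  have "Std M (eval M e t \<bullet> eval M e u)"
  proof (rule Std_app)
    show "eval M e t \<in> Dom M (ty_of u \<rightarrow> \<tau>)" "eval M e u \<in> Dom M (ty_of u)"
      using t App.prems(2) by (auto intro!: eval_in)
    show "Std M (eval M e t)" "Std M (eval M e u)"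
      using t App.prems(2) by (auto intro!: App.IH)
  qed
  then show ?case by simp
qed

lemma Std_Z [simp]: "Std M Z" and Std_S [simp]: "n \<in> N \<Longrightarrow> Std M n \<Longrightarrow> Std M (S n)"
  using Std_eval[of zero dflt] Std_eval[of "suc (v 0)" "scons T0 n dflt"] by auto

lemma Std_funs [simp]:
  "n \<in> N \<Longrightarrow> m \<in> N \<Longrightarrow> Std M n \<Longrightarrow> Std M m \<Longrightarrow> Std M (n \<oplus> m)"
  "n \<in> N \<Longrightarrow> m \<in> N \<Longrightarrow> Std M n \<Longrightarrow> Std M m \<Longrightarrow> Std M (n \<otimes> m)"
  "n \<in> N \<Longrightarrow> m \<in> N \<Longrightarrow> Std M n \<Longrightarrow> Std M m \<Longrightarrow> Std M (DIST \<bullet> n \<bullet> m)"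
  "n \<in> N \<Longrightarrow> m \<in> N \<Longrightarrow> Std M n \<Longrightarrow> Std M m \<Longrightarrow> Std M (PAIR \<bullet> n \<bullet> m)"
  "n \<in> N \<Longrightarrow> Std M n \<Longrightarrow> Std M (POW2 \<bullet> n)"
  "n \<in> N \<Longrightarrow> Std M n \<Longrightarrow> Std M (FST \<bullet> n)"
  "n \<in> N \<Longrightarrow> Std M n \<Longrightarrow> Std M (SND \<bullet> n)"
  using Std_eval[of "add (v 0) (v 1)" "scons T0 n (scons T0 m dflt)"]
    Std_eval[of "mult (v 0) (v 1)" "scons T0 n (scons T0 m dflt)"]
    Std_eval[of "dist (v 0) (v 1)" "scons T0 n (scons T0 m dflt)"]
    Std_eval[of "pair (v 0) (v 1)" "scons T0 n (scons T0 m dflt)"]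
    Std_eval[of "pow2 (v 0)" "scons T0 n dflt"]
    Std_eval[of "fst_c \<cdot> v 0" "scons T0 n dflt"]
    Std_eval[of "snd_c \<cdot> v 0" "scons T0 n dflt"]
  by auto

end

context num_model
begin

lemma Std_le: "n \<in> N \<Longrightarrow> m \<in> N \<Longrightarrow> Std M n \<Longrightarrow> nu m \<le> nu n \<Longrightarrow> Std M m"
  using axioms[OF RCA0_Omega.st_le, of "scons T0 n (scons T0 m dflt)"] by simp

section \<open>Real numbers in models\<close>

definition "VIOL = eval M dflt violations_c"
definition "HAT = eval M dflt hat_c"
definition "R0 = eval M dflt real_0"
definition "R1 = eval M dflt real_1"

lemma eval_consts' [simp]:
  "eval M e violations_c = VIOL" "eval M e hat_c = HAT" "eval M e real_0 = R0" "eval M e real_1 = R1"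
  by (auto simp: VIOL_def HAT_def R0_def R1_def intro!: eval_closed)

lemma Dom_consts' [simp]:
  "VIOL \<in> Dom M (T1 \<rightarrow> T1)" "HAT \<in> Dom M (T1 \<rightarrow> T1)" "R0 \<in> Dom M T1" "R1 \<in> Dom M T1"
  "f \<in> Dom M T1 \<Longrightarrow> n \<in> N \<Longrightarrow> VIOL \<bullet> f \<bullet> n \<in> N" "f \<in> Dom M T1 \<Longrightarrow> HAT \<bullet> f \<in> Dom M T1"
proof -
  show *: "VIOL \<in> Dom M (T1 \<rightarrow> T1)" "HAT \<in> Dom M (T1 \<rightarrow> T1)" "R0 \<in> Dom M T1" "R1 \<in> Dom M T1"
    unfolding VIOL_def HAT_def R0_def R1_def by (auto simp del: eval_consts' intro!: eval_in)
  then show "f \<in> Dom M T1 \<Longrightarrow> n \<in> N \<Longrightarrow> VIOL \<bullet> f \<bullet> n \<in> N" "f \<in> Dom M T1 \<Longrightarrow> HAT \<bullet> f \<in> Dom M T1"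
    using Ap_Dom[of VIOL T1 T1 f] Ap_Dom[of HAT T1 T1 f] by auto
qed

lemma Std_consts' [simp]: "Std M VIOL" "Std M HAT" "Std M R0" "Std M R1"
  unfolding VIOL_def HAT_def R0_def R1_def by (auto simp del: eval_consts' intro!: Std_closed)

text \<open>Two nested uses of \<open>sum_eq_Z\<close>; the outer sum runs below n + 1, hence the
  bound n included.\<close>

lemma viol_eq_Z:
  assumes f: "f \<in> Dom M T1" and n: "n \<in> N"
  shows "VIOL \<bullet> f \<bullet> n = Z \<longleftrightarrow> (\<forall>i\<in>N. nu i \<le> nu n \<longrightarrow>
    (\<forall>j\<in>N. nu j < nu i \<longrightarrow> \<bar>val (f \<bullet> j) - val (f \<bullet> i)\<bar> < h j))"
proof -
  let ?c = "frac_less_char (frac_dist (decode (Var T1 0 \<cdot> v 0)) (decode (Var T1 0 \<cdot> v 1))) (frac_pow (v 0))"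
  let ?t = "sum_below (lam T0 ?c) (v 0)"
  let ?e = "scons T0 n (scons T1 f dflt)"
  have "VIOL \<bullet> f \<bullet> n = SUMB \<bullet> eval M ?e (lam T0 ?t) \<bullet> S n"
    using f n by (simp add: VIOL_def violations_c_def)
  moreover have "eval M ?e (lam T0 ?t) \<in> Dom M T1"
    using f n by (intro eval_in) auto
  ultimately have "VIOL \<bullet> f \<bullet> n = Z \<longleftrightarrow> (\<forall>i\<in>N. nu i < nu (S n) \<longrightarrow> eval M ?e (lam T0 ?t) \<bullet> i = Z)"
    using n by (simp only: sum_eq_Z Dom_consts)
  also have "\<dots> \<longleftrightarrow> (\<forall>i\<in>N. nu i \<le> nu n \<longrightarrow> SUMB \<bullet> eval M (scons T0 i ?e) (lam T0 ?c) \<bullet> i = Z)"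
    using f n by (simp add: nu_less_S_iff)
  also have "\<dots> \<longleftrightarrow> (\<forall>i\<in>N. nu i \<le> nu n \<longrightarrow> (\<forall>j\<in>N. nu j < nu i \<longrightarrow> eval M (scons T0 i ?e) (lam T0 ?c) \<bullet> j = Z))"
  proof (intro ball_cong refl imp_cong)
    fix i assume i: "i \<in> N"
    then have "eval M (scons T0 i ?e) (lam T0 ?c) \<in> Dom M T1"
      using f n by (intro eval_in) auto
    then show "SUMB \<bullet> eval M (scons T0 i ?e) (lam T0 ?c) \<bullet> i = Z \<longleftrightarrow>
        (\<forall>j\<in>N. nu j < nu i \<longrightarrow> eval M (scons T0 i ?e) (lam T0 ?c) \<bullet> j = Z)"
      using i by (rule sum_eq_Z)
  qed
  also have "\<dots> \<longleftrightarrow> (\<forall>i\<in>N. nu i \<le> nu n \<longrightarrow> (\<forall>j\<in>N. nu j < nu i \<longrightarrow> \<bar>val (f \<bullet> j) - val (f \<bullet> i)\<bar> < h j))"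
    using f n by (simp add: frac_less_char_eq)
  finally show ?thesis .
qed

lemma hat_rec:
  "f \<in> Dom M T1 \<Longrightarrow> HAT \<bullet> f \<bullet> Z = f \<bullet> Z"
  "f \<in> Dom M T1 \<Longrightarrow> n \<in> N \<Longrightarrow> HAT \<bullet> f \<bullet> S n = (if VIOL \<bullet> f \<bullet> S n = Z then f \<bullet> S n else HAT \<bullet> f \<bullet> n)"
proof -
  assume f: "f \<in> Dom M T1"
  then show "HAT \<bullet> f \<bullet> Z = f \<bullet> Z"
    by (simp add: HAT_def hat_c_def eval_rec)
  assume n: "n \<in> N"
  have "HAT \<bullet> f \<bullet> S n = COND \<bullet> (VIOL \<bullet> f \<bullet> S n) \<bullet> (f \<bullet> S n) \<bullet> (HAT \<bullet> f \<bullet> n)"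
    using f n by (simp add: HAT_def hat_c_def eval_rec eval_scons_indep[where d = "S n" and d' = n for n])
  then show "HAT \<bullet> f \<bullet> S n = (if VIOL \<bullet> f \<bullet> S n = Z then f \<bullet> S n else HAT \<bullet> f \<bullet> n)"
    using f n by (simp add: cond_eq)
qed

text \<open>The n-th approximation of the real \<open>f\<close>, taken after \<open>HAT\<close> has
  made the sequence converge fast.\<close>

definition A :: "'m \<Rightarrow> 'm \<Rightarrow> 'q" where "A f n = val (HAT \<bullet> f \<bullet> n)"

lemma fok_apx [simp]:
  "wt D x \<Longrightarrow> ty_of x = T1 \<Longrightarrow> wt D t \<Longrightarrow> ty_of t = T0 \<Longrightarrow> is_env M e \<Longrightarrow> fok e (apx x t)"
  by (simp add: apx_def)

lemma fval_apx [simp]: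
  "wt D x \<Longrightarrow> ty_of x = T1 \<Longrightarrow> wt D t \<Longrightarrow> ty_of t = T0 \<Longrightarrow> is_env M e \<Longrightarrow>
   fval e (apx x t) = A (eval M e x) (eval M e t)"
  by (simp add: apx_def A_def)

lemma hat_eq_if_no_viol: "f \<in> Dom M T1 \<Longrightarrow> n \<in> N \<Longrightarrow> VIOL \<bullet> f \<bullet> n = Z \<Longrightarrow> HAT \<bullet> f \<bullet> n = f \<bullet> n"
  using N_cases[of n] hat_rec[of f] N_closed(3)[of n] by metis

text \<open>Induction on the distance of the two stages. If there is no violation up to the new
  stage, both approximations are values of \<open>f\<close> and obey the bound; otherwise
  \<open>HAT\<close> repeats its last value and the hypothesis carries over.\<close>

lemma A_cauchy:
  assumes f: "f \<in> Dom M T1" and n: "n \<in> N" and m: "m \<in> N" and le: "nu n \<le> nu m"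
  shows "\<bar>A f n - A f m\<bar> < h n"
proof -
  obtain i where i: "i \<in> N" "m = n \<oplus> i" using nu_le_cases[OF n m le] by blast
  let ?A = "frac_less (frac_dist (apx (Var T1 0) (v 1)) (apx (Var T1 0) (add (v 1) (v 0)))) (frac_pow (v 1))"
  have sat: "sat M (scons T0 i (scons T0 n (scons T1 f dflt))) ?A \<longleftrightarrow> \<bar>A f n - A f (n \<oplus> i)\<bar> < h n"
    if "i \<in> N" for i using that f n by simp
  have "sat M (scons T0 i (scons T0 n (scons T1 f dflt))) ?A"
  proof (rule qf_ind)
    show "wf D ?A"
      by (rule wf_fracs(1)[of dflt]) auto
    show "sat M (scons T0 Z (scons T0 n (scons T1 f dflt))) ?A"
      using n f by simp
    fix i assume i: "i \<in> N" "sat M (scons T0 i (scons T0 n (scons T1 f dflt))) ?A"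
    then have IH: "\<bar>A f n - A f (n \<oplus> i)\<bar> < h n" by (simp only: sat)
    have "\<bar>A f n - A f (n \<oplus> S i)\<bar> < h n"
    proof (cases "VIOL \<bullet> f \<bullet> S (n \<oplus> i) = Z")
      case True
      then have v: "nu k \<le> nu (S (n \<oplus> i)) \<Longrightarrow> nu j < nu k \<Longrightarrow> \<bar>val (f \<bullet> j) - val (f \<bullet> k)\<bar> < h j"
        if "k \<in> N" "j \<in> N" for k j
        using that viol_eq_Z[OF f, of "S (n \<oplus> i)"] n i by simp
      have ni: "0 \<le> nu i" using i by simp
      have "VIOL \<bullet> f \<bullet> n = Z"
        unfolding viol_eq_Z[OF f n]
      proof (intro ballI impI)
        fix k j assume "k \<in> N" "nu k \<le> nu n" "j \<in> N" "nu j < nu k"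
        then show "\<bar>val (f \<bullet> j) - val (f \<bullet> k)\<bar> < h j"
          using v[of k j] ni n i by simp
      qed
      then have "HAT \<bullet> f \<bullet> n = f \<bullet> n" "HAT \<bullet> f \<bullet> (n \<oplus> S i) = f \<bullet> (n \<oplus> S i)"
        using hat_eq_if_no_viol[OF f n] hat_rec(2)[OF f, of "n \<oplus> i"] True n i by simp_all
      then show ?thesis
        using v[of "n \<oplus> S i" n] n i ni by (simp add: A_def)
    next
      case False
      then have "HAT \<bullet> f \<bullet> (n \<oplus> S i) = HAT \<bullet> f \<bullet> (n \<oplus> i)"
        using hat_rec(2)[OF f, of "n \<oplus> i"] n i by simp
      with IH show ?thesis by (simp add: A_def)
    qed
    then show "sat M (scons T0 (S i) (scons T0 n (scons T1 f dflt))) ?A"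
      using i by (simp only: sat Dom_consts)
  qed (use n i f in simp_all)
  then show ?thesis
    using sat[OF i(1)] i(2) by simp
qed

lemma A_eq_val:
  assumes f: "f \<in> Dom M T1" and n: "n \<in> N"
    and c: "\<And>i j. i \<in> N \<Longrightarrow> j \<in> N \<Longrightarrow> nu j < nu i \<Longrightarrow> \<bar>val (f \<bullet> j) - val (f \<bullet> i)\<bar> < h j"
  shows "A f n = val (f \<bullet> n)"
  using hat_eq_if_no_viol[OF f n] c by (simp add: A_def viol_eq_Z[OF f n])

text \<open>The parameter \<open>K\<close> is the range of the number quantifier:
  \<open>full\<close> gives the internal relation and \<open>st\<close> the relativised one.\<close>

definition req :: "('m \<Rightarrow> bool) \<Rightarrow> 'm \<Rightarrow> 'm \<Rightarrow> bool" where
  "req K x y \<longleftrightarrow> (\<forall>n\<in>N. K n \<longrightarrow> \<bar>A x n - A y n\<bar> \<le> h n)"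

definition rle :: "('m \<Rightarrow> bool) \<Rightarrow> 'm \<Rightarrow> 'm \<Rightarrow> bool" where
  "rle K x y \<longleftrightarrow> (\<forall>n\<in>N. K n \<longrightarrow> A x n \<le> A y n + (h n + h n))"

definition near :: "'m \<Rightarrow> 'm \<Rightarrow> 'm \<Rightarrow> bool" where
  "near x y k \<longleftrightarrow> (\<exists>n\<in>N. Std M n \<and> \<bar>A x n - A y n\<bar> + (h n + h n) < h k)"

definition runit :: "('m \<Rightarrow> bool) \<Rightarrow> 'm \<Rightarrow> bool" where
  "runit K x \<longleftrightarrow> rle K R0 x \<and> rle K x R1"

abbreviation "st \<equiv> Std M"
abbreviation "full \<equiv> \<lambda>_ :: 'm. True"

lemma lift_consts [simp]: "lift \<sigma> real_0 = real_0" "lift \<sigma> real_1 = real_1"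
  by (simp_all add: lift_closed)

lemma sat_reals [simp]:
  assumes "wt D x" "ty_of x = T1" "wt D y" "ty_of y = T1" "is_env M e"
  shows "sat M e (real_eq x y) \<longleftrightarrow> req full (eval M e x) (eval M e y)"
    "sat M e (relat (real_eq x y)) \<longleftrightarrow> req st (eval M e x) (eval M e y)"
    "sat M e (real_le x y) \<longleftrightarrow> rle full (eval M e x) (eval M e y)"
    "sat M e (relat (real_le x y)) \<longleftrightarrow> rle st (eval M e x) (eval M e y)"
  using assms by (auto simp: real_eq_def real_le_def req_def rle_def)

lemma sat_in_unit [simp]:
  assumes "wt D x" "ty_of x = T1" "is_env M e"
  shows "sat M e (in_unit x) \<longleftrightarrow> runit full (eval M e x)"
    "sat M e (relat (in_unit x)) \<longleftrightarrow> runit st (eval M e x)"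
  using assms by (auto simp: in_unit_def runit_def)

lemma sat_near [simp]:
  assumes "wt D x" "ty_of x = T1" "wt D y" "ty_of y = T1" "wt D k" "ty_of k = T0" "is_env M e"
  shows "sat M e (relat (real_near x y k)) \<longleftrightarrow> near (eval M e x) (eval M e y) (eval M e k)"
  using assms by (simp add: real_near_def near_def)

lemma bounded_body_reals [simp]:
  "\<not> bounded_body (real_le x y)" "\<not> bounded_body (real_near x y k)"
  "\<not> bounded_body (in_unit x)"
  by (auto simp: real_le_def real_near_def in_unit_def)

subsection \<open>Standardly continuous functions\<close>

definition rfun :: "'m \<Rightarrow> bool" where
  "rfun F \<longleftrightarrow> (\<forall>x\<in>Dom M T1. st x \<longrightarrow> (\<forall>y\<in>Dom M T1. st y \<longrightarrow> req st x y \<longrightarrow> req st (F \<bullet> x) (F \<bullet> y)))"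

definition rcont :: "'m \<Rightarrow> bool" where
  "rcont F \<longleftrightarrow> (\<forall>x\<in>Dom M T1. st x \<longrightarrow> runit st x \<longrightarrow> (\<forall>k\<in>N. st k \<longrightarrow> (\<exists>n\<in>N. st n \<and>
     (\<forall>y\<in>Dom M T1. st y \<longrightarrow> runit st y \<longrightarrow> near x y n \<longrightarrow> near (F \<bullet> x) (F \<bullet> y) k))))"

definition Cbar :: "'m \<Rightarrow> bool" where
  "Cbar F \<longleftrightarrow> rfun F \<and> rcont F \<and> rle st R0 (F \<bullet> R0) \<and> rle st (F \<bullet> R1) R0"

lemma sat_Cbar [simp]:
  assumes "is_env M e"
  shows "sat M e (relat C_bar_unit) \<longleftrightarrow> Cbar (e (T1 \<rightarrow> T1) 0)"
proof -
  have "e (T1 \<rightarrow> T1) 0 \<in> Dom M (T1 \<rightarrow> T1)" using assms by (simp add: is_env_def)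
  then show ?thesis
    using assms by (simp add: C_bar_unit_def C_unit_def real_function_def Cbar_def rfun_def rcont_def) blast
qed

end

lemma wf_relat [simp]: "wf D A \<Longrightarrow> wf D (relat A)"
  by (induction A) (auto simp: all_st_def)

lemma wf_st [simp]: "wf D (\<^bold>\<forall>st \<sigma>. A) \<longleftrightarrow> wf D A" "wf D (\<^bold>\<exists>st \<sigma>. A) \<longleftrightarrow> wf D A"
  by (simp_all add: all_st_def ex_st_def)

lemma wf_exists2_matrix [simp]: "wf D exists2_matrix"
  by (simp add: exists2_matrix_def)

context num_model
begin

lemma relat_le [simp]: "relat (le t u) = le t u" "relat (lt t u) = lt t u"
  by (simp_all add: le_def lt_def)

section \<open>The principles in models\<close>

definition EX2 :: "'m \<Rightarrow> bool" where
  "EX2 \<phi> \<longleftrightarrow> \<phi> \<in> Dom M T2 \<and> st \<phi> \<and> (\<forall>g\<in>Dom M T1. st g \<longrightarrow> ((\<exists>x\<in>N. st x \<and> g \<bullet> x = Z) \<longleftrightarrow> \<phi> \<bullet> g = Z))"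

definition TRANS :: bool where
  "TRANS \<longleftrightarrow> (\<forall>f\<in>Dom M T1. st f \<longrightarrow> (\<forall>n\<in>N. st n \<longrightarrow> f \<bullet> n = Z) \<longrightarrow> (\<forall>n\<in>N. f \<bullet> n = Z))"

definition IVT :: bool where
  "IVT \<longleftrightarrow> (\<forall>F\<in>Dom M (T1 \<rightarrow> T1). st F \<longrightarrow> Cbar F \<longrightarrow>
     (\<exists>x\<in>Dom M T1. st x \<and> runit full x \<and> req full (F \<bullet> x) R0))"

definition EUIVT :: "'m \<Rightarrow> bool" where
  "EUIVT \<Phi> \<longleftrightarrow> \<Phi> \<in> Dom M ((T1 \<rightarrow> T1) \<rightarrow> T1) \<and> st \<Phi> \<and>
     (\<forall>F\<in>Dom M (T1 \<rightarrow> T1). st F \<longrightarrow> Cbar F \<longrightarrow> req st (F \<bullet> (\<Phi> \<bullet> F)) R0) \<and>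
     (\<forall>F\<in>Dom M (T1 \<rightarrow> T1). st F \<longrightarrow> (\<forall>G\<in>Dom M (T1 \<rightarrow> T1). st G \<longrightarrow>
        (\<forall>x\<in>Dom M T1. st x \<longrightarrow> (\<forall>n\<in>N. st n \<longrightarrow> F \<bullet> x \<bullet> n = G \<bullet> x \<bullet> n)) \<longrightarrow>
        (\<forall>n\<in>N. st n \<longrightarrow> \<Phi> \<bullet> F \<bullet> n = \<Phi> \<bullet> G \<bullet> n)))"

lemma fun_T1 [simp]: "F \<in> Dom M (T1 \<rightarrow> T1) \<Longrightarrow> x \<in> Dom M T1 \<Longrightarrow> F \<bullet> x \<in> Dom M T1"
  and fun_T2 [simp]: "\<phi> \<in> Dom M T2 \<Longrightarrow> x \<in> Dom M T1 \<Longrightarrow> \<phi> \<bullet> x \<in> N"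
  and fun_T3 [simp]: "\<Phi> \<in> Dom M ((T1 \<rightarrow> T1) \<rightarrow> T1) \<Longrightarrow> F \<in> Dom M (T1 \<rightarrow> T1) \<Longrightarrow> \<Phi> \<bullet> F \<in> Dom M T1"
  and fun_T01 [simp]: "r \<in> Dom M (T0 \<rightarrow> T1) \<Longrightarrow> n \<in> N \<Longrightarrow> r \<bullet> n \<in> Dom M T1"
  by (rule Ap_Dom; assumption)+

lemma exists2_not_bounded [simp]: "\<not> bounded_body (Var T1 0 \<cdot> v 0 \<^bold>= zero \<^bold>\<longrightarrow> B)"
  by (simp add: bounded_body_def lt_def)

lemma sat_exists2: "is_env M e \<Longrightarrow> sat M e (relat exists2) \<longleftrightarrow> (\<exists>\<phi>. EX2 \<phi>)"
  by (auto simp: exists2_def exists2_matrix_def EX2_def)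

lemma sat_Pi01_TRANS: "is_env M e \<Longrightarrow> sat M e Pi01_TRANS \<longleftrightarrow> TRANS"
  by (simp add: Pi01_TRANS_def TRANS_def)

lemma sat_IVT_star: "is_env M e \<Longrightarrow> sat M e IVT_star \<longleftrightarrow> IVT"
  by (auto simp: IVT_star_def IVT_def)

lemma sat_UIVT_matrix: "is_env M e \<Longrightarrow> sat M e (relat UIVT_matrix) \<longleftrightarrow>
    (\<forall>F\<in>Dom M (T1 \<rightarrow> T1). st F \<longrightarrow> Cbar F \<longrightarrow> req st (F \<bullet> (e ((T1 \<rightarrow> T1) \<rightarrow> T1) 0 \<bullet> F)) R0)"
  by (simp add: UIVT_matrix_def)

lemma sat_standard_extensional:
  "is_env M e \<Longrightarrow> sat M e (standard_extensional (T1 \<rightarrow> T1) T1) \<longleftrightarrow>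
     (\<forall>F\<in>Dom M (T1 \<rightarrow> T1). st F \<longrightarrow> (\<forall>G\<in>Dom M (T1 \<rightarrow> T1). st G \<longrightarrow>
        (\<forall>x\<in>Dom M T1. st x \<longrightarrow> (\<forall>n\<in>N. st n \<longrightarrow> F \<bullet> x \<bullet> n = G \<bullet> x \<bullet> n)) \<longrightarrow>
        (\<forall>n\<in>N. st n \<longrightarrow> e ((T1 \<rightarrow> T1) \<rightarrow> T1) 0 \<bullet> F \<bullet> n = e ((T1 \<rightarrow> T1) \<rightarrow> T1) 0 \<bullet> G \<bullet> n)))"
  by (simp add: standard_extensional_def approx_def Let_def)

lemma sat_Conj: "sat M e (B \<^bold>\<and> C) \<longleftrightarrow> sat M e B \<and> sat M e C"
  by simp

lemma sat_E_UIVT_st: "is_env M e \<Longrightarrow> sat M e E_UIVT_st \<longleftrightarrow> (\<exists>\<Phi>. EUIVT \<Phi>)"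
  unfolding E_UIVT_st_def E_st_def EUIVT_def sat_ex_st Bex_def
  by (simp only: sat_Conj sat_UIVT_matrix sat_standard_extensional is_env_scons scons_0 cong: conj_cong)

subsection \<open>Transfer and $(\exists^2)$\<close>

lemma one_monus: "n \<in> N \<Longrightarrow> S Z \<ominus> n = Z \<longleftrightarrow> n \<noteq> Z"
proof -
  assume n: "n \<in> N"
  have "S Z \<ominus> n = Z \<longleftrightarrow> nu (S Z) \<le> nu n" using n by (intro monus_eq_Z) auto
  also have "\<dots> \<longleftrightarrow> 0 < nu n" using n nu_less_iff[of Z n] by simp
  also have "\<dots> \<longleftrightarrow> n \<noteq> Z" using n nu_eq_0[of n] nu_nonneg[of n] by (metis less_le)
  finally show ?thesis .
qed

lemma EX2_imp_TRANS:
  assumes D: "D T2 i = Some exists2_spec" and \<phi>: "EX2 \<phi>"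
  shows TRANS
proof -
  define \<Xi> where "\<Xi> = Cst M (Xi T2 i)"
  have wt: "wt D (Cn (Xi T2 i))" using D by simp
  have \<Xi>: "\<Xi> \<in> Dom M T2" using Cst_Dom[OF wt] by (simp add: \<Xi>_def)
  have \<phi>_Dom: "\<phi> \<in> Dom M T2" "st \<phi>" using \<phi> by (auto simp: EX2_def)
  \<comment> \<open>The given functional may have arbitrary nonzero values, while the specification
    of the constant asks for values in {0,1}.\<close>
  define \<psi> where "\<psi> = eval M (scons T2 \<phi> dflt) (lam T1 (cond (Var T2 0 \<cdot> Var T1 0) zero (suc zero)))"
  have \<psi>: "\<psi> \<in> Dom M T2" "st \<psi>"
    unfolding \<psi>_def using \<phi>_Dom by (auto intro!: eval_in Std_eval)
  have \<psi>_eq: "\<psi> \<bullet> g = (if \<phi> \<bullet> g = Z then Z else S Z)" if "g \<in> Dom M T1" for g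
    using that \<phi>_Dom by (simp add: \<psi>_def cond_eq)
  have "sat M dflt (\<^bold>\<forall>st T2. (relat exists2_spec \<^bold>\<longrightarrow> approx T2 (Cn (Xi T2 i)) (Var T2 0)))"
    using D wt by (intro axioms RCA0_Omega.Xi_agree) (auto simp: exists2_spec_def approx_def)
  then have "sat M (scons T2 \<psi> dflt) (relat exists2_spec) \<longrightarrow>
      sat M (scons T2 \<psi> dflt) (approx T2 (Cn (Xi T2 i)) (Var T2 0))"
    using \<psi> by (simp only: sat_all_st sat.simps) blast
  moreover have "sat M (scons T2 \<psi> dflt) (approx T2 (Cn (Xi T2 i)) (Var T2 0)) \<longleftrightarrow>
      (\<forall>g\<in>Dom M T1. st g \<longrightarrow> \<Xi> \<bullet> g = \<psi> \<bullet> g)"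
    using \<psi>(1) by (simp add: approx_def \<Xi>_def)
  moreover have \<psi>_zero: "(\<exists>x\<in>N. st x \<and> g \<bullet> x = Z) \<longleftrightarrow> \<psi> \<bullet> g = Z" if "g \<in> Dom M T1" "st g" for g
  proof -
    have "\<psi> \<bullet> g = Z \<longleftrightarrow> \<phi> \<bullet> g = Z" using that by (simp add: \<psi>_eq)
    then show ?thesis using that \<phi> unfolding EX2_def by blast
  qed
  moreover have "sat M (scons T2 \<psi> dflt) (relat exists2_spec)"
  proof -
    have "sat M (scons T2 \<psi> dflt) (relat exists2_matrix) \<longleftrightarrow>
        (\<forall>g\<in>Dom M T1. st g \<longrightarrow> ((\<exists>x\<in>N. st x \<and> g \<bullet> x = Z) \<longleftrightarrow> \<psi> \<bullet> g = Z))"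
      using \<psi> unfolding exists2_matrix_def by (simp, blast)
    moreover have "sat M (scons T2 \<psi> dflt) (relat (\<^bold>\<forall>T1. le (Var T2 0 \<cdot> Var T1 0) (suc zero)))"
      using \<psi> by (simp add: \<psi>_eq)
    ultimately show ?thesis
      unfolding exists2_spec_def relat.simps sat_Conj using \<psi>_zero by blast
  qed
  ultimately have \<Xi>_eq: "\<Xi> \<bullet> g = Z \<longleftrightarrow> (\<exists>x\<in>N. st x \<and> g \<bullet> x = Z)" if "g \<in> Dom M T1" "st g" for g
    using that by metis
  \<comment> \<open>Transfer allows one variable, so \<open>h\<close> codes the number h(0) together
    with the sequence h(1), h(2), ... The formula says that if the sequence vanishes at that number,
    the constant reports a zero.\<close>
  let ?tail = "lam T0 (Var T1 0 \<cdot> suc (v 0))"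
  let ?A = "Var T1 0 \<cdot> suc (Var T1 0 \<cdot> zero) \<^bold>= zero \<^bold>\<longrightarrow> Cn (Xi T2 i) \<cdot> ?tail \<^bold>= zero"
  define tail where "tail h = eval M (scons T1 h dflt) ?tail" for h
  have tail: "tail h \<in> Dom M T1" "n \<in> N \<Longrightarrow> tail h \<bullet> n = h \<bullet> S n" if "h \<in> Dom M T1" for h n
    using that by (auto simp: tail_def intro!: eval_in)
  have st_tail: "st (tail h)" if "h \<in> Dom M T1" "st h" for h
    unfolding tail_def using that by (intro Std_eval) auto
  have "sat M dflt ((\<^bold>\<forall>st T1. ?A) \<^bold>\<longrightarrow> (\<^bold>\<forall>T1. ?A))"
    using wt by (intro axioms RCA0_Omega.PF_TP) (auto split: if_splits)
  moreover have "sat M dflt (\<^bold>\<forall>st T1. ?A)"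
  proof -
    have "\<Xi> \<bullet> tail h = Z" if h: "h \<in> Dom M T1" "st h" "h \<bullet> S (h \<bullet> Z) = Z" for h
    proof -
      have "st (h \<bullet> Z)" using h by (intro Std_app[of h T0 T0 Z]) auto
      then show ?thesis
        using \<Xi>_eq[OF tail(1) st_tail, OF h(1) h(1,2)] tail(2)[OF h(1), of "h \<bullet> Z"] h by auto
    qed
    then show ?thesis by (simp add: \<Xi>_def tail_def)
  qed
  ultimately have all: "h \<bullet> S (h \<bullet> Z) = Z \<longrightarrow> \<Xi> \<bullet> tail h = Z" if "h \<in> Dom M T1" for h
    using that by (simp add: \<Xi>_def tail_def)
  have transfer: "\<Xi> \<bullet> g = Z" if g: "g \<in> Dom M T1" and x: "x \<in> N" "g \<bullet> x = Z" for g x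
  proof -
    \<comment> \<open>The code that lists \<open>x\<close> first and then the values of
      \<open>g\<close>.\<close>
    let ?t = "lam T0 (rec (v 1) (Var T1 0 \<cdot> v 0) (v 0))"
    define h where "h = eval M (scons T0 x (scons T1 g dflt)) ?t"
    have h: "h \<in> Dom M T1" "h \<bullet> Z = x" "h \<bullet> S n = g \<bullet> n" if "n \<in> N" for n
      using that g x by (auto simp: h_def eval_rec intro!: eval_in)
    have "tail h = g"
      by (rule ext[of _ T0 T0]) (use h(1)[OF Dom_consts(1)] tail h(3) g in auto)
    with all[OF h(1)[OF Dom_consts(1)]] h(2)[OF Dom_consts(1)] h(3)[OF x(1)] x show ?thesis by simp
  qed
  show TRANS
    unfolding TRANS_def
  proof (intro ballI impI)
    fix f n assume f: "f \<in> Dom M T1" "st f" "\<forall>n\<in>N. st n \<longrightarrow> f \<bullet> n = Z" and n: "n \<in> N"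
    define g where "g = eval M (scons T1 f dflt) (lam T0 (monus (suc zero) (Var T1 0 \<cdot> v 0)))"
    have g: "g \<in> Dom M T1" "st g"
      unfolding g_def using f by (auto intro!: eval_in Std_eval)
    have g_eq: "g \<bullet> k = Z \<longleftrightarrow> f \<bullet> k \<noteq> Z" if "k \<in> N" for k
      using that f by (simp add: g_def one_monus)
    show "f \<bullet> n = Z"
    proof (rule ccontr)
      assume "f \<bullet> n \<noteq> Z"
      \<comment> \<open>The zero n may be nonstandard, but \<open>g\<close> is standard and there
        the answer of the constant can be trusted: it provides a standard zero.\<close>
      then have "\<Xi> \<bullet> g = Z" using transfer[OF g(1) n] g_eq[OF n] by simp
      then obtain x where "x \<in> N" "st x" "g \<bullet> x = Z" using \<Xi>_eq[OF g] by auto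
      then show False using f(3) g_eq[of x] by simp
    qed
  qed
qed

lemma TRANS_imp_EX2:
  assumes TRANS
  shows "\<exists>\<phi>. EX2 \<phi>"
proof -
  have st_zero: "\<exists>x\<in>N. st x \<and> g \<bullet> x = Z" if g: "g \<in> Dom M T1" "st g" and x: "x \<in> N" "g \<bullet> x = Z" for g x
  proof (rule ccontr)
    assume no: "\<not> ?thesis"
    define f where "f = eval M (scons T1 g dflt) (lam T0 (monus (suc zero) (Var T1 0 \<cdot> v 0)))"
    have f: "f \<in> Dom M T1" "st f"
      unfolding f_def using g by (auto intro!: eval_in Std_eval)
    have f_eq: "f \<bullet> k = Z \<longleftrightarrow> g \<bullet> k \<noteq> Z" if "k \<in> N" for k
      using that g by (simp add: f_def one_monus)
    show False using assms f f_eq no x unfolding TRANS_def by blast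
  qed
  let ?S = "T1 \<rightarrow> Sq T0"
  \<comment> \<open>The existential premise is internal, as the choice principle demands; by
    \<open>st_zero\<close> the conclusion still has a standard witness.\<close>
  let ?A = "(\<^bold>\<exists>T0. (Var T1 0 \<cdot> v 0 \<^bold>= zero)) \<^bold>\<longrightarrow> Var T1 0 \<cdot> v 0 \<^bold>= zero"
  have A: "sat M e ?A \<longleftrightarrow> ((\<exists>x\<in>N. e T1 0 \<bullet> x = Z) \<longrightarrow> e T1 0 \<bullet> e T0 0 = Z)" for e
    by simp
  have A': "subst_fm (push T0 (push T1 (shift ?S))) ?A = ?A"
    by (simp add: push_def shift_def)
  have elem: "sat M e (elem T0 (v 0) (Var ?S 0 \<cdot> Var T1 0)) \<longleftrightarrow>
     (\<exists>i\<in>N. nu i < nu (Cst M (Len T0) \<bullet> (e ?S 0 \<bullet> e T1 0)) \<and>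
        e T0 0 = Cst M (Entry T0) \<bullet> (e ?S 0 \<bullet> e T1 0) \<bullet> i)" if "is_env M e" for e
    using that by (auto simp: elem_def bex_def ball_def)
  have HAC: "sat M dflt ((\<^bold>\<forall>st T1. \<^bold>\<exists>st T0. ?A) \<^bold>\<longrightarrow>
       (\<^bold>\<exists>st ?S. \<^bold>\<forall>st T1. \<^bold>\<exists>T0.
          (elem T0 (Var T0 0) (lift T0 (lift T1 (Var ?S 0) \<cdot> Var T1 0)) \<^bold>\<and>
           subst_fm (push T0 (push T1 (shift ?S))) ?A)))"
    by (rule axioms, rule RCA0_Omega.HAC_int, simp, simp, unfold A')
      (simp_all add: elem_def bex_def ball_def)
  have "sat M dflt (\<^bold>\<forall>st T1. \<^bold>\<exists>st T0. ?A)"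
  proof -
    have "\<exists>n\<in>N. st n \<and> ((\<exists>x\<in>N. g \<bullet> x = Z) \<longrightarrow> g \<bullet> n = Z)" if g: "g \<in> Dom M T1" "st g" for g
      using st_zero[OF g] Dom_consts(1) Std_Z by (cases "\<exists>x\<in>N. g \<bullet> x = Z") blast+
    then show ?thesis by (simp add: A del: sat.simps(4))
  qed
  from HAC[unfolded sat.simps(4), rule_format, OF this]
  obtain \<Phi> where \<Phi>: "\<Phi> \<in> Dom M ?S" "st \<Phi>" and
    "sat M (scons ?S \<Phi> dflt) (\<^bold>\<forall>st T1. \<^bold>\<exists>T0. (elem T0 (Var T0 0) (Var ?S 0 \<cdot> Var T1 0) \<^bold>\<and> ?A))"
    unfolding A' sat_ex_st by auto
  then have ex: "\<exists>i\<in>N. nu i < nu (Cst M (Len T0) \<bullet> (\<Phi> \<bullet> g)) \<and>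
        ((\<exists>x\<in>N. g \<bullet> x = Z) \<longrightarrow> g \<bullet> (Cst M (Entry T0) \<bullet> (\<Phi> \<bullet> g) \<bullet> i) = Z)"
    if "g \<in> Dom M T1" "st g" for g
    using that by (simp add: elem) blast
  let ?len = "Cn (Len T0) \<cdot> (Var ?S 0 \<cdot> Var T1 0)"
  \<comment> \<open>The candidates are searched by summing 1 monus g(candidate), which is nonzero if
    and only if some candidate is a zero.\<close>
  let ?s = "lam T0 (monus (suc zero) (Var T1 0 \<cdot> (Cn (Entry T0) \<cdot> (Var ?S 0 \<cdot> Var T1 0) \<cdot> v 0)))"
  define \<phi> where "\<phi> = eval M (scons ?S \<Phi> dflt) (lam T1 (monus (suc zero) (sum_below ?s ?len)))"
  have "EX2 \<phi>"
    unfolding EX2_def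
  proof (intro conjI ballI impI)
    show "\<phi> \<in> Dom M T2" "st \<phi>"
      unfolding \<phi>_def using \<Phi> by (auto intro!: eval_in Std_eval)
    fix g assume g: "g \<in> Dom M T1" "st g"
    let ?e = "scons T1 g (scons ?S \<Phi> dflt)"
    have s: "eval M ?e ?s \<in> Dom M T1" and len: "eval M ?e ?len \<in> N"
      using g \<Phi> by (auto simp del: eval.simps intro!: eval_in)
    have entry: "Cst M (Entry T0) \<bullet> (\<Phi> \<bullet> g) \<bullet> k \<in> N" if "k \<in> N" for k
      using eval_in[of "Cn (Entry T0) \<cdot> (Var ?S 0 \<cdot> Var T1 0) \<cdot> v 0" T0 "scons T0 k ?e"] g \<Phi> that by simp
    have "\<phi> \<bullet> g = S Z \<ominus> SUMB \<bullet> eval M ?e ?s \<bullet> eval M ?e ?len"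
      using g \<Phi> by (simp add: \<phi>_def)
    then have "\<phi> \<bullet> g = Z \<longleftrightarrow> \<not> (\<forall>k\<in>N. nu k < nu (eval M ?e ?len) \<longrightarrow> eval M ?e ?s \<bullet> k = Z)"
      using s len by (simp only: one_monus N_closed sum_eq_Z)
    also have "\<dots> \<longleftrightarrow> (\<exists>k\<in>N. nu k < nu (Cst M (Len T0) \<bullet> (\<Phi> \<bullet> g)) \<and> g \<bullet> (Cst M (Entry T0) \<bullet> (\<Phi> \<bullet> g) \<bullet> k) = Z)"
      using g \<Phi> entry by (simp add: one_monus)
    \<comment> \<open>A candidate that passes the test need not be known to be standard, since any
      internal zero entails a standard one.\<close>
    also have "\<dots> \<longleftrightarrow> (\<exists>x\<in>N. st x \<and> g \<bullet> x = Z)"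
      using ex[OF g] st_zero[OF g] entry by blast
    finally show "(\<exists>x\<in>N. st x \<and> g \<bullet> x = Z) \<longleftrightarrow> \<phi> \<bullet> g = Z" by blast
  qed
  then show ?thesis ..
qed

end

section \<open>A family of functions that detects zeros of sequences\<close>

text \<open>
  \<open>first_c \<cdot> g \<cdot> n\<close> is \<open>k + 1\<close> for the least zero \<open>k < n\<close> of \<open>g\<close>, and \<open>0\<close> if there is none.
\<close>

definition first_c :: tm where
  "first_c = lam T1 (lam T0 (rec zero (cond (v 1) (cond (Var T1 0 \<cdot> v 0) (suc (v 0)) zero) (v 1)) (v 0)))"

text \<open>A code for 2^-n times the rational coded by \<open>q\<close>. Codes store the
  denominator diminished by one, hence the successor and the predecessor.\<close>

definition scale :: "tm \<Rightarrow> tm \<Rightarrow> tm" where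
  "scale q n = pair (fst_c \<cdot> q) (pred_c \<cdot> mult (suc (snd_c \<cdot> q)) (pow2 n))"

text \<open>
  With \<open>c\<close> for \<open>first_c \<cdot> g \<cdot> n\<close>, the \<open>n\<close>-th approximation of the function value at \<open>x\<close> is $0$ if
  $c = 0$, and $2^{-c} p(x_n)$ otherwise.
\<close>

definition fam_c :: tm where
  "fam_c = lam T1 (lam T1 (lam T1 (lam T0 (cond (first_c \<cdot> Var T1 2 \<cdot> v 0) zero
     (scale (Var T1 1 \<cdot> (hat_c \<cdot> Var T1 0 \<cdot> v 0)) (first_c \<cdot> Var T1 2 \<cdot> v 0))))))"

lemma first_c_typing [simp]: "fv_tm first_c = {}" "wt D first_c" "ty_of first_c = T1 \<rightarrow> T1"
  by (auto simp: first_c_def split: if_splits)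

lemma scale_typing [simp]:
  "fv_tm (scale q n) = fv_tm q \<union> fv_tm n"
  "wt D q \<Longrightarrow> ty_of q = T0 \<Longrightarrow> wt D n \<Longrightarrow> ty_of n = T0 \<Longrightarrow> wt D (scale q n)" "ty_of (scale q n) = T0"
  by (auto simp: scale_def)

lemma fam_c_typing [simp]: "fv_tm fam_c = {}" "wt D fam_c" "ty_of fam_c = T1 \<rightarrow> T1 \<rightarrow> T1 \<rightarrow> T1"
  by (auto simp: fam_c_def split: if_splits)

context num_model
begin

lemma R_eq: "n \<in> N \<Longrightarrow> R0 \<bullet> n = Z" "n \<in> N \<Longrightarrow> R1 \<bullet> n = PAIR \<bullet> (PAIR \<bullet> S Z \<bullet> Z) \<bullet> Z"
  by (simp_all add: R0_def real_0_def R1_def real_1_def)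

lemma A_R0: "n \<in> N \<Longrightarrow> A R0 n = 0" and A_R1: "n \<in> N \<Longrightarrow> A R1 n = 1"
  by (simp_all add: A_eq_val R_eq)

definition "FIRST = eval M dflt first_c"
definition "FAM = eval M dflt fam_c"

lemma eval_FAM [simp]: "eval M e first_c = FIRST" "eval M e fam_c = FAM"
  by (auto simp: FIRST_def FAM_def intro!: eval_closed)

lemma FIRST_Dom: "g \<in> Dom M T1 \<Longrightarrow> FIRST \<bullet> g \<in> Dom M T1"
  using eval_in[of "first_c \<cdot> Var T1 0" T1 "scons T1 g dflt"] by simp

lemma FIRST_N [simp]: "g \<in> Dom M T1 \<Longrightarrow> n \<in> N \<Longrightarrow> FIRST \<bullet> g \<bullet> n \<in> N"
  using FIRST_Dom by simp

lemma FAM_Dom [simp]: "g \<in> Dom M T1 \<Longrightarrow> p \<in> Dom M T1 \<Longrightarrow> FAM \<bullet> g \<bullet> p \<in> Dom M (T1 \<rightarrow> T1)"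
  using eval_in[of "fam_c \<cdot> Var T1 0 \<cdot> Var T1 1" "T1 \<rightarrow> T1" "scons T1 g (scons T1 p dflt)"] by simp

lemma FAM_Std: "g \<in> Dom M T1 \<Longrightarrow> p \<in> Dom M T1 \<Longrightarrow> st g \<Longrightarrow> st p \<Longrightarrow> st (FAM \<bullet> g \<bullet> p)"
  using Std_eval[of "fam_c \<cdot> Var T1 0 \<cdot> Var T1 1" "scons T1 g (scons T1 p dflt)"] by simp

lemma first_rec:
  "g \<in> Dom M T1 \<Longrightarrow> FIRST \<bullet> g \<bullet> Z = Z"
  "g \<in> Dom M T1 \<Longrightarrow> n \<in> N \<Longrightarrow> FIRST \<bullet> g \<bullet> S n =
     (if FIRST \<bullet> g \<bullet> n = Z then if g \<bullet> n = Z then S n else Z else FIRST \<bullet> g \<bullet> n)"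
proof -
  assume g: "g \<in> Dom M T1"
  then show "FIRST \<bullet> g \<bullet> Z = Z"
    by (simp add: FIRST_def first_c_def eval_rec)
  assume n: "n \<in> N"
  have "FIRST \<bullet> g \<bullet> S n = COND \<bullet> (FIRST \<bullet> g \<bullet> n) \<bullet> (COND \<bullet> (g \<bullet> n) \<bullet> S n \<bullet> Z) \<bullet> (FIRST \<bullet> g \<bullet> n)"
    using g n by (simp add: FIRST_def first_c_def eval_rec eval_scons_indep[where d = "S n" and d' = n for n])
  then show "FIRST \<bullet> g \<bullet> S n =
     (if FIRST \<bullet> g \<bullet> n = Z then if g \<bullet> n = Z then S n else Z else FIRST \<bullet> g \<bullet> n)"
    using g n by (simp add: cond_eq)
qed

lemma first_persist:
  assumes "g \<in> Dom M T1" "n \<in> N" "m \<in> N" "nu n \<le> nu m" "FIRST \<bullet> g \<bullet> n \<noteq> Z"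
  shows "FIRST \<bullet> g \<bullet> m = FIRST \<bullet> g \<bullet> n"
proof -
  obtain i where i: "i \<in> N" "m = n \<oplus> i" using nu_le_cases assms by blast
  have "sat M (scons T0 i (scons T0 n (scons T1 g dflt)))
      (first_c \<cdot> Var T1 0 \<cdot> add (v 1) (v 0) \<^bold>= first_c \<cdot> Var T1 0 \<cdot> v 1)"
    by (rule qf_ind) (use assms i in \<open>simp_all add: first_rec\<close>)
  then show ?thesis using i assms by simp
qed

text \<open>The predecessor of \<open>FIRST \<bullet> g \<bullet> n\<close> names the least zero by
  a term, so that the induction is quantifier-free. Its leastness is the statement that nothing has
  been recorded at its own stage.\<close>

lemma first_least:
  assumes g: "g \<in> Dom M T1" and n: "n \<in> N" and ne: "FIRST \<bullet> g \<bullet> n \<noteq> Z"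
  obtains k where "k \<in> N" "FIRST \<bullet> g \<bullet> n = S k" "g \<bullet> k = Z" "nu k < nu n" "FIRST \<bullet> g \<bullet> k = Z"
proof -
  let ?f = "first_c \<cdot> Var T1 0" and ?k = "pred_c \<cdot> (first_c \<cdot> Var T1 0 \<cdot> v 0)"
  have "sat M (scons T0 n (scons T1 g dflt)) (\<^bold>\<not> (?f \<cdot> v 0 \<^bold>= zero) \<^bold>\<longrightarrow>
      (Var T1 0 \<cdot> ?k \<^bold>= zero \<^bold>\<and> lt ?k (v 0) \<^bold>\<and> ?f \<cdot> ?k \<^bold>= zero))"
  proof (rule qf_ind)
    fix n assume n: "n \<in> N" and "sat M (scons T0 n (scons T1 g dflt)) (\<^bold>\<not> (?f \<cdot> v 0 \<^bold>= zero) \<^bold>\<longrightarrow>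
      (Var T1 0 \<cdot> ?k \<^bold>= zero \<^bold>\<and> lt ?k (v 0) \<^bold>\<and> ?f \<cdot> ?k \<^bold>= zero))"
    then have IH: "FIRST \<bullet> g \<bullet> n \<noteq> Z \<Longrightarrow> g \<bullet> (PRED \<bullet> (FIRST \<bullet> g \<bullet> n)) = Z \<and>
        nu (PRED \<bullet> (FIRST \<bullet> g \<bullet> n)) < nu n \<and> FIRST \<bullet> g \<bullet> (PRED \<bullet> (FIRST \<bullet> g \<bullet> n)) = Z"
      using g by auto
    have "FIRST \<bullet> g \<bullet> S n \<noteq> Z \<longrightarrow> g \<bullet> (PRED \<bullet> (FIRST \<bullet> g \<bullet> S n)) = Z \<and>
        nu (PRED \<bullet> (FIRST \<bullet> g \<bullet> S n)) < nu (S n) \<and> FIRST \<bullet> g \<bullet> (PRED \<bullet> (FIRST \<bullet> g \<bullet> S n)) = Z"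
    proof (cases "FIRST \<bullet> g \<bullet> n = Z")
      case False
      with IH have *: "nu (PRED \<bullet> (FIRST \<bullet> g \<bullet> n)) < nu n" by blast
      have "nu (PRED \<bullet> (FIRST \<bullet> g \<bullet> n)) < nu n + 1" using * by linarith
      with False IH g n show ?thesis by (simp add: first_rec)
    qed (use g n in \<open>simp add: first_rec\<close>)
    then show "sat M (scons T0 (S n) (scons T1 g dflt)) (\<^bold>\<not> (?f \<cdot> v 0 \<^bold>= zero) \<^bold>\<longrightarrow>
      (Var T1 0 \<cdot> ?k \<^bold>= zero \<^bold>\<and> lt ?k (v 0) \<^bold>\<and> ?f \<cdot> ?k \<^bold>= zero))"
      using g n by simp
  qed (use g n in \<open>simp_all add: first_rec\<close>)
  then have "g \<bullet> (PRED \<bullet> (FIRST \<bullet> g \<bullet> n)) = Z \<and>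
        nu (PRED \<bullet> (FIRST \<bullet> g \<bullet> n)) < nu n \<and> FIRST \<bullet> g \<bullet> (PRED \<bullet> (FIRST \<bullet> g \<bullet> n)) = Z"
    using g n ne by simp
  moreover have "FIRST \<bullet> g \<bullet> n = S (PRED \<bullet> (FIRST \<bullet> g \<bullet> n))"
    using N_cases[of "FIRST \<bullet> g \<bullet> n"] ne g n FIRST_N by blast
  moreover have "PRED \<bullet> (FIRST \<bullet> g \<bullet> n) \<in> N" using g n by simp
  ultimately show thesis using that by blast
qed

lemma first_zero:
  assumes "g \<in> Dom M T1" "n \<in> N" "m \<in> N" "g \<bullet> n = Z" "nu n < nu m"
  shows "FIRST \<bullet> g \<bullet> m \<noteq> Z"
proof -
  have *: "FIRST \<bullet> g \<bullet> S n \<noteq> Z" using assms by (simp add: first_rec)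
  have "nu (S n) \<le> nu m" using assms nu_less_iff[of n m] by simp
  then show ?thesis using first_persist[of g "S n" m] assms * by simp
qed

text \<open>A zero k that is first recorded between the stages j and i satisfies k >= j. Its scale
  2^-(k+1) is then below 2^-j, within the tolerance for fast convergence.\<close>

lemma first_cases:
  assumes "g \<in> Dom M T1" "j \<in> N" "i \<in> N" "nu j \<le> nu i"
  obtains "FIRST \<bullet> g \<bullet> i = FIRST \<bullet> g \<bullet> j"
  | "FIRST \<bullet> g \<bullet> j = Z" "FIRST \<bullet> g \<bullet> i \<noteq> Z" "h (FIRST \<bullet> g \<bullet> i) < h j"
proof (cases "FIRST \<bullet> g \<bullet> j = Z \<and> FIRST \<bullet> g \<bullet> i \<noteq> Z")
  case True
  then obtain k where k: "k \<in> N" "FIRST \<bullet> g \<bullet> i = S k" "g \<bullet> k = Z"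
    using first_least[OF assms(1,3)] by blast
  have "nu j \<le> nu k"
    using True first_zero[OF assms(1) k(1) assms(2) k(3)] by (meson not_less)
  then have "h k \<le> h j" using k assms by (intro h_mono)
  moreover have "h (S k) < h k" using k by simp
  ultimately have "h (FIRST \<bullet> g \<bullet> i) < h j" unfolding k(2) by linarith
  with True that show thesis by blast
next
  case False
  then have "FIRST \<bullet> g \<bullet> i = FIRST \<bullet> g \<bullet> j"
    using first_persist[OF assms] by metis
  with that show thesis by blast
qed

lemma val_scale:
  assumes "u \<in> N" "n \<in> N"
  shows "val (PAIR \<bullet> (FST \<bullet> u) \<bullet> (PRED \<bullet> (S (SND \<bullet> u) \<otimes> POW2 \<bullet> n))) = h n * val u"
proof -
  let ?x = "S (SND \<bullet> u) \<otimes> POW2 \<bullet> n"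
  have x: "?x \<in> N" "nu ?x = (nu (SND \<bullet> u) + 1) * nu (POW2 \<bullet> n)"
    using assms by (simp_all add: distrib_right)
  have "0 < (nu (SND \<bullet> u) + 1) * nu (POW2 \<bullet> n)"
    using assms by (intro mult_pos_pos) (auto intro: add_nonneg_pos)
  then have "?x \<noteq> Z" using x by (metis less_irrefl nu_Z)
  then have "?x = S (PRED \<bullet> ?x)" using N_cases[OF x(1)] by blast
  then have "nu ?x = nu (PRED \<bullet> ?x) + 1" using x(1) by (metis nu_S N_closed(3))
  then have "nu (PRED \<bullet> ?x) + 1 = (nu (SND \<bullet> u) + 1) * nu (POW2 \<bullet> n)" using x by simp
  then show ?thesis
    using assms x(1) by (simp add: val_def h_def)
qed

lemma FAM_eq:
  assumes "g \<in> Dom M T1" "p \<in> Dom M T1" "x \<in> Dom M T1" "n \<in> N"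
  shows "val (FAM \<bullet> g \<bullet> p \<bullet> x \<bullet> n) =
    (if FIRST \<bullet> g \<bullet> n = Z then 0 else h (FIRST \<bullet> g \<bullet> n) * val (p \<bullet> (HAT \<bullet> x \<bullet> n)))"
proof -
  have "FAM \<bullet> g \<bullet> p \<bullet> x \<bullet> n = COND \<bullet> (FIRST \<bullet> g \<bullet> n) \<bullet> Z \<bullet> (PAIR \<bullet> (FST \<bullet> (p \<bullet> (HAT \<bullet> x \<bullet> n))) \<bullet>
      (PRED \<bullet> (S (SND \<bullet> (p \<bullet> (HAT \<bullet> x \<bullet> n))) \<otimes> POW2 \<bullet> (FIRST \<bullet> g \<bullet> n))))"
    using assms by (simp add: FAM_def fam_c_def scale_def)
  then show ?thesis
    using assms by (simp add: cond_eq val_scale del: mult_S_left)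
qed

lemma h_le_1: "n \<in> N \<Longrightarrow> h n \<le> 1"
  using h_mono[of Z n] by simp

text \<open>The bound 1 keeps the jump at the first zero within its scale. The Lipschitz constant 1
  preserves fast convergence and makes the identity a modulus of continuity for the family.\<close>

definition contracting :: "'m \<Rightarrow> bool" where
  "contracting p \<longleftrightarrow> p \<in> Dom M T1 \<and> (\<forall>a\<in>N. \<bar>val (p \<bullet> a)\<bar> \<le> 1 \<and>
     (\<forall>b\<in>N. \<bar>val (p \<bullet> a) - val (p \<bullet> b)\<bar> \<le> \<bar>val a - val b\<bar>))"

lemma contractingD:
  assumes "contracting p"
  shows "p \<in> Dom M T1" "a \<in> N \<Longrightarrow> \<bar>val (p \<bullet> a)\<bar> \<le> 1"
    "a \<in> N \<Longrightarrow> b \<in> N \<Longrightarrow> \<bar>val (p \<bullet> a) - val (p \<bullet> b)\<bar> \<le> \<bar>val a - val b\<bar>"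
  using assms by (auto simp: contracting_def)

lemma h_mult_le: "n \<in> N \<Longrightarrow> \<bar>h n * a - h n * b\<bar> \<le> \<bar>a - b\<bar>"
proof -
  assume n: "n \<in> N"
  have "h n * \<bar>a - b\<bar> \<le> 1 * \<bar>a - b\<bar>"
    using h_le_1[OF n] by (intro mult_right_mono) auto
  moreover have "\<bar>h n * a - h n * b\<bar> = h n * \<bar>a - b\<bar>"
    using h_pos[OF n] by (simp add: right_diff_distrib[symmetric] abs_mult)
  ultimately show ?thesis by simp
qed

text \<open>The defining values converge fast already: the contraction takes care of stages with the
  same record, and \<open>first_cases\<close> of those between which a zero is found.\<close>

lemma A_FAM:
  assumes g: "g \<in> Dom M T1" and p: "contracting p" and x: "x \<in> Dom M T1" and n: "n \<in> N"
  shows "A (FAM \<bullet> g \<bullet> p \<bullet> x) n =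
    (if FIRST \<bullet> g \<bullet> n = Z then 0 else h (FIRST \<bullet> g \<bullet> n) * val (p \<bullet> (HAT \<bullet> x \<bullet> n)))"
proof -
  note p' = contractingD[OF p]
  have "A (FAM \<bullet> g \<bullet> p \<bullet> x) n = val (FAM \<bullet> g \<bullet> p \<bullet> x \<bullet> n)"
  proof (rule A_eq_val[OF _ n])
    show "FAM \<bullet> g \<bullet> p \<bullet> x \<in> Dom M T1" using g p' x by simp
    fix i j assume ij: "i \<in> N" "j \<in> N" "nu j < nu i"
    let ?F = "FAM \<bullet> g \<bullet> p \<bullet> x"
    have hN: "HAT \<bullet> x \<bullet> i \<in> N" "HAT \<bullet> x \<bullet> j \<in> N" using x ij by simp_all
    have "nu j \<le> nu i" using ij by simp
    from g ij(2,1) this show "\<bar>val (?F \<bullet> j) - val (?F \<bullet> i)\<bar> < h j"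
    proof (cases rule: first_cases)
      case 1
      have "\<bar>val (?F \<bullet> j) - val (?F \<bullet> i)\<bar> \<le> \<bar>val (p \<bullet> (HAT \<bullet> x \<bullet> j)) - val (p \<bullet> (HAT \<bullet> x \<bullet> i))\<bar>"
        using g p'(1) x ij h_mult_le[OF FIRST_N[OF g ij(2)]] by (simp add: FAM_eq 1)
      also have "\<dots> \<le> \<bar>A x j - A x i\<bar>"
        unfolding A_def using p'(3) hN by blast
      also have "\<dots> < h j" using A_cauchy[OF x ij(2,1)] ij by simp
      finally show ?thesis .
    next
      case 2
      have pos: "0 < h (FIRST \<bullet> g \<bullet> i)" using g ij by simp
      then have "h (FIRST \<bullet> g \<bullet> i) * \<bar>val (p \<bullet> (HAT \<bullet> x \<bullet> i))\<bar> \<le> h (FIRST \<bullet> g \<bullet> i) * 1"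
        using p'(2)[OF hN(1)] by (intro mult_left_mono) auto
      moreover have "\<bar>val (?F \<bullet> j) - val (?F \<bullet> i)\<bar> = h (FIRST \<bullet> g \<bullet> i) * \<bar>val (p \<bullet> (HAT \<bullet> x \<bullet> i))\<bar>"
        using 2 g p'(1) x ij abs_of_pos[OF pos] by (simp add: FAM_eq abs_mult)
      ultimately show ?thesis using 2(3) by simp
    qed
  qed
  then show ?thesis using FAM_eq[OF g p'(1) x n] by simp
qed

text \<open>The estimate holds at each stage separately, so it carries over equality as well as
  nearness of reals, the latter with the same witnessing stage.\<close>

lemma A_FAM_le:
  assumes g: "g \<in> Dom M T1" and p: "contracting p" and x: "x \<in> Dom M T1" and y: "y \<in> Dom M T1" and n: "n \<in> N"
  shows "\<bar>A (FAM \<bullet> g \<bullet> p \<bullet> x) n - A (FAM \<bullet> g \<bullet> p \<bullet> y) n\<bar> \<le> \<bar>A x n - A y n\<bar>"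
proof -
  have "\<bar>h (FIRST \<bullet> g \<bullet> n) * val (p \<bullet> (HAT \<bullet> x \<bullet> n)) - h (FIRST \<bullet> g \<bullet> n) * val (p \<bullet> (HAT \<bullet> y \<bullet> n))\<bar>
      \<le> \<bar>val (p \<bullet> (HAT \<bullet> x \<bullet> n)) - val (p \<bullet> (HAT \<bullet> y \<bullet> n))\<bar>"
    using g n by (intro h_mult_le) simp
  also have "\<dots> \<le> \<bar>A x n - A y n\<bar>"
    unfolding A_def using x y n by (intro contractingD(3)[OF p]) auto
  finally show ?thesis
    using A_FAM[OF g p x n] A_FAM[OF g p y n] by simp
qed

lemma FAM_Cbar:
  assumes g: "g \<in> Dom M T1" "st g" and p: "contracting p" "st p"
    and 0: "\<And>n. n \<in> N \<Longrightarrow> st n \<Longrightarrow> 0 \<le> A (FAM \<bullet> g \<bullet> p \<bullet> R0) n"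
    and 1: "\<And>n. n \<in> N \<Longrightarrow> st n \<Longrightarrow> A (FAM \<bullet> g \<bullet> p \<bullet> R1) n \<le> 0"
  shows "Cbar (FAM \<bullet> g \<bullet> p)"
  unfolding Cbar_def
proof (intro conjI)
  note le = A_FAM_le[OF g(1) p(1)]
  show "rfun (FAM \<bullet> g \<bullet> p)"
    unfolding rfun_def req_def using le by (meson order_trans)
  have "near (FAM \<bullet> g \<bullet> p \<bullet> x) (FAM \<bullet> g \<bullet> p \<bullet> y) k" if near: "x \<in> Dom M T1" "y \<in> Dom M T1" "near x y k" for x y k
  proof -
    obtain n where "n \<in> N" "st n" "\<bar>A x n - A y n\<bar> + (h n + h n) < h k"
      using near unfolding near_def by blast
    then show ?thesis
      unfolding near_def using le[OF near(1,2), of n] by (intro bexI[of _ n]) auto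
  qed
  then show "rcont (FAM \<bullet> g \<bullet> p)"
    unfolding rcont_def by blast
  show "rle st R0 (FAM \<bullet> g \<bullet> p \<bullet> R0)" "rle st (FAM \<bullet> g \<bullet> p \<bullet> R1) R0"
    unfolding rle_def
    using order_trans[OF _ add_increasing2[OF less_imp_le[OF add_pos_pos[OF h_pos h_pos]] order_refl]] 0 1
    by (fastforce simp: A_R0)+
qed

end

text \<open>On codes \<open>q\<close>: \<open>neg q\<close> is $-q$, \<open>clamp_c\<close> is $-\min(1,\max(0,q))$ and \<open>coclamp_c\<close> is $1-\min(1,\max(0,q))$.\<close>

definition neg :: "tm \<Rightarrow> tm" where
  "neg q = pair (pair (snd_c \<cdot> (fst_c \<cdot> q)) (fst_c \<cdot> (fst_c \<cdot> q))) (snd_c \<cdot> q)"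

definition code_1 :: tm where
  "code_1 = pair (pair (suc zero) zero) zero"

definition clamp_c :: tm where
  "clamp_c = lam T0 (cond (frac_less_char (decode zero) (decode (v 0)))
     (cond (frac_less_char (decode (v 0)) (decode code_1)) (neg (v 0)) (neg code_1)) zero)"

definition coclamp_c :: tm where
  "coclamp_c = lam T0 (pair (pair (add (suc (snd_c \<cdot> (clamp_c \<cdot> v 0))) (fst_c \<cdot> (fst_c \<cdot> (clamp_c \<cdot> v 0))))
     (snd_c \<cdot> (fst_c \<cdot> (clamp_c \<cdot> v 0)))) (snd_c \<cdot> (clamp_c \<cdot> v 0)))"

lemma code_typing [simp]:
  "wt D q \<Longrightarrow> ty_of q = T0 \<Longrightarrow> wt D (neg q)" "ty_of (neg q) = T0" "fv_tm (neg q) = fv_tm q"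
  "wt D code_1" "ty_of code_1 = T0" "fv_tm code_1 = {}"
  by (simp_all add: neg_def code_1_def)

lemma char_decode_typing [simp]:
  assumes "wt D t" "ty_of t = T0" "wt D u" "ty_of u = T0"
  shows "wt D (frac_less_char (decode t) (decode u))" "ty_of (frac_less_char (decode t) (decode u)) = T0"
  using assms by (simp_all add: decode_def)

lemma clamp_typing [simp]: "fv_tm clamp_c = {}" "wt D clamp_c" "ty_of clamp_c = T1"
proof -
  show "fv_tm clamp_c = {}"
    by (auto simp: clamp_c_def decode_def split: if_splits)
  show "wt D clamp_c" "ty_of clamp_c = T1" for D
    by (simp_all add: clamp_c_def)
qed

lemma coclamp_typing [simp]: "fv_tm coclamp_c = {}" "wt D coclamp_c" "ty_of coclamp_c = T1"
  by (auto simp: coclamp_c_def split: if_splits)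

context num_model
begin

subsection \<open>The intermediate value theorem implies transfer\<close>

lemma contracting_R1: "contracting R1"
  by (simp add: contracting_def R_eq)

text \<open>A zero recorded at a standard stage lies below that stage and would itself be
  standard.\<close>

lemma FIRST_eq_Z:
  assumes "g \<in> Dom M T1" "\<And>k. k \<in> N \<Longrightarrow> st k \<Longrightarrow> g \<bullet> k \<noteq> Z" "n \<in> N" "st n"
  shows "FIRST \<bullet> g \<bullet> n = Z"
proof (rule ccontr)
  assume "FIRST \<bullet> g \<bullet> n \<noteq> Z"
  then obtain k where k: "k \<in> N" "g \<bullet> k = Z" "nu k < nu n"
    using first_least assms by metis
  then have "st k" using Std_le[of n k] assms by simp
  with k assms show False by blast
qed

text \<open>The least internal zero of \<open>g\<close> shows up as a jump of the constant function \<open>FAM \<bullet> g \<bullet> R1\<close>.\<close>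

lemma IVT_imp_TRANS:
  assumes IVT
  shows TRANS
  unfolding TRANS_def
proof (intro ballI impI)
  fix f n assume f: "f \<in> Dom M T1" "st f" "\<forall>n\<in>N. st n \<longrightarrow> f \<bullet> n = Z" and n: "n \<in> N"
  define g where "g = eval M (scons T1 f dflt) (lam T0 (monus (suc zero) (Var T1 0 \<cdot> v 0)))"
  have g: "g \<in> Dom M T1" "st g"
    unfolding g_def using f by (auto intro!: eval_in Std_eval)
  have g_eq: "g \<bullet> k = Z \<longleftrightarrow> f \<bullet> k \<noteq> Z" if "k \<in> N" for k
    using that f by (simp add: g_def one_monus)
  have "FIRST \<bullet> g \<bullet> n = Z" if "n \<in> N" "st n" for n
    using g(1) _ that by (rule FIRST_eq_Z) (use g_eq f in auto)
  then have "A (FAM \<bullet> g \<bullet> R1 \<bullet> x) n = 0" if "n \<in> N" "st n" "x \<in> Dom M T1" for n x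
    using A_FAM[OF g(1) contracting_R1] that by simp
  then have "Cbar (FAM \<bullet> g \<bullet> R1)"
    using g by (intro FAM_Cbar contracting_R1) auto
  then obtain x where x: "x \<in> Dom M T1" "req full (FAM \<bullet> g \<bullet> R1 \<bullet> x) R0"
    using assms FAM_Std[of g R1] FAM_Dom[of g R1] g unfolding IVT_def by auto
  show "f \<bullet> n = Z"
  proof (rule ccontr)
    assume "f \<bullet> n \<noteq> Z"
    then have "FIRST \<bullet> g \<bullet> S n \<noteq> Z"
      using first_zero[OF g(1) n, of "S n"] g_eq n by simp
    then obtain k where k: "k \<in> N" "g \<bullet> k = Z" "FIRST \<bullet> g \<bullet> k = Z"
      using first_least[OF g(1), of "S n"] n by auto
    \<comment> \<open>Stage k + 1 would not do: there the value 2^-(k+1) equals the admissible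
      error. At stage k + 2 it is twice as large.\<close>
    have "FIRST \<bullet> g \<bullet> S (S k) = S k"
      using first_rec[OF g(1)] k by simp
    then have "A (FAM \<bullet> g \<bullet> R1 \<bullet> x) (S (S k)) = h (S k)"
      using A_FAM[OF g(1) contracting_R1 x(1), of "S (S k)"] k x by (simp add: R_eq)
    moreover have "\<bar>A (FAM \<bullet> g \<bullet> R1 \<bullet> x) (S (S k)) - A R0 (S (S k))\<bar> \<le> h (S (S k))"
      using bspec[OF x(2)[unfolded req_def], of "S (S k)"] k by (simp del: h_rec)
    ultimately show False
      using k h_pos[OF k(1)] by (simp add: A_R0)
  qed
qed

subsection \<open>Grilliot's trick\<close>

definition "CLAMP = eval M dflt clamp_c"
definition "COCLAMP = eval M dflt coclamp_c"

lemma eval_CLAMP [simp]: "eval M e clamp_c = CLAMP" "eval M e coclamp_c = COCLAMP"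
  by (auto simp: CLAMP_def COCLAMP_def intro!: eval_closed)

lemma CLAMP_Dom [simp]: "CLAMP \<in> Dom M T1" "COCLAMP \<in> Dom M T1" "st CLAMP" "st COCLAMP"
  using eval_in[of clamp_c T1 dflt] eval_in[of coclamp_c T1 dflt] Std_closed[of clamp_c dflt] Std_closed[of coclamp_c dflt]
  by auto

lemma val_neg: "a \<in> N \<Longrightarrow> val (PAIR \<bullet> (PAIR \<bullet> (SND \<bullet> (FST \<bullet> a)) \<bullet> (FST \<bullet> (FST \<bullet> a))) \<bullet> (SND \<bullet> a)) = - val a"
  by (simp add: val_def minus_divide_left)

lemma val_CLAMP: "a \<in> N \<Longrightarrow> val (CLAMP \<bullet> a) = - min 1 (max 0 (val a))"
proof -
  assume a: "a \<in> N"
  let ?e = "scons T0 a dflt"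
  let ?c = "frac_less_char (decode zero) (decode (v 0))" and ?d = "frac_less_char (decode (v 0)) (decode code_1)"
  have c: "eval M ?e ?c = Z \<longleftrightarrow> 0 < val a" "eval M ?e ?d = Z \<longleftrightarrow> val a < 1"
    using a by (simp_all add: frac_less_char_eq code_1_def)
  have N: "eval M ?e ?c \<in> N" "eval M ?e ?d \<in> N" "eval M ?e (neg (v 0)) \<in> N" "eval M ?e (neg code_1) \<in> N"
    using a by (auto intro!: eval_in)
  have n: "val (eval M ?e (neg (v 0))) = - val a" "val (eval M ?e (neg code_1)) = - 1"
    using a by (simp add: neg_def val_neg del: val_pair) (simp add: neg_def code_1_def)
  have "CLAMP \<bullet> a = COND \<bullet> eval M ?e ?c \<bullet> (COND \<bullet> eval M ?e ?d \<bullet> eval M ?e (neg (v 0)) \<bullet> eval M ?e (neg code_1)) \<bullet> Z"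
    using a by (simp add: CLAMP_def clamp_c_def)
  then show ?thesis
    using N by (auto simp: cond_eq c n)
qed

lemma val_COCLAMP: "a \<in> N \<Longrightarrow> val (COCLAMP \<bullet> a) = 1 - min 1 (max 0 (val a))"
proof -
  assume a: "a \<in> N"
  define q where "q = CLAMP \<bullet> a"
  have q: "q \<in> N" using a by (simp add: q_def)
  have "COCLAMP \<bullet> a = PAIR \<bullet> (PAIR \<bullet> (S (SND \<bullet> q) \<oplus> FST \<bullet> (FST \<bullet> q)) \<bullet> (SND \<bullet> (FST \<bullet> q))) \<bullet> (SND \<bullet> q)"
    using a by (simp add: COCLAMP_def coclamp_c_def q_def)
  moreover have "nu (SND \<bullet> q) + 1 \<noteq> 0"
    using nu_nonneg[of "SND \<bullet> q"] q by (metis add_nonneg_pos less_irrefl N_closed(13) zero_less_one)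
  ultimately have "val (COCLAMP \<bullet> a) = 1 + val q"
    using q by (simp add: val_def field_simps)
  then show ?thesis
    using a by (simp add: q_def val_CLAMP)
qed

lemma contracting_CLAMP: "contracting CLAMP" "contracting COCLAMP"
  unfolding contracting_def by (auto simp: val_CLAMP val_COCLAMP abs_if min_def max_def)

text \<open>The approximation at stage n depends on the sequence up to n only, and all numbers below
  a standard one are standard.\<close>

lemma A_cong:
  assumes "x \<in> Dom M T1" "y \<in> Dom M T1" "\<And>n. n \<in> N \<Longrightarrow> st n \<Longrightarrow> x \<bullet> n = y \<bullet> n" "n \<in> N" "st n"
  shows "A x n = A y n"
proof -
  have eq: "x \<bullet> i = y \<bullet> i" if "i \<in> N" "nu i \<le> nu n" for i
    using assms that Std_le[of n i] by blast
  have viol: "VIOL \<bullet> x \<bullet> m = Z \<longleftrightarrow> VIOL \<bullet> y \<bullet> m = Z" if "m \<in> N" "nu m \<le> nu n" for m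
  proof -
    have xy: "x \<bullet> i = y \<bullet> i" if "i \<in> N" "nu i \<le> nu m" for i
      using that \<open>nu m \<le> nu n\<close> eq by auto
    show ?thesis
      unfolding viol_eq_Z[OF assms(1) that(1)] viol_eq_Z[OF assms(2) that(1)]
    proof (intro ball_cong imp_cong refl)
      fix i j assume "i \<in> N" "nu i \<le> nu m" "j \<in> N" "nu j < nu i"
      then show "\<bar>val (x \<bullet> j) - val (x \<bullet> i)\<bar> < h j \<longleftrightarrow> \<bar>val (y \<bullet> j) - val (y \<bullet> i)\<bar> < h j"
        using xy[of i] xy[of j] by simp
    qed
  qed
  have "sat M (scons T0 n (scons T0 n (scons T1 x (scons T1 y dflt))))
      (le (v 0) (v 1) \<^bold>\<longrightarrow> hat_c \<cdot> Var T1 0 \<cdot> v 0 \<^bold>= hat_c \<cdot> Var T1 1 \<cdot> v 0)"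
  proof (rule qf_ind)
    fix m assume m: "m \<in> N" "sat M (scons T0 m (scons T0 n (scons T1 x (scons T1 y dflt))))
      (le (v 0) (v 1) \<^bold>\<longrightarrow> hat_c \<cdot> Var T1 0 \<cdot> v 0 \<^bold>= hat_c \<cdot> Var T1 1 \<cdot> v 0)"
    then have IH: "nu m \<le> nu n \<longrightarrow> HAT \<bullet> x \<bullet> m = HAT \<bullet> y \<bullet> m" using assms by simp
    have "HAT \<bullet> x \<bullet> S m = HAT \<bullet> y \<bullet> S m" if le: "nu (S m) \<le> nu n"
    proof -
      have "nu m \<le> nu n" using le m by simp
      then show ?thesis
        using hat_rec(2)[OF assms(1) m(1)] hat_rec(2)[OF assms(2) m(1)] viol[of "S m"] eq[of "S m"] IH le m by simp
    qed
    then show "sat M (scons T0 (S m) (scons T0 n (scons T1 x (scons T1 y dflt))))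
      (le (v 0) (v 1) \<^bold>\<longrightarrow> hat_c \<cdot> Var T1 0 \<cdot> v 0 \<^bold>= hat_c \<cdot> Var T1 1 \<cdot> v 0)"
      using assms m by simp
  qed (use assms eq[of Z] in \<open>simp_all add: hat_rec\<close>)
  then show ?thesis using assms by (simp add: A_def)
qed

lemma FAM_eq_Z:
  assumes "g \<in> Dom M T1" "p \<in> Dom M T1" "x \<in> Dom M T1" "n \<in> N" "FIRST \<bullet> g \<bullet> n = Z"
  shows "FAM \<bullet> g \<bullet> p \<bullet> x \<bullet> n = Z"
  using assms by (simp add: FAM_def fam_c_def scale_def cond_eq)

lemma R1_neq_Z: "n \<in> N \<Longrightarrow> R1 \<bullet> n \<noteq> Z"
proof
  assume "n \<in> N" "R1 \<bullet> n = Z"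
  then have "val (R1 \<bullet> n) = 0" by simp
  with \<open>n \<in> N\<close> show False by (simp add: R_eq)
qed

lemma EUIVT_ext:
  assumes "EUIVT \<Phi>" "F \<in> Dom M (T1 \<rightarrow> T1)" "st F" "G \<in> Dom M (T1 \<rightarrow> T1)" "st G"
    "\<forall>x\<in>Dom M T1. st x \<longrightarrow> (\<forall>n\<in>N. st n \<longrightarrow> F \<bullet> x \<bullet> n = G \<bullet> x \<bullet> n)" "n \<in> N" "st n"
  shows "\<Phi> \<bullet> F \<bullet> n = \<Phi> \<bullet> G \<bullet> n"
proof -
  from assms(1) have "\<forall>F\<in>Dom M (T1 \<rightarrow> T1). st F \<longrightarrow> (\<forall>G\<in>Dom M (T1 \<rightarrow> T1). st G \<longrightarrow>
        (\<forall>x\<in>Dom M T1. st x \<longrightarrow> (\<forall>n\<in>N. st n \<longrightarrow> F \<bullet> x \<bullet> n = G \<bullet> x \<bullet> n)) \<longrightarrow>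
        (\<forall>n\<in>N. st n \<longrightarrow> \<Phi> \<bullet> F \<bullet> n = \<Phi> \<bullet> G \<bullet> n))"
    unfolding EUIVT_def by (elim conjE)
  from this[rule_format, OF assms(2-5) _ assms(7,8)] assms(6) show ?thesis by blast
qed

text \<open>Both functions vanish at standard arguments and stages, and standard extensionality
  applies. \<open>R1\<close> serves as a standard sequence without zeros: its entries are codes of
  1, and code 0 stands for 0.\<close>

lemma EUIVT_no_zero:
  assumes \<Phi>: "EUIVT \<Phi>" and g: "g \<in> Dom M T1" "st g" and p: "p \<in> Dom M T1" "st p"
    and no: "\<not> (\<exists>k\<in>N. st k \<and> g \<bullet> k = Z)" and n: "n \<in> N" "st n"
  shows "A (\<Phi> \<bullet> (FAM \<bullet> g \<bullet> p)) n = A (\<Phi> \<bullet> (FAM \<bullet> R1 \<bullet> CLAMP)) n"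
proof (rule A_cong)
  have \<Phi>_Dom: "\<Phi> \<in> Dom M ((T1 \<rightarrow> T1) \<rightarrow> T1)" using \<Phi> by (simp add: EUIVT_def)
  then show "\<Phi> \<bullet> (FAM \<bullet> g \<bullet> p) \<in> Dom M T1" "\<Phi> \<bullet> (FAM \<bullet> R1 \<bullet> CLAMP) \<in> Dom M T1"
    using g p by auto
  have Z: "FIRST \<bullet> g \<bullet> k = Z" "FIRST \<bullet> R1 \<bullet> k = Z" if "k \<in> N" "st k" for k
    using FIRST_eq_Z[OF g(1) _ that] FIRST_eq_Z[OF _ _ that, of R1] no R1_neq_Z by auto
  have "FAM \<bullet> g \<bullet> p \<bullet> x \<bullet> k = FAM \<bullet> R1 \<bullet> CLAMP \<bullet> x \<bullet> k" if "x \<in> Dom M T1" "k \<in> N" "st k" for x k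
    using FAM_eq_Z[OF g(1) p(1) that(1,2)] FAM_eq_Z[OF _ _ that(1,2), of R1 CLAMP] Z[OF that(2,3)] by simp
  then show "\<Phi> \<bullet> (FAM \<bullet> g \<bullet> p) \<bullet> k = \<Phi> \<bullet> (FAM \<bullet> R1 \<bullet> CLAMP) \<bullet> k" if "k \<in> N" "st k" for k
    using that g p by (intro EUIVT_ext[OF \<Phi>]) (auto intro: FAM_Std)
qed (use n in auto)

text \<open>The scale of the function is a standard power of two, so the bound on its value at the
  root can be divided by it: \<open>p\<close> almost vanishes at a late approximation of the root.
  For the two clamped maps this puts the approximation at stage 2 below 3/8 and above 5/8,
  respectively.\<close>

lemma EUIVT_zero:
  assumes \<Phi>: "EUIVT \<Phi>" and g: "g \<in> Dom M T1" "st g" and p: "contracting p" "st p"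
    and 0: "\<And>a. a \<in> N \<Longrightarrow> val a = 0 \<Longrightarrow> 0 \<le> val (p \<bullet> a)"
    and 1: "\<And>a. a \<in> N \<Longrightarrow> val a = 1 \<Longrightarrow> val (p \<bullet> a) \<le> 0"
    and k: "k \<in> N" "st k" "g \<bullet> k = Z"
  obtains a where "a \<in> N" "\<bar>val (p \<bullet> a)\<bar> \<le> 1/8" "\<bar>A (\<Phi> \<bullet> (FAM \<bullet> g \<bullet> p)) (S (S Z)) - val a\<bar> < 1/4"
proof -
  define F y where "F = FAM \<bullet> g \<bullet> p" and "y = \<Phi> \<bullet> F"
  have F: "F \<in> Dom M (T1 \<rightarrow> T1)" "st F"
    using FAM_Dom[OF g(1) contractingD(1)[OF p(1)]] FAM_Std[OF g(1) contractingD(1)[OF p(1)] g(2) p(2)]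
    by (auto simp: F_def)
  have y: "y \<in> Dom M T1" using \<Phi> F by (simp add: y_def EUIVT_def)
  have hN: "0 \<le> h (FIRST \<bullet> g \<bullet> n)" if "n \<in> N" for n
    using g that by (simp add: less_imp_le)
  have "Cbar F"
    unfolding F_def
  proof (rule FAM_Cbar[OF g p])
    fix n assume n: "n \<in> N" "st n"
    show "0 \<le> A (FAM \<bullet> g \<bullet> p \<bullet> R0) n"
      using A_FAM[OF g(1) p(1) _ n(1), of R0] 0[of "HAT \<bullet> R0 \<bullet> n"] A_R0[OF n(1)] hN[OF n(1)] n
      by (simp add: A_def)
    show "A (FAM \<bullet> g \<bullet> p \<bullet> R1) n \<le> 0"
      using A_FAM[OF g(1) p(1) _ n(1), of R1] 1[of "HAT \<bullet> R1 \<bullet> n"] A_R1[OF n(1)] hN[OF n(1)] n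
      by (simp add: A_def mult_nonneg_nonpos)
  qed
  then have req: "req st (F \<bullet> y) R0"
    using \<Phi> F unfolding EUIVT_def y_def by blast
  have "FIRST \<bullet> g \<bullet> S k \<noteq> Z"
    using first_zero[OF g(1) k(1) _ k(3), of "S k"] k by simp
  then obtain l where l: "l \<in> N" "FIRST \<bullet> g \<bullet> S k = S l" "nu l < nu (S k)" "g \<bullet> l = Z"
    using first_least[OF g(1), of "S k"] k by auto
  have "st l" using Std_le[of "S k" l] l k by simp
  \<comment> \<open>Three stages beyond l + 1, so that the admissible error 2^-n is one eighth of
    the scale 2^-(l+1).\<close>
  define n where "n = S (S (S (S l)))"
  have n: "n \<in> N" "st n" using l \<open>st l\<close> by (auto simp: n_def)
  have First: "FIRST \<bullet> g \<bullet> n = S l"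
  proof -
    have "FIRST \<bullet> g \<bullet> n \<noteq> Z"
      using first_zero[OF g(1) l(1) n(1) l(4)] l by (simp add: n_def)
    then show ?thesis
      using first_persist[OF g(1), of "S k" n] first_persist[OF g(1), of n "S k"] l(2) k(1) n(1) S_neq_Z[OF l(1)]
      by (cases "nu (S k) \<le> nu n") (simp_all del: nu_S S_neq_Z add: linear)
  qed
  let ?a = "HAT \<bullet> y \<bullet> n"
  have a: "?a \<in> N" using y n by simp
  have hl: "0 < h l" "h n = h (S l) / 8" "h (S l) = h l / 2" using l by (simp_all add: n_def)
  have "\<bar>A (F \<bullet> y) n\<bar> \<le> h n"
    using req n unfolding req_def by (auto simp: A_R0)
  then have "h (S l) * \<bar>val (p \<bullet> ?a)\<bar> \<le> h (S l) * (1/8)"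
    using A_FAM[OF g(1) p(1) y n(1)] First l hl by (simp add: F_def abs_mult del: h_rec)
  then have "\<bar>val (p \<bullet> ?a)\<bar> \<le> 1/8"
    using hl by (simp add: mult_le_cancel_left_pos del: h_rec)
  \<comment> \<open>Stage 2 precedes n, hence the error is below 2^-2.\<close>
  moreover have "\<bar>A y (S (S Z)) - val ?a\<bar> < 1/4"
    using A_cauchy[OF y, of "S (S Z)" n] n l by (simp add: n_def A_def add_nonneg_nonneg)
  ultimately show thesis using that a by (simp add: y_def F_def)
qed

lemma EUIVT_imp_EX2:
  assumes \<Phi>: "EUIVT \<Phi>"
  shows "\<exists>\<phi>. EX2 \<phi>"
proof -
  let ?S = "(T1 \<rightarrow> T1) \<rightarrow> T1"
  let ?x = "apx (Var ?S 0 \<cdot> (fam_c \<cdot> Var T1 0 \<cdot> Var T1 1)) (suc (suc zero))"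
  let ?h = "(suc zero, zero, suc (suc zero)) :: frac"
  have \<Phi>_Dom: "\<Phi> \<in> Dom M ?S" "st \<Phi>" using \<Phi> by (auto simp: EUIVT_def)
  have h: "fok e ?h" "fval e ?h = 1/2" if "is_env M e" for e
    using that by (simp_all add: fok_def fval_def)
  have x: "fok e ?x" "fval e ?x = A (e ?S 0 \<bullet> (FAM \<bullet> e T1 0 \<bullet> e T1 1)) (S (S Z))" if "is_env M e" for e
    using that by simp_all
  have typing: "wt D (frac_less_char ?x ?h)" "ty_of (frac_less_char ?x ?h) = T0"
    "wt D (frac_less_char ?h ?x)" "ty_of (frac_less_char ?h ?x) = T0"
    using tmN_frac_less_char[OF x(1) h(1), of dflt] tmN_frac_less_char[OF h(1) x(1), of dflt] by auto
  define \<alpha> where "\<alpha> p g = A (\<Phi> \<bullet> (FAM \<bullet> g \<bullet> p)) (S (S Z))" for p g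
  define \<phi> \<psi> where "\<phi> = eval M (scons T1 CLAMP (scons ?S \<Phi> dflt)) (lam T1 (frac_less_char ?x ?h))"
    and "\<psi> = eval M (scons T1 COCLAMP (scons ?S \<Phi> dflt)) (lam T1 (frac_less_char ?h ?x))"
  have \<phi>_Dom: "\<phi> \<in> Dom M T2" "\<psi> \<in> Dom M T2" "st \<phi>" "st \<psi>"
    unfolding \<phi>_def \<psi>_def using typing \<Phi>_Dom by (auto simp del: frac_less_char.simps intro!: eval_in Std_eval)
  have \<phi>_eq: "\<phi> \<bullet> g = Z \<longleftrightarrow> \<alpha> CLAMP g < 1/2" "\<psi> \<bullet> g = Z \<longleftrightarrow> 1/2 < \<alpha> COCLAMP g" if "g \<in> Dom M T1" for g
  proof -
    have e: "is_env M (scons T1 g (scons T1 p (scons ?S \<Phi> dflt)))" if "p \<in> Dom M T1" for p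
      using that \<Phi>_Dom \<open>g \<in> Dom M T1\<close> by simp
    show "\<phi> \<bullet> g = Z \<longleftrightarrow> \<alpha> CLAMP g < 1/2"
      using frac_less_char_eq[OF x(1) h(1), OF e e, of CLAMP] x(2)[OF e, of CLAMP] h(2)[OF e, of CLAMP] typing that \<Phi>_Dom
      by (simp add: \<phi>_def \<alpha>_def del: frac_less_char.simps)
    show "\<psi> \<bullet> g = Z \<longleftrightarrow> 1/2 < \<alpha> COCLAMP g"
      using frac_less_char_eq[OF h(1) x(1), OF e e, of COCLAMP] x(2)[OF e, of COCLAMP] h(2)[OF e, of COCLAMP] typing that \<Phi>_Dom
      by (simp add: \<psi>_def \<alpha>_def del: frac_less_char.simps)
  qed
  have no: "\<alpha> p g = \<alpha> CLAMP R1" if "g \<in> Dom M T1" "st g" "p \<in> Dom M T1" "st p" "\<not> (\<exists>k\<in>N. st k \<and> g \<bullet> k = Z)" for p g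
    unfolding \<alpha>_def using EUIVT_no_zero[OF \<Phi> that] by simp
  have zero: "\<alpha> CLAMP g < 1/2" "1/2 < \<alpha> COCLAMP g" if g: "g \<in> Dom M T1" "st g" "\<exists>k\<in>N. st k \<and> g \<bullet> k = Z" for g
  proof -
    from g obtain k where k: "k \<in> N" "st k" "g \<bullet> k = Z" by blast
    obtain a where "a \<in> N" "\<bar>val (CLAMP \<bullet> a)\<bar> \<le> 1/8" "\<bar>\<alpha> CLAMP g - val a\<bar> < 1/4"
      unfolding \<alpha>_def using EUIVT_zero[OF \<Phi> g(1,2) contracting_CLAMP(1) _ _ _ k] by (auto simp: val_CLAMP)
    then show "\<alpha> CLAMP g < 1/2"
      by (auto simp: val_CLAMP min_def max_def abs_if split: if_splits)
    obtain a where "a \<in> N" "\<bar>val (COCLAMP \<bullet> a)\<bar> \<le> 1/8" "\<bar>\<alpha> COCLAMP g - val a\<bar> < 1/4"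
      unfolding \<alpha>_def using EUIVT_zero[OF \<Phi> g(1,2) contracting_CLAMP(2) _ _ _ k] by (auto simp: val_COCLAMP)
    then show "1/2 < \<alpha> COCLAMP g"
      by (auto simp: val_COCLAMP min_def max_def abs_if split: if_splits)
  qed
  show ?thesis
  \<comment> \<open>The root found for the zero function is compared with 1/2. The map is chosen
    that sends the root to the other side as soon as there is a standard zero.\<close>
  proof (cases "\<alpha> CLAMP R1 < 1/2")
    case True
    have "EX2 \<psi>"
      unfolding EX2_def
    proof (intro conjI ballI impI \<phi>_Dom)
      fix g assume g: "g \<in> Dom M T1" "st g"
      show "(\<exists>x\<in>N. st x \<and> g \<bullet> x = Z) \<longleftrightarrow> \<psi> \<bullet> g = Z"
      proof (cases "\<exists>x\<in>N. st x \<and> g \<bullet> x = Z")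
        case zero_g: True
        with zero(2)[OF g] \<phi>_eq(2)[OF g(1)] show ?thesis by simp
      next
        case no_zero: False
        then have "\<not> \<psi> \<bullet> g = Z"
          using no[OF g _ _ no_zero, of COCLAMP] True \<phi>_eq(2)[OF g(1)] by simp
        with no_zero show ?thesis by simp
      qed
    qed
    then show ?thesis ..
  next
    case False
    have "EX2 \<phi>"
      unfolding EX2_def
    proof (intro conjI ballI impI \<phi>_Dom)
      fix g assume g: "g \<in> Dom M T1" "st g"
      show "(\<exists>x\<in>N. st x \<and> g \<bullet> x = Z) \<longleftrightarrow> \<phi> \<bullet> g = Z"
      proof (cases "\<exists>x\<in>N. st x \<and> g \<bullet> x = Z")
        case zero_g: True
        with zero(1)[OF g] \<phi>_eq(1)[OF g(1)] show ?thesis by simp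
      next
        case no_zero: False
        then have "\<not> \<phi> \<bullet> g = Z"
          using no[OF g _ _ no_zero, of CLAMP] False \<phi>_eq(1)[OF g(1)] by simp
        with no_zero show ?thesis by simp
      qed
    qed
    then show ?thesis ..
  qed
qed

end

section \<open>Bisection\<close>

definition const_c :: tm where
  "const_c = lam T0 (lam T0 (v 1))"

text \<open>\<open>pos_c \<cdot> r \<cdot> k\<close> has the value \<open>0\<close> at \<open>m\<close> if and only if stage \<open>m\<close> shows that the real \<open>r \<cdot> k\<close> is positive.\<close>

definition pos_c :: tm where
  "pos_c = lam (T0 \<rightarrow> T1) (lam T0 (lam T0 (frac_less_char (frac_add (frac_pow (v 0)) (frac_pow (v 0)))
     (apx (Var (T0 \<rightarrow> T1) 0 \<cdot> v 1) (v 0)))))"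

text \<open>A code of the midpoint of two rationals: the denominator of their sum is doubled and
  stored diminished by one.\<close>

definition half_sum :: "tm \<Rightarrow> tm \<Rightarrow> tm" where
  "half_sum l r = (case frac_add (decode l) (decode r) of (x, y, w) \<Rightarrow> pair (pair x y) (pred_c \<cdot> add w w))"

text \<open>
  The state \<open>v 1\<close> is the pair of the end points of the current interval.  For a functional \<open>Var T2 0\<close>
  as in $(\exists^2)$, the first case is that the function is positive at the midpoint.
\<close>

definition bisect_step :: tm where
  "bisect_step = (let l = fst_c \<cdot> v 1; r = snd_c \<cdot> v 1 in
     cond (Var T2 0 \<cdot> (pos_c \<cdot> Var (T0 \<rightarrow> T1) 0 \<cdot> half_sum l r)) (pair (half_sum l r) r) (pair l (half_sum l r)))"

definition bisect_c :: tm where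
  "bisect_c = lam T2 (lam (T0 \<rightarrow> T1) (lam T0 (rec (pair zero code_1) bisect_step (v 0))))"

definition left_c :: tm where
  "left_c = lam T2 (lam (T0 \<rightarrow> T1) (lam T0 (fst_c \<cdot> (bisect_c \<cdot> Var T2 0 \<cdot> Var (T0 \<rightarrow> T1) 0 \<cdot> v 0))))"

definition right_c :: tm where
  "right_c = lam T2 (lam (T0 \<rightarrow> T1) (lam T0 (snd_c \<cdot> (bisect_c \<cdot> Var T2 0 \<cdot> Var (T0 \<rightarrow> T1) 0 \<cdot> v 0))))"

text \<open>The restriction of a function to the rationals, as a sequence of reals. The bisection
  receives nothing else of the function.\<close>

definition comp_c :: tm where
  "comp_c = lam (T1 \<rightarrow> T1) (lam T0 (Var (T1 \<rightarrow> T1) 0 \<cdot> (const_c \<cdot> v 0)))"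

lemma const_c_typing [simp]: "fv_tm const_c = {}" "wt D const_c" "ty_of const_c = T0 \<rightarrow> T1"
  by (auto simp: const_c_def)

lemma pos_c_typing [simp]: "fv_tm pos_c = {}" "wt D pos_c" "ty_of pos_c = (T0 \<rightarrow> T1) \<rightarrow> T0 \<rightarrow> T1"
proof -
  let ?t = "frac_less_char (frac_add (frac_pow (v 0)) (frac_pow (v 0))) (apx (Var (T0 \<rightarrow> T1) 0 \<cdot> v 1) (v 0))"
  show "fv_tm pos_c = {}"
    by (auto simp: pos_c_def apx_def decode_def frac_pow_def split: if_splits)
  have "wt D ?t" "ty_of ?t = T0" for D
    by (simp_all add: apx_def decode_def frac_pow_def)
  then show "wt D pos_c" "ty_of pos_c = (T0 \<rightarrow> T1) \<rightarrow> T0 \<rightarrow> T1" for D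
    by (simp_all add: pos_c_def del: frac_less_char.simps frac_add.simps)
qed

lemma half_sum_typing [simp]:
  "wt D t \<Longrightarrow> ty_of t = T0 \<Longrightarrow> wt D u \<Longrightarrow> ty_of u = T0 \<Longrightarrow> wt D (half_sum t u)"
  "ty_of (half_sum t u) = T0"
  "fv_tm (half_sum t u) = fv_tm t \<union> fv_tm u"
  by (auto simp: half_sum_def decode_def)

lemma bisect_step_typing [simp]:
  "wt D bisect_step" "ty_of bisect_step = T0" "fv_tm bisect_step = {(T0, 1), (T2, 0), (T0 \<rightarrow> T1, 0)}"
  by (auto simp: bisect_step_def Let_def)

lemma bisect_typing [simp]:
  "fv_tm bisect_c = {}" "wt D bisect_c" "ty_of bisect_c = T2 \<rightarrow> (T0 \<rightarrow> T1) \<rightarrow> T1"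
  "fv_tm left_c = {}" "wt D left_c" "ty_of left_c = T2 \<rightarrow> (T0 \<rightarrow> T1) \<rightarrow> T1"
  "fv_tm right_c = {}" "wt D right_c" "ty_of right_c = T2 \<rightarrow> (T0 \<rightarrow> T1) \<rightarrow> T1"
proof -
  show 1: "fv_tm bisect_c = {}"
    by (auto simp: bisect_c_def split: if_splits)
  show 2: "wt D bisect_c" "ty_of bisect_c = T2 \<rightarrow> (T0 \<rightarrow> T1) \<rightarrow> T1" for D
    by (simp_all add: bisect_c_def)
  show "wt D left_c" "ty_of left_c = T2 \<rightarrow> (T0 \<rightarrow> T1) \<rightarrow> T1"
    "wt D right_c" "ty_of right_c = T2 \<rightarrow> (T0 \<rightarrow> T1) \<rightarrow> T1"
    using 2 by (simp_all add: left_c_def right_c_def)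
  show "fv_tm left_c = {}" "fv_tm right_c = {}"
    using 1 by (auto simp: left_c_def right_c_def split: if_splits)
qed

lemma comp_typing [simp]: "fv_tm comp_c = {}" "wt D comp_c" "ty_of comp_c = (T1 \<rightarrow> T1) \<rightarrow> T0 \<rightarrow> T1"
  by (auto simp: comp_c_def split: if_splits)

context num_model
begin

definition "KSEQ = eval M dflt const_c"
definition "POS = eval M dflt pos_c"
definition "BISECT = eval M dflt bisect_c"
definition "LEFT = eval M dflt left_c"
definition "RIGHT = eval M dflt right_c"
definition "COMP = eval M dflt comp_c"
definition "MID a b = eval M (scons T0 a (scons T0 b dflt)) (half_sum (v 0) (v 1))"

lemma eval_bisect [simp]:
  "eval M e const_c = KSEQ" "eval M e pos_c = POS" "eval M e bisect_c = BISECT" "eval M e left_c = LEFT"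
  "eval M e right_c = RIGHT" "eval M e comp_c = COMP"
  "eval M e (half_sum t u) = MID (eval M e t) (eval M e u)"
  by (auto simp: KSEQ_def POS_def BISECT_def LEFT_def RIGHT_def COMP_def intro!: eval_closed)
    (simp add: MID_def half_sum_def decode_def)

lemma code_1 [simp]: "eval M e code_1 = R1 \<bullet> Z"
  by (simp add: code_1_def R_eq)

lemma bisect_Dom:
  "k \<in> N \<Longrightarrow> KSEQ \<bullet> k \<in> Dom M T1"
  "r \<in> Dom M (T0 \<rightarrow> T1) \<Longrightarrow> k \<in> N \<Longrightarrow> POS \<bullet> r \<bullet> k \<in> Dom M T1"
  "\<phi> \<in> Dom M T2 \<Longrightarrow> r \<in> Dom M (T0 \<rightarrow> T1) \<Longrightarrow> n \<in> N \<Longrightarrow> BISECT \<bullet> \<phi> \<bullet> r \<bullet> n \<in> N"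
  "\<phi> \<in> Dom M T2 \<Longrightarrow> r \<in> Dom M (T0 \<rightarrow> T1) \<Longrightarrow> LEFT \<bullet> \<phi> \<bullet> r \<in> Dom M T1"
  "\<phi> \<in> Dom M T2 \<Longrightarrow> r \<in> Dom M (T0 \<rightarrow> T1) \<Longrightarrow> RIGHT \<bullet> \<phi> \<bullet> r \<in> Dom M T1"
  "F \<in> Dom M (T1 \<rightarrow> T1) \<Longrightarrow> COMP \<bullet> F \<in> Dom M (T0 \<rightarrow> T1)"
  "a \<in> N \<Longrightarrow> b \<in> N \<Longrightarrow> MID a b \<in> N"
  using eval_in[of "const_c \<cdot> v 0" T1 "scons T0 k dflt"]
    eval_in[of "pos_c \<cdot> Var (T0 \<rightarrow> T1) 0 \<cdot> v 0" T1 "scons (T0 \<rightarrow> T1) r (scons T0 k dflt)"]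
    eval_in[of "bisect_c \<cdot> Var T2 0 \<cdot> Var (T0 \<rightarrow> T1) 0 \<cdot> v 0" T0 "scons T2 \<phi> (scons (T0 \<rightarrow> T1) r (scons T0 n dflt))"]
    eval_in[of "left_c \<cdot> Var T2 0 \<cdot> Var (T0 \<rightarrow> T1) 0" T1 "scons T2 \<phi> (scons (T0 \<rightarrow> T1) r dflt)"]
    eval_in[of "right_c \<cdot> Var T2 0 \<cdot> Var (T0 \<rightarrow> T1) 0" T1 "scons T2 \<phi> (scons (T0 \<rightarrow> T1) r dflt)"]
    eval_in[of "comp_c \<cdot> Var (T1 \<rightarrow> T1) 0" "T0 \<rightarrow> T1" "scons (T1 \<rightarrow> T1) F dflt"]
    eval_in[of "half_sum (v 0) (v 1)" T0 "scons T0 a (scons T0 b dflt)"]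
  by simp_all

lemma bisect_Std:
  "k \<in> N \<Longrightarrow> st k \<Longrightarrow> st (KSEQ \<bullet> k)"
  "r \<in> Dom M (T0 \<rightarrow> T1) \<Longrightarrow> k \<in> N \<Longrightarrow> st r \<Longrightarrow> st k \<Longrightarrow> st (POS \<bullet> r \<bullet> k)"
  "\<phi> \<in> Dom M T2 \<Longrightarrow> r \<in> Dom M (T0 \<rightarrow> T1) \<Longrightarrow> st \<phi> \<Longrightarrow> st r \<Longrightarrow> st (LEFT \<bullet> \<phi> \<bullet> r)"
  "\<phi> \<in> Dom M T2 \<Longrightarrow> r \<in> Dom M (T0 \<rightarrow> T1) \<Longrightarrow> st \<phi> \<Longrightarrow> st r \<Longrightarrow> st (RIGHT \<bullet> \<phi> \<bullet> r)"
  "F \<in> Dom M (T1 \<rightarrow> T1) \<Longrightarrow> st F \<Longrightarrow> st (COMP \<bullet> F)"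
  using Std_eval[of "const_c \<cdot> v 0" "scons T0 k dflt"]
    Std_eval[of "pos_c \<cdot> Var (T0 \<rightarrow> T1) 0 \<cdot> v 0" "scons (T0 \<rightarrow> T1) r (scons T0 k dflt)"]
    Std_eval[of "left_c \<cdot> Var T2 0 \<cdot> Var (T0 \<rightarrow> T1) 0" "scons T2 \<phi> (scons (T0 \<rightarrow> T1) r dflt)"]
    Std_eval[of "right_c \<cdot> Var T2 0 \<cdot> Var (T0 \<rightarrow> T1) 0" "scons T2 \<phi> (scons (T0 \<rightarrow> T1) r dflt)"]
    Std_eval[of "comp_c \<cdot> Var (T1 \<rightarrow> T1) 0" "scons (T1 \<rightarrow> T1) F dflt"]
  by simp_all

lemma KSEQ_eq: "k \<in> N \<Longrightarrow> n \<in> N \<Longrightarrow> KSEQ \<bullet> k \<bullet> n = k"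
  by (simp add: KSEQ_def const_c_def)

lemma A_KSEQ: "k \<in> N \<Longrightarrow> n \<in> N \<Longrightarrow> A (KSEQ \<bullet> k) n = val k"
  by (simp add: A_eq_val bisect_Dom KSEQ_eq)

lemma KSEQ_ends: "KSEQ \<bullet> Z = R0" "KSEQ \<bullet> (R1 \<bullet> Z) = R1"
  by (rule ext[of _ T0 T0]; simp add: bisect_Dom KSEQ_eq R_eq)+

lemma COMP_eq: "F \<in> Dom M (T1 \<rightarrow> T1) \<Longrightarrow> k \<in> N \<Longrightarrow> COMP \<bullet> F \<bullet> k = F \<bullet> (KSEQ \<bullet> k)"
  by (simp add: COMP_def comp_c_def)

lemma POS_eq:
  assumes "r \<in> Dom M (T0 \<rightarrow> T1)" "k \<in> N" "m \<in> N"
  shows "POS \<bullet> r \<bullet> k \<bullet> m = Z \<longleftrightarrow> h m + h m < A (r \<bullet> k) m"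
proof -
  let ?p = "frac_add (frac_pow (v 0)) (frac_pow (v 0))" and ?q = "apx (Var (T0 \<rightarrow> T1) 0 \<cdot> v 1) (v 0)"
  let ?e = "scons T0 m (scons T0 k (scons (T0 \<rightarrow> T1) r dflt))"
  have fok: "fok e ?p" "fok e ?q" if "is_env M e" for e using that by simp_all
  have typing: "wt D (frac_less_char ?p ?q)" "ty_of (frac_less_char ?p ?q) = T0"
    using tmN_frac_less_char[OF fok(1) fok(2), of dflt] by auto
  have "POS \<bullet> r \<bullet> k \<bullet> m = eval M ?e (frac_less_char ?p ?q)"
    using assms typing by (simp add: POS_def pos_c_def del: frac_less_char.simps frac_add.simps)
  moreover have "is_env M ?e" using assms by simp
  ultimately show ?thesis
    using frac_less_char_eq[OF fok(1) fok(2), of ?e] assms by simp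
qed

lemma val_MID: "a \<in> N \<Longrightarrow> b \<in> N \<Longrightarrow> val (MID a b) = (val a + val b) / 2"
proof -
  assume ab: "a \<in> N" "b \<in> N"
  let ?e = "scons T0 a (scons T0 b dflt)"
  obtain x y w where f: "frac_add (decode (v 0)) (decode (v 1)) = (x, y, w)"
    by (cases "frac_add (decode (v 0)) (decode (v 1))")
  have "fok ?e (frac_add (decode (v 0)) (decode (v 1)))" using ab by simp
  then have t: "tmN x" "tmN y" "tmN w" "is_env M ?e" and pos: "0 < nu (eval M ?e w)"
    unfolding f fok_def by auto
  have "fval ?e (x, y, w) = fval ?e (decode (v 0)) + fval ?e (decode (v 1))"
    unfolding f[symmetric] using ab by (intro fval_add) auto
  also have "\<dots> = val a + val b"
    using ab by simp
  finally have val: "(nu (eval M ?e x) - nu (eval M ?e y)) / nu (eval M ?e w) = val a + val b"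
    by (simp add: fval_def)
  let ?w = "eval M ?e w"
  have w: "?w \<oplus> ?w \<in> N" "nu (?w \<oplus> ?w) = nu ?w + nu ?w" using t by simp_all
  then have "?w \<oplus> ?w \<noteq> Z" using pos nu_eq_0[OF w(1)] by auto
  then have "?w \<oplus> ?w = S (PRED \<bullet> (?w \<oplus> ?w))" using N_cases[OF w(1)] by blast
  then have p: "nu (PRED \<bullet> (?w \<oplus> ?w)) + 1 = nu ?w + nu ?w"
    using w by (metis nu_S N_closed(3))
  have "MID a b = PAIR \<bullet> (PAIR \<bullet> eval M ?e x \<bullet> eval M ?e y) \<bullet> (PRED \<bullet> (?w \<oplus> ?w))"
    by (simp add: MID_def half_sum_def f[unfolded One_nat_def] del: eval_bisect)
  from this have "val (MID a b) = (nu (eval M ?e x) - nu (eval M ?e y)) / (nu ?w + nu ?w)"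
    using t w p by simp
  also have "\<dots> = (nu (eval M ?e x) - nu (eval M ?e y)) / nu ?w / 2"
    by (simp add: mult_2[symmetric] mult.commute)
  finally show ?thesis unfolding val .
qed

lemma bisect_rec:
  assumes "\<phi> \<in> Dom M T2" "r \<in> Dom M (T0 \<rightarrow> T1)"
  defines "B \<equiv> \<lambda>n. BISECT \<bullet> \<phi> \<bullet> r \<bullet> n"
  defines "m \<equiv> \<lambda>n. MID (FST \<bullet> B n) (SND \<bullet> B n)"
  shows "B Z = PAIR \<bullet> Z \<bullet> (R1 \<bullet> Z)"
    and "n \<in> N \<Longrightarrow> B (S n) = (if \<phi> \<bullet> (POS \<bullet> r \<bullet> m n) = Z then PAIR \<bullet> m n \<bullet> (SND \<bullet> B n) else PAIR \<bullet> (FST \<bullet> B n) \<bullet> m n)"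
proof -
  show "B Z = PAIR \<bullet> Z \<bullet> (R1 \<bullet> Z)"
    using assms(1,2) by (simp add: B_def BISECT_def bisect_c_def eval_rec)
  assume n: "n \<in> N"
  have BN: "B n \<in> N" using n assms(1,2) by (simp add: B_def bisect_Dom)
  have N: "m n \<in> N" "POS \<bullet> r \<bullet> m n \<in> Dom M T1" using BN assms(2) by (simp_all add: m_def bisect_Dom)
  have "B (S n) = COND \<bullet> (\<phi> \<bullet> (POS \<bullet> r \<bullet> m n)) \<bullet> (PAIR \<bullet> m n \<bullet> (SND \<bullet> B n)) \<bullet> (PAIR \<bullet> (FST \<bullet> B n) \<bullet> m n)"
    using n assms(1,2)
    by (simp add: m_def B_def BISECT_def bisect_c_def eval_rec bisect_step_def Let_def
        eval_scons_indep[where d = "S n" and d' = n for n])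
  then show "B (S n) = (if \<phi> \<bullet> (POS \<bullet> r \<bullet> m n) = Z then PAIR \<bullet> m n \<bullet> (SND \<bullet> B n) else PAIR \<bullet> (FST \<bullet> B n) \<bullet> m n)"
    using N BN assms(1) by (simp add: cond_eq)
qed

lemma ends_rec:
  assumes "\<phi> \<in> Dom M T2" "r \<in> Dom M (T0 \<rightarrow> T1)"
  defines "L \<equiv> LEFT \<bullet> \<phi> \<bullet> r" and "R \<equiv> RIGHT \<bullet> \<phi> \<bullet> r"
  shows "L \<bullet> Z = Z" "R \<bullet> Z = R1 \<bullet> Z"
    and "n \<in> N \<Longrightarrow> L \<bullet> S n = (if \<phi> \<bullet> (POS \<bullet> r \<bullet> MID (L \<bullet> n) (R \<bullet> n)) = Z then MID (L \<bullet> n) (R \<bullet> n) else L \<bullet> n)"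
    and "n \<in> N \<Longrightarrow> R \<bullet> S n = (if \<phi> \<bullet> (POS \<bullet> r \<bullet> MID (L \<bullet> n) (R \<bullet> n)) = Z then R \<bullet> n else MID (L \<bullet> n) (R \<bullet> n))"
proof -
  have L: "L \<bullet> n = FST \<bullet> (BISECT \<bullet> \<phi> \<bullet> r \<bullet> n)" and R: "R \<bullet> n = SND \<bullet> (BISECT \<bullet> \<phi> \<bullet> r \<bullet> n)" if "n \<in> N" for n
    using that assms(1,2) by (simp_all add: L_def R_def LEFT_def left_c_def RIGHT_def right_c_def)
  show "L \<bullet> Z = Z" "R \<bullet> Z = R1 \<bullet> Z"
    using bisect_rec(1)[OF assms(1,2)] by (simp_all add: L R)
  assume n: "n \<in> N"
  have N: "FST \<bullet> (BISECT \<bullet> \<phi> \<bullet> r \<bullet> n) \<in> N" "SND \<bullet> (BISECT \<bullet> \<phi> \<bullet> r \<bullet> n) \<in> N"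
    using bisect_Dom(3)[OF assms(1,2) n] by simp_all
  show "L \<bullet> S n = (if \<phi> \<bullet> (POS \<bullet> r \<bullet> MID (L \<bullet> n) (R \<bullet> n)) = Z then MID (L \<bullet> n) (R \<bullet> n) else L \<bullet> n)"
    "R \<bullet> S n = (if \<phi> \<bullet> (POS \<bullet> r \<bullet> MID (L \<bullet> n) (R \<bullet> n)) = Z then R \<bullet> n else MID (L \<bullet> n) (R \<bullet> n))"
    using bisect_rec(2)[OF assms(1,2) n] n N by (simp_all add: L R bisect_Dom)
qed

text \<open>The invariants of the bisection hold at all stages, not only at the standard ones.\<close>

context
  fixes \<phi> r L R
  assumes \<phi>: "\<phi> \<in> Dom M T2" and r: "r \<in> Dom M (T0 \<rightarrow> T1)"
    and L_eq: "L = LEFT \<bullet> \<phi> \<bullet> r" and R_def: "R = RIGHT \<bullet> \<phi> \<bullet> r"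
begin

lemma LR_Dom [simp]: "L \<in> Dom M T1" "R \<in> Dom M T1"
  using \<phi> r by (simp_all add: L_eq R_def bisect_Dom)

lemmas LR_rec = ends_rec[OF \<phi> r, folded L_eq R_def]

lemma gap: "n \<in> N \<Longrightarrow> val (L \<bullet> n) + h n = val (R \<bullet> n)"
proof -
  assume n: "n \<in> N"
  let ?l = "decode (Var T1 0 \<cdot> v 0)" and ?r = "decode (Var T1 1 \<cdot> v 0)"
  \<comment> \<open>An equation between rationals, expressed by two quantifier-free
    inequalities.\<close>
  let ?A = "frac_le (frac_add ?l (frac_pow (v 0))) ?r \<^bold>\<and> frac_le ?r (frac_add ?l (frac_pow (v 0)))"
  have sat: "sat M (scons T0 n (scons T1 L (scons T1 R dflt))) ?A \<longleftrightarrow> val (L \<bullet> n) + h n = val (R \<bullet> n)"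
    if "n \<in> N" for n using that by auto
  have "sat M (scons T0 n (scons T1 L (scons T1 R dflt))) ?A"
  proof (rule qf_ind)
    show "wf D ?A" using wf_fracs(2)[of dflt "frac_add ?l (frac_pow (v 0))" ?r] wf_fracs(2)[of dflt ?r "frac_add ?l (frac_pow (v 0))"]
      by simp
    show "sat M (scons T0 Z (scons T1 L (scons T1 R dflt))) ?A"
      unfolding sat[OF Dom_consts(1)] by (simp add: LR_rec R_eq)
    fix n assume n: "n \<in> N" "sat M (scons T0 n (scons T1 L (scons T1 R dflt))) ?A"
    then have IH: "val (L \<bullet> n) + h n = val (R \<bullet> n)" using sat by blast
    have "val (MID (L \<bullet> n) (R \<bullet> n)) = (val (L \<bullet> n) + val (R \<bullet> n)) / 2"
      using n by (simp add: val_MID)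
    then have "val (L \<bullet> S n) + h (S n) = val (R \<bullet> S n)"
      using IH n by (simp add: LR_rec field_simps)
    then show "sat M (scons T0 (S n) (scons T1 L (scons T1 R dflt))) ?A"
      using sat n by simp
  qed (use n in auto)
  with sat[OF n] show ?thesis by simp
qed

lemma LR_mono:
  assumes n: "n \<in> N" and m: "m \<in> N" and le: "nu n \<le> nu m"
  shows "val (L \<bullet> n) \<le> val (L \<bullet> m) \<and> val (R \<bullet> m) \<le> val (R \<bullet> n)"
proof -
  obtain i where i: "i \<in> N" "m = n \<oplus> i" using nu_le_cases[OF n m le] by blast
  let ?l = "\<lambda>t. decode (Var T1 0 \<cdot> t)" and ?r = "\<lambda>t. decode (Var T1 1 \<cdot> t)" and ?ni = "add (v 1) (v 0)"
  let ?A = "frac_le (?l (v 1)) (?l ?ni) \<^bold>\<and> frac_le (?r ?ni) (?r (v 1))"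
  let ?e = "\<lambda>i. scons T0 i (scons T0 n (scons T1 L (scons T1 R dflt)))"
  have sat: "sat M (?e i) ?A \<longleftrightarrow> val (L \<bullet> n) \<le> val (L \<bullet> (n \<oplus> i)) \<and> val (R \<bullet> (n \<oplus> i)) \<le> val (R \<bullet> n)"
    if "i \<in> N" for i using that n by auto
  have "sat M (?e i) ?A"
  proof (rule qf_ind)
    show "wf D ?A" using wf_fracs(2)[of dflt "?l (v 1)" "?l ?ni"] wf_fracs(2)[of dflt "?r ?ni" "?r (v 1)"]
      by simp
    show "sat M (?e Z) ?A"
      unfolding sat[OF Dom_consts(1)] using n by simp
    fix i assume i: "i \<in> N" "sat M (?e i) ?A"
    then have IH: "val (L \<bullet> n) \<le> val (L \<bullet> (n \<oplus> i))" "val (R \<bullet> (n \<oplus> i)) \<le> val (R \<bullet> n)"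
      using sat by blast+
    have k: "n \<oplus> i \<in> N" using n i by simp
    have mid: "val (MID (L \<bullet> (n \<oplus> i)) (R \<bullet> (n \<oplus> i))) = (val (L \<bullet> (n \<oplus> i)) + val (R \<bullet> (n \<oplus> i))) / 2"
      using k by (simp add: val_MID)
    have "val (L \<bullet> (n \<oplus> i)) < val (R \<bullet> (n \<oplus> i))"
      using gap[OF k] h_pos[OF k] by linarith
    with mid have "val (L \<bullet> (n \<oplus> i)) \<le> val (MID (L \<bullet> (n \<oplus> i)) (R \<bullet> (n \<oplus> i)))"
      "val (MID (L \<bullet> (n \<oplus> i)) (R \<bullet> (n \<oplus> i))) \<le> val (R \<bullet> (n \<oplus> i))"
      by (simp_all add: field_simps)
    then have "val (L \<bullet> n) \<le> val (L \<bullet> (n \<oplus> S i)) \<and> val (R \<bullet> (n \<oplus> S i)) \<le> val (R \<bullet> n)"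
      using IH n i k LR_rec(3,4)[OF k] by auto
    then show "sat M (?e (S i)) ?A"
      using sat i by simp
  qed (use n i in auto)
  with sat[OF i(1)] i(2) show ?thesis by simp
qed

lemma LR_bounds: "n \<in> N \<Longrightarrow> 0 \<le> val (L \<bullet> n) \<and> val (L \<bullet> n) < val (R \<bullet> n) \<and> val (R \<bullet> n) \<le> 1"
proof -
  assume n: "n \<in> N"
  have "val (L \<bullet> Z) = 0" "val (R \<bullet> Z) = 1" by (simp_all add: LR_rec R_eq)
  moreover have "val (L \<bullet> Z) \<le> val (L \<bullet> n) \<and> val (R \<bullet> n) \<le> val (R \<bullet> Z)"
    using n by (intro LR_mono) auto
  ultimately show ?thesis
    using gap[OF n] h_pos[OF n] by linarith
qed

text \<open>The right end point is never judged positive, and the left one always is, unless it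
  still is the initial 0, where only the weak inequality from \<open>Cbar\<close> is at
  hand.\<close>

lemma LR_sign:
  assumes "\<phi> \<bullet> (POS \<bullet> r \<bullet> (R1 \<bullet> Z)) \<noteq> Z" "n \<in> N"
  shows "\<phi> \<bullet> (POS \<bullet> r \<bullet> (R \<bullet> n)) \<noteq> Z" "L \<bullet> n = Z \<or> \<phi> \<bullet> (POS \<bullet> r \<bullet> (L \<bullet> n)) = Z"
proof -
  let ?p = "\<lambda>t. Var T2 0 \<cdot> (pos_c \<cdot> Var (T0 \<rightarrow> T1) 0 \<cdot> t)"
  let ?A = "\<^bold>\<not> (?p (Var T1 1 \<cdot> v 0) \<^bold>= zero) \<^bold>\<and>
    (\<^bold>\<not> (Var T1 0 \<cdot> v 0 \<^bold>= zero) \<^bold>\<longrightarrow> ?p (Var T1 0 \<cdot> v 0) \<^bold>= zero)"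
  let ?e = "\<lambda>n. scons T0 n (scons T1 L (scons T1 R (scons T2 \<phi> (scons (T0 \<rightarrow> T1) r dflt))))"
  have sat: "sat M (?e n) ?A \<longleftrightarrow> \<phi> \<bullet> (POS \<bullet> r \<bullet> (R \<bullet> n)) \<noteq> Z \<and> (L \<bullet> n = Z \<or> \<phi> \<bullet> (POS \<bullet> r \<bullet> (L \<bullet> n)) = Z)" for n
    by auto
  have "sat M (?e n) ?A"
  proof (rule qf_ind)
    show "sat M (?e Z) ?A" unfolding sat using assms by (simp add: LR_rec)
    fix n assume "n \<in> N" "sat M (?e n) ?A"
    then show "sat M (?e (S n)) ?A" unfolding sat by (simp add: LR_rec)
  qed (use assms \<phi> r in auto)
  then show "\<phi> \<bullet> (POS \<bullet> r \<bullet> (R \<bullet> n)) \<noteq> Z" "L \<bullet> n = Z \<or> \<phi> \<bullet> (POS \<bullet> r \<bullet> (L \<bullet> n)) = Z"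
    unfolding sat by auto
qed

text \<open>Later left ends stay in the j-th interval, of length 2^-j, and strictly below its right
  end.\<close>

lemma A_L: "n \<in> N \<Longrightarrow> A L n = val (L \<bullet> n)"
proof (rule A_eq_val)
  fix i j assume ij: "i \<in> N" "j \<in> N" "nu j < nu i"
  then have "val (L \<bullet> j) \<le> val (L \<bullet> i)" "val (R \<bullet> i) \<le> val (R \<bullet> j)"
    using LR_mono[of j i] by auto
  then show "\<bar>val (L \<bullet> j) - val (L \<bullet> i)\<bar> < h j"
    using LR_bounds[OF ij(1)] gap[OF ij(2)] by (simp add: abs_if)
qed auto

lemma runit_L: "runit K L"
  unfolding runit_def rle_def
proof (intro conjI ballI impI)
  fix m assume m: "m \<in> N"
  show "A R0 m \<le> A L m + (h m + h m)" "A L m \<le> A R1 m + (h m + h m)"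
    using A_R0[OF m] A_R1[OF m] A_L[OF m] h_pos[OF m] LR_bounds[OF m] by linarith+
qed

lemma runit_ends: "n \<in> N \<Longrightarrow> runit K (KSEQ \<bullet> (L \<bullet> n))" "n \<in> N \<Longrightarrow> runit K (KSEQ \<bullet> (R \<bullet> n))"
proof -
  assume n: "n \<in> N"
  have "runit K (KSEQ \<bullet> k)" if "k \<in> N" "0 \<le> val k" "val k \<le> 1" for k
    unfolding runit_def rle_def
  proof (intro conjI ballI impI)
    fix m assume m: "m \<in> N"
    show "A R0 m \<le> A (KSEQ \<bullet> k) m + (h m + h m)" "A (KSEQ \<bullet> k) m \<le> A R1 m + (h m + h m)"
      using A_R0[OF m] A_R1[OF m] A_KSEQ[OF that(1) m] h_pos[OF m] that(2,3) by linarith+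
  qed
  then show "runit K (KSEQ \<bullet> (L \<bullet> n))" "runit K (KSEQ \<bullet> (R \<bullet> n))"
    using LR_bounds[OF n] n by auto
qed

end

end

lemma wf_reals [simp]:
  assumes "wt D x" "ty_of x = T1" "wt D y" "ty_of y = T1"
  shows "wf D (real_eq x y)" "wf D (real_le x y)" "wt D k \<Longrightarrow> ty_of k = T0 \<Longrightarrow> wf D (real_near x y k)"
  using assms by (simp_all add: real_eq_def real_le_def real_near_def apx_def decode_def frac_pow_def le_def lt_def)

lemma wf_in_unit [simp]: "wt D x \<Longrightarrow> ty_of x = T1 \<Longrightarrow> wf D (in_unit x)"
  by (simp add: in_unit_def)

lemma wf_C_bar_unit [simp]: "wf D C_bar_unit"
  by (simp add: C_bar_unit_def C_unit_def real_function_def)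

lemma wf_principles: "wf D (relat exists2)" "wf D Pi01_TRANS" "wf D IVT_star" "wf D E_UIVT_st"
  by (simp_all add: exists2_def Pi01_TRANS_def IVT_star_def E_UIVT_st_def E_st_def UIVT_matrix_def
      standard_extensional_def approx_def Let_def)

section \<open>Correctness of the bisection and its use of transfer\<close>

context num_model
begin

text \<open>A substitute for the Archimedean property. With |val x| = a/d and 2^-n = 1/P the gap is
  (aP - d)/(dP), at least 1/(dP) by discreteness. Hence k = dP works, and it is standard because the
  code and n are.\<close>

lemma arch:
  assumes x: "x \<in> N" "st x" and n: "n \<in> N" "st n" and less: "h n < \<bar>val x\<bar>"
  obtains k where "k \<in> N" "st k" "h k < \<bar>val x\<bar> - h n"
proof -
  define a d P where "a = DIST \<bullet> (FST \<bullet> (FST \<bullet> x)) \<bullet> (SND \<bullet> (FST \<bullet> x))"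
    and "d = S (SND \<bullet> x)" and "P = POW2 \<bullet> n"
  have N: "a \<in> N" "d \<in> N" "P \<in> N" "st a" "st d" "st P"
    using x n by (simp_all add: a_def d_def P_def)
  have P: "0 < nu P" "h n = 1 / nu P" using n by (simp_all add: P_def h_def)
  have d: "0 < nu d" "nu d = nu (SND \<bullet> x) + 1" using x by (simp_all add: d_def add_nonneg_pos)
  have val: "\<bar>val x\<bar> = nu a / nu d"
    using x d by (simp add: val_def a_def dist_eq abs_divide)
  have "nu d < nu a * nu P"
    using less P(1) d(1) unfolding val P(2) by (simp add: field_simps)
  then have le: "nu d + 1 \<le> nu a * nu P"
    using nu_less_iff[of d "a \<otimes> P"] N by simp
  define k where "k = d \<otimes> P"
  have k: "k \<in> N" "st k" "nu k = nu d * nu P" using N by (simp_all add: k_def)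
  have kpos: "0 < nu k" using k d P by simp
  have "h k < 1 / nu k"
    unfolding h_def using pow2_ge[OF k(1)] kpos by (intro divide_strict_left_mono) (auto intro: mult_pos_pos)
  also have "1 / nu k \<le> (nu a * nu P - nu d) / nu k"
    using le kpos by (intro divide_right_mono) auto
  also have "\<dots> = \<bar>val x\<bar> - h n"
    unfolding val P(2) k(3) using P(1) d(1) by (simp add: field_simps)
  finally show thesis using that k by blast
qed

lemma A_cauchy':
  assumes "x \<in> Dom M T1" "n \<in> N" "m \<in> N"
  shows "\<bar>A x n - A x m\<bar> < h n \<or> \<bar>A x n - A x m\<bar> < h m"
  using A_cauchy[OF assms] A_cauchy[OF assms(1,3,2)] linear[of "nu n" "nu m"] by (auto simp: abs_minus_commute)

text \<open>If the value at the limit were visibly nonzero, continuity would force the same sign on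
  the function at both ends of a short standard interval, against the signs that the bisection
  maintains there.\<close>

lemma bisection_converges:
  assumes \<phi>: "EX2 \<phi>" and F: "F \<in> Dom M (T1 \<rightarrow> T1)" "st F" and C: "Cbar F"
  shows "req st (F \<bullet> (LEFT \<bullet> \<phi> \<bullet> (COMP \<bullet> F))) R0"
proof -
  define r L R where "r = COMP \<bullet> F" and "L = LEFT \<bullet> \<phi> \<bullet> r" and "R = RIGHT \<bullet> \<phi> \<bullet> r"
  have \<phi>': "\<phi> \<in> Dom M T2" "st \<phi>" using \<phi> by (auto simp: EX2_def)
  have r: "r \<in> Dom M (T0 \<rightarrow> T1)" "st r" using F by (simp_all add: r_def bisect_Dom bisect_Std)
  note LR = \<phi>'(1) r(1) L_def R_def
  have LR_Dom: "L \<in> Dom M T1" "R \<in> Dom M T1" "st L" "st R"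
    using \<phi>' r by (simp_all add: L_def R_def bisect_Dom bisect_Std)
  have pos: "\<phi> \<bullet> (POS \<bullet> r \<bullet> k) = Z \<longleftrightarrow> (\<exists>m\<in>N. st m \<and> h m + h m < A (F \<bullet> (KSEQ \<bullet> k)) m)"
    if k: "k \<in> N" "st k" for k
  proof -
    have "POS \<bullet> r \<bullet> k \<in> Dom M T1" "st (POS \<bullet> r \<bullet> k)"
      using r k by (simp_all add: bisect_Dom bisect_Std)
    then have "\<phi> \<bullet> (POS \<bullet> r \<bullet> k) = Z \<longleftrightarrow> (\<exists>m\<in>N. st m \<and> POS \<bullet> r \<bullet> k \<bullet> m = Z)"
      using \<phi> unfolding EX2_def by blast
    then show ?thesis
      using POS_eq[OF r(1) k(1)] COMP_eq[OF F(1) k(1)] by (auto simp: r_def)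
  qed
  have R1Z: "R1 \<bullet> Z \<in> N" "st (R1 \<bullet> Z)" using Std_app[of R1 T0 T0 Z] by auto
  have start: "\<phi> \<bullet> (POS \<bullet> r \<bullet> (R1 \<bullet> Z)) \<noteq> Z"
    unfolding pos[OF R1Z] KSEQ_ends using C by (auto simp: Cbar_def rle_def A_R0 not_less)
  define x where "x = F \<bullet> L"
  have x: "x \<in> Dom M T1" "st x"
    using F LR_Dom Std_app[of F T1 T1 L] by (auto simp: x_def)
  have "\<bar>A x n\<bar> \<le> h n" if n: "n \<in> N" "st n" for n
  proof (rule ccontr)
    assume "\<not> \<bar>A x n\<bar> \<le> h n"
    then have "h n < \<bar>val (HAT \<bullet> x \<bullet> n)\<bar>" by (simp add: A_def)
    moreover have "HAT \<bullet> x \<bullet> n \<in> N" "st (HAT \<bullet> x \<bullet> n)"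
      using x n Std_app[of HAT T1 T1 x] Std_app[of "HAT \<bullet> x" T0 T0 n] by auto
    ultimately obtain k where k: "k \<in> N" "st k" and kless: "h k < \<bar>A x n\<bar> - h n"
      unfolding A_def using arch[OF _ _ n] by blast
    \<comment> \<open>Continuity is applied with 2^-(k+1). The other half of 2^-k absorbs the error
      2^-m of the stage m at which nearness will be attested.\<close>
    have hk: "h k = h (S k) + h (S k)" using k by simp
    have "rcont F" "runit st L" using C runit_L[OF LR] by (auto simp: Cbar_def)
    moreover have "S k \<in> N" "st (S k)" using k by auto
    ultimately obtain i where i: "i \<in> N" "st i" and
      cont: "\<And>y. y \<in> Dom M T1 \<Longrightarrow> st y \<Longrightarrow> runit st y \<Longrightarrow> near L y i \<Longrightarrow> near x (F \<bullet> y) (S k)"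
      using LR_Dom(1,3) unfolding rcont_def x_def by meson
    \<comment> \<open>Nearness at stage j requires 2^-j for the distance and twice 2^-j for the
      errors to remain below 2^-i.\<close>
    define j where "j = S (S i)"
    have j: "j \<in> N" "st j" "4 * h j = h i" "0 < h j" using i by (simp_all add: j_def)
    have ends: "L \<bullet> j \<in> N" "st (L \<bullet> j)" "R \<bullet> j \<in> N" "st (R \<bullet> j)"
      using LR_Dom j Std_app[of L T0 T0 j] Std_app[of R T0 T0 j] by auto
    \<comment> \<open>The end point at which the sign of the function contradicts that of the
      supposed limit value.\<close>
    define c where "c = (if 0 < A x n then R \<bullet> j else L \<bullet> j)"
    have c: "c \<in> N" "st c" using ends by (auto simp: c_def)
    define y where "y = KSEQ \<bullet> c"
    have y: "y \<in> Dom M T1" "st y" using c by (simp_all add: y_def bisect_Dom bisect_Std)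
    have "runit st y" using runit_ends[OF LR j(1)] by (simp add: y_def c_def)
    moreover have "near L y i"
      unfolding near_def
    proof (intro bexI conjI)
      have "\<bar>A L j - A y j\<bar> \<le> h j"
        using A_L[OF LR j(1)] A_KSEQ[OF c(1) j(1)] gap[OF LR j(1)] j(4) by (auto simp: y_def c_def)
      then show "\<bar>A L j - A y j\<bar> + (h j + h j) < h i" using j(3,4) by linarith
    qed (use j in auto)
    ultimately have "near x (F \<bullet> y) (S k)" using cont y by blast
    then obtain m where m: "m \<in> N" "st m" "\<bar>A x m - A (F \<bullet> y) m\<bar> + (h m + h m) < h (S k)"
      unfolding near_def by blast
    have hm: "0 < h m" "0 < h n" using m n by auto
    have near_xm: "\<bar>A x n - A x m\<bar> < h n + h m" using A_cauchy'[OF x(1) n(1) m(1)] hm by linarith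
    show False
    proof (cases "0 < A x n")
      case True
      then have "\<phi> \<bullet> (POS \<bullet> r \<bullet> c) \<noteq> Z" using LR_sign(1)[OF LR start j(1)] by (simp add: c_def)
      then have "A (F \<bullet> y) m \<le> h m + h m" using pos[OF c] m by (auto simp: y_def not_less)
      then show False using True m(3) near_xm kless hk hm by (simp add: abs_if split: if_splits)
    next
      case False
      then have y_eq: "y = KSEQ \<bullet> (L \<bullet> j)" "c = L \<bullet> j" by (simp_all add: y_def c_def)
      have "- (h m + h m) \<le> A (F \<bullet> y) m"
      proof (cases "L \<bullet> j = Z")
        case True
        then have "y = R0" using KSEQ_ends by (simp add: y_eq)
        then have "A R0 m \<le> A (F \<bullet> y) m + (h m + h m)" using C m by (simp add: Cbar_def rle_def)
        then show ?thesis using A_R0[OF m(1)] by simp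
      next
        case nz: False
        then have "\<phi> \<bullet> (POS \<bullet> r \<bullet> c) = Z" using LR_sign(2)[OF LR start j(1)] y_eq by simp
        \<comment> \<open>Positivity is attested at some stage l unrelated to m. Changing the stage
          costs less than 2^-l or less than 2^-m, and the weak lower bound survives in both
          cases.\<close>
        then obtain l where l: "l \<in> N" "h l + h l < A (F \<bullet> y) l"
          using pos[OF c] by (auto simp: y_def)
        have hl: "0 < h l" and "F \<bullet> y \<in> Dom M T1" using l F y by auto
        from A_cauchy'[OF this(2) l(1) m(1)] show ?thesis
          using l(2) hl hm by (elim disjE) linarith+
      qed
      then show False using False m(3) near_xm kless hk hm by (simp add: abs_if split: if_splits)
    qed
  qed
  then show ?thesis
    unfolding req_def by (simp add: A_R0 x_def L_def r_def)
qed

text \<open>For standard reals, equality says that a standard sequence of characteristic values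
  vanishes everywhere, which is what transfer extends from standard to all stages.\<close>

lemma TRANS_req:
  assumes TRANS and x: "x \<in> Dom M T1" "st x" and y: "y \<in> Dom M T1" "st y" and req: "req st x y"
  shows "req full x y"
proof -
  let ?p = "frac_pow (v 0)" and ?q = "frac_dist (apx (Var T1 0) (v 0)) (apx (Var T1 1) (v 0))"
  have fok: "fok e ?p" "fok e ?q" if "is_env M e" for e using that by simp_all
  have typing: "wt D (frac_less_char ?p ?q)" "ty_of (frac_less_char ?p ?q) = T0"
    using tmN_frac_less_char[OF fok(1) fok(2), of dflt] by auto
  define f where "f = eval M (scons T1 x (scons T1 y dflt)) (lam T0 (monus (suc zero) (frac_less_char ?p ?q)))"
  have f: "f \<in> Dom M T1" "st f"
    unfolding f_def using typing x y by (auto simp del: frac_less_char.simps frac_dist.simps intro!: eval_in Std_eval)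
  have f_eq: "f \<bullet> n = Z \<longleftrightarrow> \<bar>A x n - A y n\<bar> \<le> h n" if n: "n \<in> N" for n
  proof -
    let ?e = "scons T0 n (scons T1 x (scons T1 y dflt))"
    have e: "is_env M ?e" using n x y by simp
    have N: "eval M ?e (frac_less_char ?p ?q) \<in> N" using typing e by (intro eval_in)
    have "f \<bullet> n = S Z \<ominus> eval M ?e (frac_less_char ?p ?q)"
      using typing n x y by (simp add: f_def del: frac_less_char.simps frac_dist.simps)
    then have "f \<bullet> n = Z \<longleftrightarrow> \<not> h n < \<bar>A x n - A y n\<bar>"
      using N frac_less_char_eq[OF fok(1) fok(2), of ?e] e by (simp add: one_monus)
    then show ?thesis by (simp add: not_less)
  qed
  have "\<forall>n\<in>N. f \<bullet> n = Z"
    using assms(1) f req f_eq unfolding TRANS_def req_def by blast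
  then show ?thesis
    using f_eq unfolding req_def by blast
qed

text \<open>Agreement at rationals k and stages n is a universal statement about the pair of k and
  n. Transfer extends it from standard to all pairs, whence the two restrictions are equal outright,
  and with them all that the bisection computes.\<close>

lemma TRANS_COMP:
  assumes TRANS and F: "F \<in> Dom M (T1 \<rightarrow> T1)" "st F" and G: "G \<in> Dom M (T1 \<rightarrow> T1)" "st G"
    and eq: "\<And>x n. x \<in> Dom M T1 \<Longrightarrow> st x \<Longrightarrow> n \<in> N \<Longrightarrow> st n \<Longrightarrow> F \<bullet> x \<bullet> n = G \<bullet> x \<bullet> n"
  shows "COMP \<bullet> F = COMP \<bullet> G"
proof -
  let ?R = "T0 \<rightarrow> T1"
  let ?e = "scons ?R (COMP \<bullet> F) (scons ?R (COMP \<bullet> G) dflt)"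
  have CD: "COMP \<bullet> F \<in> Dom M ?R" "COMP \<bullet> G \<in> Dom M ?R" "st (COMP \<bullet> F)" "st (COMP \<bullet> G)"
    using F G by (simp_all add: bisect_Dom bisect_Std)
  define f where "f = eval M ?e (lam T0 (dist (Var ?R 0 \<cdot> (fst_c \<cdot> v 0) \<cdot> (snd_c \<cdot> v 0))
     (Var ?R 1 \<cdot> (fst_c \<cdot> v 0) \<cdot> (snd_c \<cdot> v 0))))"
  have f: "f \<in> Dom M T1" "st f"
    unfolding f_def using CD by (auto intro!: eval_in Std_eval)
  have f_eq: "f \<bullet> z = Z \<longleftrightarrow> F \<bullet> (KSEQ \<bullet> (FST \<bullet> z)) \<bullet> (SND \<bullet> z) = G \<bullet> (KSEQ \<bullet> (FST \<bullet> z)) \<bullet> (SND \<bullet> z)"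
    if z: "z \<in> N" for z
  proof -
    let ?a = "F \<bullet> (KSEQ \<bullet> (FST \<bullet> z)) \<bullet> (SND \<bullet> z)" and ?b = "G \<bullet> (KSEQ \<bullet> (FST \<bullet> z)) \<bullet> (SND \<bullet> z)"
    have N: "?a \<in> N" "?b \<in> N" using F G z by (simp_all add: bisect_Dom)
    have "f \<bullet> z = DIST \<bullet> ?a \<bullet> ?b"
      using CD F G z by (simp add: f_def COMP_eq)
    then have "f \<bullet> z = Z \<longleftrightarrow> nu (DIST \<bullet> ?a \<bullet> ?b) = 0"
      using N nu_eq_0[of "DIST \<bullet> ?a \<bullet> ?b"] by simp
    also have "\<dots> \<longleftrightarrow> ?a = ?b" using N nu_inject[of ?a ?b] by (simp add: dist_eq)
    finally show ?thesis .
  qed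
  have "f \<bullet> z = Z" if "z \<in> N" "st z" for z
    unfolding f_eq[OF that(1)] using that by (intro eq) (auto simp: bisect_Dom bisect_Std)
  then have all: "f \<bullet> z = Z" if "z \<in> N" for z
    using assms(1) f that unfolding TRANS_def by blast
  show ?thesis
  proof (rule ext[OF CD(1,2)])
    fix k assume k: "k \<in> N"
    show "COMP \<bullet> F \<bullet> k = COMP \<bullet> G \<bullet> k"
    proof (rule ext[of _ T0 T0])
      fix n assume n: "n \<in> N"
      show "COMP \<bullet> F \<bullet> k \<bullet> n = COMP \<bullet> G \<bullet> k \<bullet> n"
        using all[of "PAIR \<bullet> k \<bullet> n"] f_eq[of "PAIR \<bullet> k \<bullet> n"] k n F G by (simp add: COMP_eq)
    qed (use CD k in auto)
  qed
qed

lemma TRANS_imp_IVT_EUIVT: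
  assumes TRANS
  shows IVT "\<exists>\<Phi>. EUIVT \<Phi>"
proof -
  obtain \<phi> where \<phi>: "EX2 \<phi>" using TRANS_imp_EX2[OF assms] ..
  have \<phi>': "\<phi> \<in> Dom M T2" "st \<phi>" using \<phi> by (auto simp: EX2_def)
  let ?L = "\<lambda>F. LEFT \<bullet> \<phi> \<bullet> (COMP \<bullet> F)"
  have L: "?L F \<in> Dom M T1" "st F \<Longrightarrow> st (?L F)" if "F \<in> Dom M (T1 \<rightarrow> T1)" for F
    using that \<phi>' by (simp_all add: bisect_Dom bisect_Std)
  show IVT
    unfolding IVT_def
  proof (intro ballI impI)
    fix F assume F: "F \<in> Dom M (T1 \<rightarrow> T1)" "st F" and C: "Cbar F"
    have "st (F \<bullet> ?L F)" using F L Std_app[of F T1 T1 "?L F"] by simp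
    then have "req full (F \<bullet> ?L F) R0"
      using F L by (intro TRANS_req[OF assms] bisection_converges[OF \<phi> F C]) auto
    moreover have "runit full (?L F)"
      using runit_L[OF \<phi>'(1) _ refl refl] F by (simp add: bisect_Dom)
    ultimately show "\<exists>x\<in>Dom M T1. st x \<and> runit full x \<and> req full (F \<bullet> x) R0"
      using L F by blast
  qed
  define \<Phi> where "\<Phi> = eval M (scons T2 \<phi> dflt) (lam (T1 \<rightarrow> T1) (left_c \<cdot> Var T2 0 \<cdot> (comp_c \<cdot> Var (T1 \<rightarrow> T1) 0)))"
  have \<Phi>: "\<Phi> \<in> Dom M ((T1 \<rightarrow> T1) \<rightarrow> T1)" "st \<Phi>"
    unfolding \<Phi>_def using \<phi>' by (auto intro!: eval_in Std_eval)
  have \<Phi>_eq: "\<Phi> \<bullet> F = ?L F" if "F \<in> Dom M (T1 \<rightarrow> T1)" for F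
    using that \<phi>' by (simp add: \<Phi>_def)
  have "EUIVT \<Phi>"
    unfolding EUIVT_def
  proof (intro conjI ballI impI \<Phi>)
    fix F assume "F \<in> Dom M (T1 \<rightarrow> T1)" "st F" "Cbar F"
    then show "req st (F \<bullet> (\<Phi> \<bullet> F)) R0"
      using bisection_converges[OF \<phi>] by (simp add: \<Phi>_eq)
  next
    fix F G n
    assume FG: "F \<in> Dom M (T1 \<rightarrow> T1)" "st F" "G \<in> Dom M (T1 \<rightarrow> T1)" "st G"
      and eq: "\<forall>x\<in>Dom M T1. st x \<longrightarrow> (\<forall>n\<in>N. st n \<longrightarrow> F \<bullet> x \<bullet> n = G \<bullet> x \<bullet> n)"
    have "COMP \<bullet> F = COMP \<bullet> G"
      by (rule TRANS_COMP[OF assms FG]) (use eq in blast)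
    then show "\<Phi> \<bullet> F \<bullet> n = \<Phi> \<bullet> G \<bullet> n"
      using FG by (simp add: \<Phi>_eq)
  qed
  then show "\<exists>\<Phi>. EUIVT \<Phi>" ..
qed

lemma principles_equivalent:
  assumes D: "D T2 i = Some exists2_spec" and e: "is_env M e"
  shows "sat M e (relat exists2) \<longleftrightarrow> sat M e Pi01_TRANS" "sat M e Pi01_TRANS \<longleftrightarrow> sat M e IVT_star"
    "sat M e IVT_star \<longleftrightarrow> sat M e E_UIVT_st"
  using EX2_imp_TRANS[OF D] TRANS_imp_EX2 TRANS_imp_IVT_EUIVT IVT_imp_TRANS EUIVT_imp_EX2
  unfolding sat_exists2[OF e] sat_Pi01_TRANS[OF e] sat_IVT_star[OF e] sat_E_UIVT_st[OF e] by blast+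

end

lemma no_counterexample: "\<not> counterexample M"
proof
  assume "counterexample M"
  then obtain D i e A where "num_model D the_counterexample field_of" and D: "D T2 i = Some exists2_spec"
    and e: "is_env the_counterexample e" "\<not> sat the_counterexample e A"
    and A: "A \<in> {relat exists2 \<^bold>\<longleftrightarrow> Pi01_TRANS, Pi01_TRANS \<^bold>\<longleftrightarrow> IVT_star, IVT_star \<^bold>\<longleftrightarrow> E_UIVT_st}"
    by (rule num_model_counterexample)
  then interpret num_model D the_counterexample field_of by simp
  show False
    using principles_equivalent[OF D e(1)] e(2) A by auto
qed

theorem theorem3p10:
  fixes D :: sig
  assumes "admissible_sig D"
    and "\<exists>i. D T2 i = Some exists2_spec"
  shows "(RCA0\<Omega>[D] \<turnstile> relat exists2 \<^bold>\<longleftrightarrow> Pi01_TRANS) \<and>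
         (RCA0\<Omega>[D] \<turnstile> Pi01_TRANS \<^bold>\<longleftrightarrow> IVT_star) \<and>
         (RCA0\<Omega>[D] \<turnstile> IVT_star \<^bold>\<longleftrightarrow> E_UIVT_st)"
proof -
  have "RCA0\<Omega>[D] \<turnstile> A"
    if A: "A \<in> {relat exists2 \<^bold>\<longleftrightarrow> Pi01_TRANS, Pi01_TRANS \<^bold>\<longleftrightarrow> IVT_star, IVT_star \<^bold>\<longleftrightarrow> E_UIVT_st}" for A
  proof (rule ccontr)
    assume "\<not> (RCA0\<Omega>[D] \<turnstile> A)"
    moreover have "wf D A" using A wf_principles by auto
    ultimately obtain M :: "tm interp" and e where "ext_model D M" "is_env M e" "\<not> sat M e A"
      using completeness by blast
    with A assms(2) have "counterexample M"
      unfolding counterexample_def by blast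
    with no_counterexample show False ..
  qed
  then show ?thesis by simp
qed

end
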